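(* Let $a>0$, $h>0$, $L\in(0,ah)$, and consider the minimization problem $$\min\{\mathcal F(\gamma):\ \gamma\in\mathcal A_{a,h,L}\}.\qquad (P)$$ The following properties hold. (i) If $2L\notin(a^2,\,2ah-a^2)$ (in particular if $h\le a$), then there exists a unique solution to problem (P). (ii) If $2L\in(a^2,\,2ah-a^2)$, then there exist infinitely many solutions to problem (P).
   Context: For $z\in\mathbb R$, $z_+:=\max\{z,0\}$. An interval $(\alpha,\beta)$ with $\alpha\ge\beta$ is understood to be empty. For an absolutely continuous curve $\gamma=(\gamma_1,\gamma_2):[0,1]\to\mathbb R^2$ with $|\gamma'(t)|\ne0$ for a.e. $t\in(0,1)$, set $$\mathcal F(\gamma)=\int_0^1\frac{(\gamma_2'(t))_+^3}{(\gamma_1'(t))^2+(\gamma_2'(t))^2}\,dt .$$ For $a>0,h>0,L\in(0,ah)$, $\mathcal A_{a,h,L}$ is the set of $\gamma\in AC([0,1];[0,a]\times[0,h])$ such that $\gamma(0)=(0,0)$, $\gamma(1)=(a,h)$, $\gamma$ is simple, $|\gamma'(t)|\neq0$ for a.e. $t\in(0,1)$, $\gamma_1'(t)\ge0$ for a.e. $t\in(0,1)$, and $\int_0^1\gamma_1(t)\gamma_2'(t)\,dt=ah-L$. Curves are identified up to orientation-preserving reparametrization: $\tilde\gamma\sim\gamma$ if $\tilde\gamma=\gamma\circ\phi$ for some monotone nondecreasing map $\phi$ from $[0,1]$ onto itself; each rectifiable simple curve is represented by an absolutely continuous parametrization with $|\gamma'|\neq0$ a.e. Uniqueness and the number of solutions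 are meant with respect to this identification. *)

theory Defs
  imports "HOL-Analysis.Analysis"
begin

type_synonym curve = "real \<Rightarrow> real \<times> real"

text \<open>Only the restriction of a curve to \<open>{0..1}\<close> matters; no condition below depends on the values
  elsewhere.\<close>

definition abs_cont_on :: "real \<Rightarrow> real \<Rightarrow> (real \<Rightarrow> 'a::metric_space) \<Rightarrow> bool" where
  "abs_cont_on u v f \<longleftrightarrow>
    (\<forall>\<epsilon>>0. \<exists>\<delta>>0. \<forall>D :: (real \<times> real) set.
      finite D \<and> (\<forall>(x, y)\<in>D. u \<le> x \<and> x \<le> y \<and> y \<le> v)
      \<and> disjoint_family_on (\<lambda>(x, y). {x<..<y}) D
      \<and> (\<Sum>(x, y)\<in>D. y - x) < \<delta>
      \<longrightarrow> (\<Sum>(x, y)\<in>D. dist (f x) (f y)) < \<epsilon>)"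

text \<open>An absolutely continuous curve is differentiable almost everywhere, so the arbitrary value of
  \<^const>\<open>vector_derivative\<close> at the remaining points has no influence.\<close>

abbreviation vel :: "curve \<Rightarrow> real \<Rightarrow> real \<times> real" where
  "vel \<gamma> t \<equiv> vector_derivative \<gamma> (at t)"

definition pos_part :: "real \<Rightarrow> real" where
  "pos_part z = max z 0"

definition functional_F :: "curve \<Rightarrow> real" where
  "functional_F \<gamma> =
    (LINT t:{0..1}|lebesgue. (pos_part (snd (vel \<gamma> t))) ^ 3 / ((fst (vel \<gamma> t))\<^sup>2 + (snd (vel \<gamma> t))\<^sup>2))"

definition admissible :: "real \<Rightarrow> real \<Rightarrow> real \<Rightarrow> curve set" where
  "admissible a h L = {\<gamma>.
      abs_cont_on 0 1 \<gamma>
    \<and> \<gamma> ` {0..1} \<subseteq> {0..a} \<times> {0..h}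
    \<and> \<gamma> 0 = (0, 0) \<and> \<gamma> 1 = (a, h)
    \<and> inj_on \<gamma> {0..1}
    \<and> (AE t\<in>{0<..<1} in lebesgue. norm (vel \<gamma> t) \<noteq> 0)
    \<and> (AE t\<in>{0<..<1} in lebesgue. fst (vel \<gamma> t) \<ge> 0)
    \<and> (LINT t:{0..1}|lebesgue. fst (\<gamma> t) * snd (vel \<gamma> t)) = a * h - L}"

definition solutions :: "real \<Rightarrow> real \<Rightarrow> real \<Rightarrow> curve set" where
  "solutions a h L = {\<gamma>. is_arg_min functional_F (\<lambda>\<eta>. \<eta> \<in> admissible a h L) \<gamma>}"

definition reparam :: "curve \<Rightarrow> curve \<Rightarrow> bool" where
  "reparam \<gamma> \<gamma>' \<longleftrightarrow>
    (\<exists>\<phi> :: real \<Rightarrow> real. mono_on {0..1} \<phi> \<and> \<phi> ` {0..1} = {0..1} \<and> (\<forall>t\<in>{0..1}. \<gamma>' t = \<gamma> (\<phi> t)))"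

definition reparam_rel :: "curve set \<Rightarrow> (curve \<times> curve) set" where
  "reparam_rel S = {(\<gamma>, \<gamma>'). \<gamma> \<in> S \<and> \<gamma>' \<in> S \<and> reparam \<gamma> \<gamma>'}"

text \<open>Reparametrization as defined above is not symmetric on all curves, but it is an equivalence
  relation on sets of simple (injective) curves.\<close>

lemma reparam_refl: "reparam \<gamma> \<gamma>"
  unfolding reparam_def by (rule exI[of _ "\<lambda>t. t"]) (auto simp: mono_on_def)

lemma reparam_trans:
  assumes "reparam \<gamma> \<gamma>'" "reparam \<gamma>' \<gamma>''"
  shows "reparam \<gamma> \<gamma>''"
proof -
  obtain \<phi> :: "real \<Rightarrow> real" where \<phi>: "mono_on {0..1} \<phi>" "\<phi> ` {0..1} = {0..1}" "\<forall>t\<in>{0..1}. \<gamma>' t = \<gamma> (\<phi> t)"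
    using assms(1) unfolding reparam_def by blast
  obtain \<psi> :: "real \<Rightarrow> real" where \<psi>: "mono_on {0..1} \<psi>" "\<psi> ` {0..1} = {0..1}" "\<forall>t\<in>{0..1}. \<gamma>'' t = \<gamma>' (\<psi> t)"
    using assms(2) unfolding reparam_def by blast
  have in01: "\<psi> t \<in> {0..1}" if "t \<in> {0..1}" for t
    using \<psi>(2) that by blast
  have "mono_on {0..1} (\<phi> \<circ> \<psi>)"
    using \<phi>(1) \<psi>(1) in01 unfolding mono_on_def by (metis comp_apply)
  moreover have "(\<phi> \<circ> \<psi>) ` {0..1} = {0..1}"
    by (simp only: image_comp[symmetric] \<phi>(2) \<psi>(2))
  moreover have "\<forall>t\<in>{0..1}. \<gamma>'' t = \<gamma> ((\<phi> \<circ> \<psi>) t)"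
    using \<phi>(3) \<psi>(3) in01 by (metis comp_apply)
  ultimately show ?thesis
    unfolding reparam_def by blast
qed

lemma reparam_sym:
  assumes "reparam \<gamma> \<gamma>'" "inj_on \<gamma>' {0..1}"
  shows "reparam \<gamma>' \<gamma>"
proof -
  obtain \<phi> :: "real \<Rightarrow> real" where \<phi>: "mono_on {0..1} \<phi>" "\<phi> ` {0..1} = {0..1}" "\<forall>t\<in>{0..1}. \<gamma>' t = \<gamma> (\<phi> t)"
    using assms(1) unfolding reparam_def by blast
  have inj: "inj_on \<phi> {0..1}"
    using assms(2) \<phi>(3) unfolding inj_on_def by metis
  define \<psi> where "\<psi> = inv_into {0..1} \<phi>"
  have in01: "\<psi> t \<in> {0..1}" and \<phi>\<psi>: "\<phi> (\<psi> t) = t" if "t \<in> {0..1}" for t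
    using that \<phi>(2) unfolding \<psi>_def by (metis inv_into_into, metis f_inv_into_f)
  have "mono_on {0..1} \<psi>"
  proof (rule mono_onI)
    fix r s :: real assume rs: "r \<in> {0..1}" "s \<in> {0..1}" "r \<le> s"
    show "\<psi> r \<le> \<psi> s"
    proof (rule ccontr)
      assume "\<not> \<psi> r \<le> \<psi> s"
      then have "\<phi> (\<psi> s) \<le> \<phi> (\<psi> r)"
        using mono_onD[OF \<phi>(1)] in01 rs by (metis linear)
      then have "r = s" using \<phi>\<psi> rs by simp
      with \<open>\<not> \<psi> r \<le> \<psi> s\<close> show False by simp
    qed
  qed
  moreover have "\<psi> ` {0..1} = {0..1}"
    using inv_into_image_cancel[OF inj subset_refl] \<phi>(2) unfolding \<psi>_def by simp
  moreover have "\<forall>t\<in>{0..1}. \<gamma> t = \<gamma>' (\<psi> t)"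
    using \<phi>(3) in01 \<phi>\<psi> by metis
  ultimately show ?thesis
    unfolding reparam_def by blast
qed

lemma equiv_reparam_rel:
  assumes "\<And>\<gamma>. \<gamma> \<in> S \<Longrightarrow> inj_on \<gamma> {0..1}"
  shows "equiv S (reparam_rel S)"
proof (rule equivI)
  show "reparam_rel S \<subseteq> S \<times> S"
    unfolding reparam_rel_def by auto
  show "refl_on S (reparam_rel S)"
    unfolding reparam_rel_def refl_on_def using reparam_refl by auto
  show "sym (reparam_rel S)"
    unfolding reparam_rel_def sym_def using reparam_sym assms by auto
  show "trans (reparam_rel S)"
    unfolding reparam_rel_def trans_def using reparam_trans by blast
qed

lemma equiv_solutions: "equiv (solutions a h L) (reparam_rel (solutions a h L))"
  by (rule equiv_reparam_rel) (auto simp: solutions_def is_arg_min_def admissible_def)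

end

theory Submission
  imports Defs
begin

text \<open>Write \<open>f p q = q\<^sub>+\<^sup>3 / (p\<^sup>2 + q\<^sup>2)\<close> for the integrand.  For \<open>p \<ge> 0\<close> and a slope \<open>s \<in> [0, 1]\<close> it
  lies above its tangent plane at \<open>(1, s)\<close>, which by homogeneity has the form \<open>m q - g p\<close> with
  \<open>m \<in> [0, 1]\<close> increasing in \<open>s\<close>; this is a calibration.  If \<open>m\<close> is taken along a curve as
  \<open>max 0 (k - l (a - x))\<close>, then \<open>\<integral> m y'\<close> is bounded below in terms of the height and area constraints
  alone (the cut-off at \<open>0\<close> is harmless since \<open>y \<ge> 0\<close>), so the functional is bounded below by a
  constant.  Equality forces \<open>y' = s x'\<close> with a slope \<open>s\<close> depending only on \<open>x\<close>, hence determines the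
  curve up to a vertical segment on the right wall.  The point reflection of the rectangle exchanges
  \<open>L\<close> and \<open>a h - L\<close>, so in case (i) one may assume \<open>2 L \<le> a\<^sup>2\<close> and \<open>2 L \<le> a h\<close>, and then
  multipliers \<open>k, l\<close> meeting both constraints exist.  In case (ii) \<open>m = 1\<close> is a calibration, and
  every curve made of vertical pieces and pieces of slope \<open>1\<close> with the right area is optimal.\<close>

section \<open>Functions of bounded variation\<close>

text \<open>The integrand is not convex. Along \<open>p = 1\<close> its convex envelope follows it
  up to slope 1 and then continues along the tangent there, whose slope 1 is also the cost per unit
  height of a vertical piece. Steeper pieces therefore lose against mixtures of slope 1 and vertical
  pieces: this is the origin of the range \<open>[0, 1]\<close> for slopes and of the many
  minimizers in case (ii). It also explains the threshold: \<open>L\<close> is the area under the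
  curve, and the diagonal from the origin to the right wall encloses \<open>a\<^sup>2 / 2\<close>.
  The multipliers obey a complementarity: height left over by the graph is climbed on the right
  wall, where a unit costs 1 while the calibration grants only \<open>k\<close>, so either nothing
  is left over or \<open>k = 1\<close>. Curves are merely absolutely continuous, and their height
  may a priori decrease, so integrating along them needs a derivative almost everywhere and the
  matching fundamental theorem of calculus; these come from Vitali coverings by way of the total
  variation.\<close>

lemma division_interval_eq:
  fixes a b :: real
  assumes "d division_of {a..b}" "K \<in> d"
  shows "K = {Inf K..Sup K}" "a \<le> Inf K" "Inf K \<le> Sup K" "Sup K \<le> b"
proof -
  obtain p q where K: "K = cbox p q" "K \<noteq> {}" "K \<subseteq> {a..b}"
    using assms by (metis division_ofD(2-4))
  then have "p \<le> q" by auto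
  then show "K = {Inf K..Sup K}" "a \<le> Inf K" "Inf K \<le> Sup K" "Sup K \<le> b"
    using K by auto
qed

lemma division_telescope:
  fixes g :: "real \<Rightarrow> 'a::real_normed_vector"
  assumes "a \<le> b" and d: "d division_of {a..b}"
  shows "(\<Sum>K\<in>d. g (Sup K) - g (Inf K)) = g b - g a"
proof -
  define p where "p = (\<lambda>K. (Inf K, K)) ` d"
  note D = division_ofD[OF d]
  have "p tagged_division_of {a..b}"
  proof (rule tagged_division_ofI)
    show "finite p" using D(1) by (simp add: p_def)
    fix x K assume "(x, K) \<in> p"
    then have K: "K \<in> d" "x = Inf K" by (auto simp: p_def)
    show "x \<in> K" using division_interval_eq[OF d K(1)] K(2) by (metis atLeastAtMost_iff order_refl)
    show "K \<subseteq> {a..b}" "\<exists>a b. K = cbox a b" using D K by auto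
    fix x' K' assume "(x', K') \<in> p" "(x, K) \<noteq> (x', K')"
    then show "interior K \<inter> interior K' = {}" using D(5) K by (auto simp: p_def)
  next
    have "{K. \<exists>x. (x, K) \<in> p} = d" by (auto simp: p_def)
    then show "\<Union>{K. \<exists>x. (x, K) \<in> p} = {a..b}" using D(6) by simp
  qed
  from additive_tagged_division_1[OF \<open>a \<le> b\<close> this, of g]
  show ?thesis unfolding p_def by (subst (asm) sum.reindex) (auto simp: inj_on_def)
qed

lemma division_sum_le_mono:
  fixes g :: "real \<Rightarrow> real"
  assumes "a \<le> b" "mono_on {a..b} g" "d division_of S" "S \<subseteq> {a..b}"
  shows "(\<Sum>K\<in>d. g (Sup K) - g (Inf K)) \<le> g b - g a"
proof -
  obtain q where q: "d \<subseteq> q" "q division_of {a..b}"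
    using partial_division_extend_interval[of d a b] assms division_ofD(6)[OF assms(3)]
    by (metis box_real(2))
  have "(\<Sum>K\<in>d. g (Sup K) - g (Inf K)) \<le> (\<Sum>K\<in>q. g (Sup K) - g (Inf K))"
  proof (rule sum_mono2)
    show "finite q" using q by auto
    fix K assume "K \<in> q - d"
    then show "0 \<le> g (Sup K) - g (Inf K)"
      using division_interval_eq[OF q(2)] mono_onD[OF assms(2), of "Inf K" "Sup K"]
      by (smt (verit) DiffE atLeastAtMost_iff)
  qed (use q in auto)
  also have "\<dots> = g b - g a" by (rule division_telescope[OF assms(1) q(2)])
  finally show ?thesis .
qed

text \<open>The intervals on which \<open>g\<close> grows at rate at least \<open>c\<close> form a
  fine cover of \<open>E\<close>. Vitali's theorem selects countably many disjoint ones that cover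
  \<open>E\<close> up to a null set, and \<open>c\<close> times their total length is at most the
  growth of \<open>g\<close>. The superset \<open>T\<close> expresses a bound on the outer measure,
  since \<open>E\<close> is arbitrary.\<close>

lemma vitali_mono_bound:
  fixes g :: "real \<Rightarrow> real"
  assumes "a \<le> b" and mono: "mono_on {a..b} g" and "c > 0"
    and E: "\<And>x d. x \<in> E \<Longrightarrow> d > 0 \<Longrightarrow> \<exists>y z. y \<le> x \<and> x \<le> z \<and> y < z \<and> z - y < d \<and> a \<le> y \<and> z \<le> b
              \<and> c * (z - y) \<le> g z - g y"
  shows "\<exists>T. T \<in> lmeasurable \<and> E \<subseteq> T \<and> measure lebesgue T \<le> (g b - g a) / c"
proof -
  \<comment> \<open>Intervals are coded by their end points; \<open>m\<close> and \<open>r\<close>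
    turn them into the balls of the covering theorem.\<close>
  define K where "K = {(y, z). a \<le> y \<and> y < z \<and> z \<le> b \<and> c * (z - y) \<le> g z - g y}"
  define m where "m = (\<lambda>(y, z). (y + z) / 2 :: real)"
  define r where "r = (\<lambda>(y, z). (z - y) / 2 :: real)"
  have cb: "cball (m i) (r i) = {fst i..snd i}" for i
    by (auto simp: m_def r_def cball_eq_atLeastAtMost split: prod.splits) (auto simp: field_simps)
  obtain C where C: "countable C" "C \<subseteq> K"
     "pairwise (\<lambda>i j. disjnt (cball (m i) (r i)) (cball (m j) (r j))) C"
     "negligible (E - (\<Union>i \<in> C. cball (m i) (r i)))"
  proof (rule Vitali_covering_theorem_cballs[of K r E m])
    show "\<And>i. i \<in> K \<Longrightarrow> 0 < r i" by (auto simp: K_def r_def)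
    fix x d :: real assume "x \<in> E" "0 < d"
    from E[OF this] obtain y z where "y \<le> x" "x \<le> z" "y < z" "z - y < d" "a \<le> y" "z \<le> b"
      "c * (z - y) \<le> g z - g y" by blast
    then show "\<exists>i. i \<in> K \<and> x \<in> cball (m i) (r i) \<and> r i < d"
      by (intro exI[of _ "(y, z)"]) (auto simp: K_def cb, auto simp: r_def)
  qed blast
  let ?U = "\<Union>i\<in>C. {fst i..snd i}"
  \<comment> \<open>A finite disjoint subfamily is a division of its union, so the bound for
    monotone functions applies; it then passes to the countable union.\<close>
  have fin: "measure lebesgue (\<Union>i\<in>I. {fst i..snd i}) \<le> (g b - g a) / c" if I: "I \<subseteq> C" "finite I" for I
  proof -
    let ?h = "\<lambda>i::real \<times> real. {fst i..snd i}"
    have lt: "fst i < snd i" "a \<le> fst i" "snd i \<le> b" "c * (snd i - fst i) \<le> g (snd i) - g (fst i)"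
      if "i \<in> I" for i
      using that I C(2) by (auto simp: K_def)
    have inj: "inj_on ?h I"
      by (rule inj_onI) (use lt in \<open>smt (verit) Icc_eq_Icc prod_eqI\<close>)
    have div: "(?h ` I) division_of (\<Union>(?h ` I))"
    proof (rule division_ofI)
      fix K1 K2 assume "K1 \<in> ?h ` I" "K2 \<in> ?h ` I" "K1 \<noteq> K2"
      then obtain i j where ij: "K1 = ?h i" "K2 = ?h j" "i \<in> I" "j \<in> I" "i \<noteq> j" by auto
      then have "disjnt (?h i) (?h j)"
        using C(3) I unfolding pairwise_def cb by blast
      then show "interior K1 \<inter> interior K2 = {}"
        using ij interior_subset unfolding disjnt_def by blast
    next
      fix K1 assume "K1 \<in> ?h ` I"
      then show "K1 \<noteq> {}" "\<exists>a b. K1 = cbox a b" using lt by (force, auto)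
    qed (use I in auto)
    have "measure lebesgue (\<Union>i\<in>I. {fst i..snd i}) \<le> (\<Sum>i\<in>I. measure lebesgue {fst i..snd i})"
      by (rule measure_UNION_le) (use I in auto)
    also have "\<dots> \<le> (\<Sum>i\<in>I. (g (snd i) - g (fst i)) / c)"
      using lt \<open>c > 0\<close> by (intro sum_mono) (simp add: field_simps less_imp_le)
    also have "\<dots> = (\<Sum>K\<in>?h ` I. g (Sup K) - g (Inf K)) / c"
      using lt by (subst sum.reindex[OF inj]) (auto simp: sum_divide_distrib less_imp_le intro!: sum.cong)
    also have "\<dots> \<le> (g b - g a) / c"
      using division_sum_le_mono[OF assms(1,2) div] lt \<open>c > 0\<close> by (force intro!: divide_right_mono)
    finally show ?thesis .
  qed
  have mI: "{fst i..snd i} \<in> lmeasurable" for i :: "real \<times> real"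
    using lmeasurable_cbox[of "fst i" "snd i"] by simp
  have U: "?U \<in> lmeasurable" "measure lebesgue ?U \<le> (g b - g a) / c"
    by (rule fmeasurable_UN_bound[OF C(1) mI fin], assumption+)
      (rule measure_UN_bound[OF C(1) mI fin], assumption+)
  have N: "negligible (E - ?U)" using C(4) by (simp add: cb)
  have "(E - ?U) \<union> ?U \<in> lmeasurable"
    by (intro fmeasurable.Un negligible_imp_measurable N U)
  moreover have "measure lebesgue ((E - ?U) \<union> ?U) \<le> measure lebesgue (E - ?U) + measure lebesgue ?U"
    by (intro measure_Un_le fmeasurableD negligible_imp_measurable N U)
  moreover have "measure lebesgue (E - ?U) = 0"
    by (rule negligible_imp_measure0[OF N])
  ultimately show ?thesis using U by (intro exI[of _ "(E - ?U) \<union> ?U"]) auto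
qed

section \<open>Total variation\<close>

definition variation_on :: "(real \<Rightarrow> real) \<Rightarrow> real set set \<Rightarrow> real" where
  "variation_on f d = (\<Sum>K\<in>d. \<bar>f (Sup K) - f (Inf K)\<bar>)"

definition bounded_var :: "real \<Rightarrow> real \<Rightarrow> (real \<Rightarrow> real) \<Rightarrow> bool" where
  "bounded_var u v f \<longleftrightarrow> (\<exists>B. \<forall>d. d division_of {u..v} \<longrightarrow> variation_on f d \<le> B)"

definition total_var :: "real \<Rightarrow> (real \<Rightarrow> real) \<Rightarrow> real \<Rightarrow> real" where
  "total_var u f x = (SUP d\<in>{d. d division_of {u..x}}. variation_on f d)"

lemma interval_division_nonempty: "{d. d division_of {u..x::real}} \<noteq> {}"
  using elementary_interval[of u x] by auto

lemma bounded_var_bdd_above: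
  assumes "bounded_var u v f" "u \<le> x" "x \<le> v"
  shows "bdd_above (variation_on f ` {d. d division_of {u..x}})"
proof -
  obtain B where B: "\<And>d. d division_of {u..v} \<Longrightarrow> variation_on f d \<le> B"
    using assms(1) unfolding bounded_var_def by blast
  show ?thesis
  proof (rule bdd_aboveI2)
    fix d assume "d \<in> {d. d division_of {u..x}}"
    then have d: "d division_of {u..x}" by simp
    obtain q where q: "d \<subseteq> q" "q division_of {u..v}"
      using partial_division_extend_interval[of d u v] d assms(2,3) division_ofD(6)[OF d]
      by (metis atLeastatMost_subset_iff box_real(2) order_refl)
    have "variation_on f d \<le> variation_on f q"
      unfolding variation_on_def using q by (intro sum_mono2) auto
    with B[OF q(2)] show "variation_on f d \<le> B" by simp
  qed
qed

lemma variation_on_le_total_var: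
  assumes "bounded_var u v f" "u \<le> x" "x \<le> v" "d division_of {u..x}"
  shows "variation_on f d \<le> total_var u f x"
  unfolding total_var_def
  by (rule cSUP_upper) (use assms bounded_var_bdd_above in auto)

text \<open>Appending the cell \<open>{x..y}\<close> turns a division of \<open>{u..x}\<close> into
  one of \<open>{u..y}\<close>. Thus the increments of a monotone function dominate those of
  \<open>f\<close>, which makes \<open>f\<close> accessible to
  \<open>vitali_mono_bound\<close>.\<close>

lemma total_var_increment:
  assumes "bounded_var u v f" "u \<le> x" "x \<le> y" "y \<le> v"
  shows "total_var u f x + \<bar>f y - f x\<bar> \<le> total_var u f y"
proof (cases "x = y")
  case False
  then have "x < y" using assms by simp
  have "total_var u f x \<le> total_var u f y - \<bar>f y - f x\<bar>"
    unfolding total_var_def[of u f x]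
  proof (rule cSUP_least[OF interval_division_nonempty])
    fix d assume "d \<in> {d. d division_of {u..x}}"
    then have d: "d division_of {u..x}" by simp
    have new: "{x..y} \<notin> d"
      using division_ofD(2)[OF d, of "{x..y}"] \<open>x < y\<close> by auto
    have "(d \<union> {{x..y}}) division_of ({u..x} \<union> {x..y})"
      by (rule division_disjoint_union[OF d])
        (use \<open>x < y\<close> in \<open>auto simp: division_of_def interior_atLeastAtMost_real\<close>)
    then have "insert {x..y} d division_of {u..y}"
      using assms by (simp add: ivl_disj_un_two_touch)
    from variation_on_le_total_var[OF assms(1) _ assms(4) this]
    have "variation_on f (insert {x..y} d) \<le> total_var u f y" using assms by simp
    moreover have "variation_on f (insert {x..y} d) = \<bar>f y - f x\<bar> + variation_on f d"
      using new division_ofD(1)[OF d] \<open>x < y\<close> by (simp add: variation_on_def)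
    ultimately show "variation_on f d \<le> total_var u f y - \<bar>f y - f x\<bar>" by simp
  qed
  then show ?thesis by simp
qed simp

lemma total_var_nonneg:
  assumes "bounded_var u v f" "u \<le> v"
  shows "0 \<le> total_var u f u"
proof -
  have "{{u..u}} division_of {u..u}" using division_of_self[of u u] by simp
  from variation_on_le_total_var[OF assms(1) _ assms(2) this]
  show ?thesis by (simp add: variation_on_def)
qed

text \<open>Subtracting a multiple of the identity shifts all difference quotients by a constant, so
  that an oscillation between two values can be centred at 0.\<close>

lemma bounded_var_minus_linear:
  assumes f: "bounded_var u v f" and "u \<le> v"
  shows "bounded_var u v (\<lambda>x. f x - c * x)"
proof -
  obtain B where B: "\<And>d. d division_of {u..v} \<Longrightarrow> variation_on f d \<le> B"
    using f unfolding bounded_var_def by blast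
  show ?thesis unfolding bounded_var_def
  proof (intro exI allI impI)
    fix d assume d: "d division_of {u..v}"
    have "variation_on (\<lambda>x. f x - c * x) d \<le> (\<Sum>K\<in>d. \<bar>f (Sup K) - f (Inf K)\<bar> + \<bar>c\<bar> * (Sup K - Inf K))"
      unfolding variation_on_def
    proof (rule sum_mono)
      fix K assume "K \<in> d"
      then have "Inf K \<le> Sup K" using division_interval_eq[OF d] by blast
      then have "\<bar>c\<bar> * (Sup K - Inf K) = \<bar>c * (Sup K - Inf K)\<bar>" by (simp add: abs_mult)
      then show "\<bar>f (Sup K) - c * Sup K - (f (Inf K) - c * Inf K)\<bar>
          \<le> \<bar>f (Sup K) - f (Inf K)\<bar> + \<bar>c\<bar> * (Sup K - Inf K)"
        using abs_triangle_ineq4[of "f (Sup K) - f (Inf K)" "c * (Sup K - Inf K)"]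
        by (simp add: algebra_simps)
    qed
    also have "\<dots> = variation_on f d + \<bar>c\<bar> * (v - u)"
      using division_telescope[OF assms(2) d, of "\<lambda>x. x"]
      by (simp add: variation_on_def sum.distrib sum_distrib_left[symmetric])
    finally show "variation_on (\<lambda>x. f x - c * x) d \<le> B + \<bar>c\<bar> * (v - u)" using B[OF d] by simp
  qed
qed

text \<open>Where difference quotients are unbounded, the total variation grows at every rate
  \<open>M\<close> on arbitrarily short intervals, so the Vitali bound makes the outer measure of
  order \<open>1 / M\<close>.\<close>

lemma bounded_var_steep_negligible:
  assumes f: "bounded_var u v f" and uv: "u \<le> v"
    and E: "\<And>x d M. x \<in> E \<Longrightarrow> d > 0 \<Longrightarrow> M > 0 \<Longrightarrow> \<exists>y z. y \<le> x \<and> x \<le> z \<and> y < z \<and> z - y < d \<and> u \<le> y \<and> z \<le> v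
              \<and> M * (z - y) \<le> \<bar>f z - f y\<bar>"
  shows "negligible E"
  unfolding negligible_outer_le
proof (intro allI impI)
  fix e :: real assume "e > 0"
  let ?V = "total_var u f"
  \<comment> \<open>The summand 1 keeps \<open>M\<close> positive when the total variation is
    constant.\<close>
  define M where "M = (?V v - ?V u + 1) / e"
  have mono: "mono_on {u..v} ?V"
    by (rule mono_onI) (use total_var_increment[OF f] in fastforce)
  then have "?V u \<le> ?V v" using uv by (auto simp: mono_on_def)
  then have "M > 0" using \<open>e > 0\<close> by (simp add: M_def)
  have "\<exists>T. T \<in> lmeasurable \<and> E \<subseteq> T \<and> measure lebesgue T \<le> (?V v - ?V u) / M"
  proof (rule vitali_mono_bound[OF uv mono \<open>M > 0\<close>])
    fix x d :: real assume "x \<in> E" "d > 0"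
    from E[OF this \<open>M > 0\<close>] obtain y z where yz: "y \<le> x" "x \<le> z" "y < z" "z - y < d" "u \<le> y" "z \<le> v"
      "M * (z - y) \<le> \<bar>f z - f y\<bar>" by blast
    then show "\<exists>y z. y \<le> x \<and> x \<le> z \<and> y < z \<and> z - y < d \<and> u \<le> y \<and> z \<le> v
        \<and> M * (z - y) \<le> ?V z - ?V y"
      using total_var_increment[OF f, of y z] by (intro exI[of _ y] exI[of _ z]) auto
  qed
  moreover have "(?V v - ?V u) / M \<le> e"
    using \<open>?V u \<le> ?V v\<close> \<open>e > 0\<close> unfolding M_def by (simp add: field_simps)
  ultimately show "\<exists>T. E \<subseteq> T \<and> T \<in> lmeasurable \<and> measure lebesgue T \<le> e" by (meson order_trans)
qed

text \<open>Take a division whose variation is almost the total one.  On a cell where \<open>f\<close> increases the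
  negative variation is then small, and steep descents within the cell are charged to it; likewise
  for decreasing cells.\<close>

lemma bounded_var_oscillation_negligible:
  assumes f: "bounded_var u v f" and uv: "u \<le> v" and c: "c > 0"
    and E: "E \<subseteq> {u..v}"
    and up: "\<And>x d. x \<in> E \<Longrightarrow> d > 0 \<Longrightarrow> \<exists>y z. y \<le> x \<and> x \<le> z \<and> y < z \<and> z - y < d
              \<and> c * (z - y) \<le> f z - f y"
    and down: "\<And>x d. x \<in> E \<Longrightarrow> d > 0 \<Longrightarrow> \<exists>y z. y \<le> x \<and> x \<le> z \<and> y < z \<and> z - y < d
              \<and> f z - f y \<le> - c * (z - y)"
  shows "negligible E"
  unfolding negligible_outer_le
proof (intro allI impI)
  fix e :: real assume "e > 0"
  let ?V = "total_var u f"
  have "\<exists>d\<in>{d. d division_of {u..v}}. ?V v - c * e < variation_on f d"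
    using less_cSUP_iff[OF interval_division_nonempty bounded_var_bdd_above[OF f uv order_refl], of "?V v - c * e"]
    unfolding total_var_def[of u f v] using \<open>c > 0\<close> \<open>e > 0\<close> by simp
  then obtain d where d: "d division_of {u..v}" and near: "?V v - c * e < variation_on f d" by auto
  note cell = division_interval_eq[OF d]
  have "\<exists>T. T \<in> lmeasurable \<and> E \<inter> interior K \<subseteq> T
      \<and> measure lebesgue T \<le> (?V (Sup K) - ?V (Inf K) - \<bar>f (Sup K) - f (Inf K)\<bar>) / (2 * c)"
    if K: "K \<in> d" for K
  proof -
    define s where "s = (if f (Sup K) - f (Inf K) \<ge> 0 then 1 else -1 :: real)"
    \<comment> \<open>On the cell, \<open>g\<close> increases by twice the variation of
      \<open>f\<close> against its overall direction \<open>s\<close>. An interval on which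
      \<open>f\<close> runs against \<open>s\<close> at rate \<open>c\<close> thus raises
      \<open>g\<close> at rate \<open>2 * c\<close>.\<close>
    define g where "g = (\<lambda>x. ?V x - s * f x)"
    have s: "\<bar>s\<bar> = 1" "s * (f (Sup K) - f (Inf K)) = \<bar>f (Sup K) - f (Inf K)\<bar>"
      by (auto simp: s_def)
    have inc: "\<bar>f y - f x\<bar> \<le> ?V y - ?V x" if "u \<le> x" "x \<le> y" "y \<le> v" for x y
      using total_var_increment[OF f that] by simp
    have mono: "mono_on {Inf K..Sup K} g"
    proof (rule mono_onI)
      fix x y assume xy: "x \<in> {Inf K..Sup K}" "y \<in> {Inf K..Sup K}" "x \<le> y"
      then have "u \<le> x" "y \<le> v" using cell(2,4)[OF K] unfolding atLeastAtMost_iff by linarith+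
      then have "\<bar>f y - f x\<bar> \<le> ?V y - ?V x" using xy(3) by (intro inc)
      then show "g x \<le> g y" by (auto simp: g_def s_def)
    qed
    have K': "interior K = {Inf K<..<Sup K}"
      by (subst cell(1)[OF K]) (simp add: interior_atLeastAtMost_real)
    have "\<exists>T. T \<in> lmeasurable \<and> E \<inter> interior K \<subseteq> T
        \<and> measure lebesgue T \<le> (g (Sup K) - g (Inf K)) / (2 * c)"
    proof (rule vitali_mono_bound[OF cell(3)[OF K] mono])
      show "2 * c > 0" using c by simp
      fix x r :: real assume x: "x \<in> E \<inter> interior K" and r: "r > 0"
      \<comment> \<open>The cap on the length confines the intervals supplied by \<open>up\<close>
        and \<open>down\<close> to the cell \<open>K\<close>.\<close>
      define r' where "r' = min r (min (x - Inf K) (Sup K - x))"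
      have r': "r' > 0" using x r K' by (auto simp: r'_def)
      have "\<exists>y z. y \<le> x \<and> x \<le> z \<and> y < z \<and> z - y < r' \<and> c * (z - y) \<le> - s * (f z - f y)"
      proof (cases "s = 1")
        case True
        then show ?thesis using down[of x r'] x r' by fastforce
      next
        case False
        then show ?thesis using up[of x r'] x r' by (fastforce simp: s_def split: if_splits)
      qed
      then obtain y z where yz: "y \<le> x" "x \<le> z" "y < z" "z - y < r'" "c * (z - y) \<le> - s * (f z - f y)"
        by blast
      then have b: "Inf K \<le> y" "z \<le> Sup K" "z - y < r" unfolding r'_def by linarith+
      then have "\<bar>f z - f y\<bar> \<le> ?V z - ?V y" using cell(2,4)[OF K] yz(3) by (intro inc) linarith+
      moreover have "- s * (f z - f y) \<le> \<bar>f z - f y\<bar>" using s(1) by (auto simp: s_def)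
      ultimately have "2 * c * (z - y) \<le> g z - g y"
        using yz(5) by (simp add: g_def algebra_simps)
      then show "\<exists>y z. y \<le> x \<and> x \<le> z \<and> y < z \<and> z - y < r \<and> Inf K \<le> y \<and> z \<le> Sup K
          \<and> 2 * c * (z - y) \<le> g z - g y"
        using yz b by blast
    qed
    moreover have "g (Sup K) - g (Inf K) = ?V (Sup K) - ?V (Inf K) - \<bar>f (Sup K) - f (Inf K)\<bar>"
      using s(2) by (simp add: g_def algebra_simps)
    ultimately show ?thesis by simp
  qed
  then obtain T where T: "\<And>K. K \<in> d \<Longrightarrow> T K \<in> lmeasurable" "\<And>K. K \<in> d \<Longrightarrow> E \<inter> interior K \<subseteq> T K"
    "\<And>K. K \<in> d \<Longrightarrow> measure lebesgue (T K) \<le> (?V (Sup K) - ?V (Inf K) - \<bar>f (Sup K) - f (Inf K)\<bar>) / (2 * c)"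
    by metis
  define Z where "Z = (Inf ` d \<union> Sup ` d :: real set)"
  have fin: "finite d" using d by auto
  then have Z: "negligible Z" by (simp add: Z_def negligible_finite)
  let ?T = "(\<Union>K\<in>d. T K)"
  have sub: "E \<subseteq> Z \<union> ?T"
  proof
    fix x assume x: "x \<in> E"
    then obtain K where K: "K \<in> d" "x \<in> K" using E division_ofD(6)[OF d] by blast
    have "x \<in> {Inf K..Sup K}" using cell(1)[OF K(1)] K(2) by simp
    moreover have "interior K = {Inf K<..<Sup K}"
      by (subst cell(1)[OF K(1)]) (simp add: interior_atLeastAtMost_real)
    ultimately have "x = Inf K \<or> x = Sup K \<or> x \<in> interior K" by auto
    then show "x \<in> Z \<union> ?T" using x K T(2)[OF K(1)] by (auto simp: Z_def)
  qed
  have mT: "?T \<in> lmeasurable" by (rule fmeasurable.finite_UN[OF fin T(1)])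
  have "measure lebesgue ?T \<le> (\<Sum>K\<in>d. measure lebesgue (T K))"
    by (rule measure_UNION_le[OF fin]) (use T(1) in auto)
  also have "\<dots> \<le> (\<Sum>K\<in>d. (?V (Sup K) - ?V (Inf K) - \<bar>f (Sup K) - f (Inf K)\<bar>) / (2 * c))"
    by (rule sum_mono) (rule T(3))
  also have "\<dots> = (?V v - ?V u - variation_on f d) / (2 * c)"
    using division_telescope[OF uv d, of ?V]
    by (simp add: sum_divide_distrib[symmetric] sum_subtractf variation_on_def)
  also have "\<dots> \<le> e"
    using near total_var_nonneg[OF f uv] c mult_pos_pos[OF c \<open>e > 0\<close>] by (simp add: field_simps)
  finally have "measure lebesgue ?T \<le> e" .
  moreover have "measure lebesgue (Z \<union> ?T) \<le> measure lebesgue Z + measure lebesgue ?T"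
    by (intro measure_Un_le fmeasurableD negligible_imp_measurable Z mT)
  moreover have "measure lebesgue Z = 0" by (rule negligible_imp_measure0[OF Z])
  moreover have "Z \<union> ?T \<in> lmeasurable" by (intro fmeasurable.Un negligible_imp_measurable Z mT)
  ultimately show "\<exists>T. E \<subseteq> T \<and> T \<in> lmeasurable \<and> measure lebesgue T \<le> e"
    using sub by (intro exI[of _ "Z \<union> ?T"]) auto
qed

text \<open>The limit is the lower limit, the supremum of the eventual lower bounds. A rational
  \<open>r\<close> above it is not an eventual lower bound, so the alternative makes every larger
  rational an eventual upper bound. Testing only rational pairs keeps the number of exceptional sets
  countable in the application.\<close>

lemma tendsto_if_no_oscillation:
  fixes q :: "'a \<Rightarrow> real"
  assumes "F \<noteq> bot" and bdd: "\<forall>\<^sub>F h in F. \<bar>q h\<bar> \<le> M"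
    and osc: "\<And>r s. r \<in> \<rat> \<Longrightarrow> s \<in> \<rat> \<Longrightarrow> r < s \<Longrightarrow> (\<forall>\<^sub>F h in F. r < q h) \<or> (\<forall>\<^sub>F h in F. q h < s)"
  shows "\<exists>l. (q \<longlongrightarrow> l) F"
proof -
  define R where "R = {r. \<forall>\<^sub>F h in F. r \<le> q h}"
  have "R \<noteq> {}" using bdd by (auto simp: R_def abs_le_iff intro!: exI[of _ "-M"] elim!: eventually_mono)
  have "r \<le> M" if "r \<in> R" for r
  proof -
    have "\<forall>\<^sub>F h in F. r \<le> M" using that bdd unfolding R_def mem_Collect_eq
      by eventually_elim linarith
    then show ?thesis using \<open>F \<noteq> bot\<close> by simp
  qed
  then have bR: "bdd_above R" by (rule bdd_aboveI)
  have "(q \<longlongrightarrow> Sup R) F"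
  proof (rule order_tendstoI)
    fix a assume "a < Sup R"
    then obtain r where "r \<in> R" "a < r" using less_cSup_iff[OF \<open>R \<noteq> {}\<close> bR] by blast
    then show "\<forall>\<^sub>F h in F. a < q h" by (auto simp: R_def elim: eventually_mono)
  next
    fix a assume "Sup R < a"
    then obtain s where s: "s \<in> \<rat>" "Sup R < s" "s < a" using Rats_dense_in_real by blast
    then obtain r where r: "r \<in> \<rat>" "Sup R < r" "r < s" using Rats_dense_in_real by blast
    have "\<not> (\<forall>\<^sub>F h in F. r < q h)"
    proof
      assume "\<forall>\<^sub>F h in F. r < q h"
      then have "r \<in> R" by (auto simp: R_def elim: eventually_mono)
      then show False using cSup_upper[OF _ bR] r by fastforce
    qed
    then have "\<forall>\<^sub>F h in F. q h < s" using osc[OF r(1) s(1) r(3)] by blast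
    then show "\<forall>\<^sub>F h in F. q h < a" by eventually_elim (use s in simp)
  qed
  then show ?thesis by blast
qed

text \<open>A quotient with \<open>h\<close> of either sign becomes one over an interval having
  \<open>x\<close> as an end point, which is the form that Vitali coverings use.\<close>

lemma frequently_quotient_interval:
  fixes f :: "real \<Rightarrow> real"
  assumes "\<exists>\<^sub>F h in at 0. P ((f (x + h) - f x) / h)" "d > 0"
  shows "\<exists>y z. y \<le> x \<and> x \<le> z \<and> y < z \<and> z - y < d \<and> P ((f z - f y) / (z - y))"
proof -
  have "\<forall>\<^sub>F h in at (0::real). \<bar>h\<bar> < d \<and> h \<noteq> 0"
    using \<open>d > 0\<close> by (auto simp: eventually_at dist_real_def)
  then have "\<exists>\<^sub>F h in at 0. P ((f (x + h) - f x) / h) \<and> \<bar>h\<bar> < d \<and> h \<noteq> 0"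
    by (rule frequently_elim1[OF frequently_eventually_conj[OF assms(1)]]) auto
  then obtain h where h: "P ((f (x + h) - f x) / h)" "\<bar>h\<bar> < d" "h \<noteq> 0"
    by (auto dest: frequently_ex)
  show ?thesis
  proof (cases "h > 0")
    case True
    then show ?thesis using h by (intro exI[of _ x] exI[of _ "x + h"]) auto
  next
    case False
    moreover have "(f x - f (x + h)) / (- h) = (f (x + h) - f x) / h"
      by (metis minus_diff_eq minus_divide_divide)
    ultimately show ?thesis using h by (intro exI[of _ "x + h"] exI[of _ x]) auto
  qed
qed

text \<open>This is Lebesgue's differentiation theorem. At an interior point without derivative the
  difference quotients are either unbounded (\<open>I\<close>) or oscillate across a rational gap
  (\<open>J r s\<close>).\<close>

theorem bounded_var_differentiable_ae:
  assumes f: "bounded_var u v f" and uv: "u \<le> v"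
  shows "negligible {x \<in> {u..v}. \<not> f differentiable (at x)}"
proof -
  let ?q = "\<lambda>x h. (f (x + h) - f x) / h"
  define I where "I = {x \<in> {u<..<v}. \<forall>M>0. \<exists>\<^sub>F h in at 0. M \<le> \<bar>?q x h\<bar>}"
  define J where "J r s = {x \<in> {u<..<v}. (\<exists>\<^sub>F h in at 0. ?q x h \<le> r) \<and> (\<exists>\<^sub>F h in at 0. s \<le> ?q x h)}" for r s
  have "negligible I"
  proof (rule bounded_var_steep_negligible[OF f uv])
    fix x d M :: real assume x: "x \<in> I" and d: "d > 0" and M: "M > 0"
    define d' where "d' = min d (min (x - u) (v - x))"
    have "d' > 0" using x d by (auto simp: I_def d'_def)
    have "\<exists>\<^sub>F h in at 0. M \<le> \<bar>?q x h\<bar>" using x M by (auto simp: I_def)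
    from frequently_quotient_interval[OF this \<open>d' > 0\<close>]
    obtain y z where yz: "y \<le> x" "x \<le> z" "y < z" "z - y < d'" "M \<le> \<bar>(f z - f y) / (z - y)\<bar>"
      by blast
    then have "u \<le> y" "z \<le> v" "z - y < d" by (auto simp: d'_def)
    with yz show "\<exists>y z. y \<le> x \<and> x \<le> z \<and> y < z \<and> z - y < d \<and> u \<le> y \<and> z \<le> v \<and> M * (z - y) \<le> \<bar>f z - f y\<bar>"
      by (intro exI[of _ y] exI[of _ z]) (simp add: abs_divide field_simps)
  qed
  moreover have "negligible (J r s)" if "r < s" for r s
  \<comment> \<open>Subtracting the slope \<open>(r + s) / 2\<close> turns quotients below
    \<open>r\<close> and above \<open>s\<close> into quotients below \<open>- c\<close> and above
    \<open>c\<close> for \<open>c = (s - r) / 2\<close>.\<close>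
  proof (rule bounded_var_oscillation_negligible[OF bounded_var_minus_linear[OF f uv, of "(r + s) / 2"] uv])
    show "(s - r) / 2 > 0" using that by simp
    show "J r s \<subseteq> {u..v}" by (auto simp: J_def)
    fix x d :: real assume x: "x \<in> J r s" and d: "d > 0"
    have "\<exists>\<^sub>F h in at 0. s \<le> ?q x h" using x by (auto simp: J_def)
    from frequently_quotient_interval[OF this d]
    obtain y z where yz: "y \<le> x" "x \<le> z" "y < z" "z - y < d" "s \<le> (f z - f y) / (z - y)"
      by blast
    have "s * (z - y) \<le> f z - f y" using yz by (simp add: field_simps)
    then have "(s - r) / 2 * (z - y) \<le> f z - (r + s) / 2 * z - (f y - (r + s) / 2 * y)"
      by (simp add: field_simps)
    with yz show "\<exists>y z. y \<le> x \<and> x \<le> z \<and> y < z \<and> z - y < d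
        \<and> (s - r) / 2 * (z - y) \<le> f z - (r + s) / 2 * z - (f y - (r + s) / 2 * y)" by blast
    have "\<exists>\<^sub>F h in at 0. ?q x h \<le> r" using x by (auto simp: J_def)
    from frequently_quotient_interval[OF this d]
    obtain y z where yz: "y \<le> x" "x \<le> z" "y < z" "z - y < d" "(f z - f y) / (z - y) \<le> r"
      by blast
    have "f z - f y \<le> r * (z - y)" using yz by (simp add: field_simps)
    then have "f z - (r + s) / 2 * z - (f y - (r + s) / 2 * y) \<le> - ((s - r) / 2) * (z - y)"
      by (simp add: field_simps)
    with yz show "\<exists>y z. y \<le> x \<and> x \<le> z \<and> y < z \<and> z - y < d
        \<and> f z - (r + s) / 2 * z - (f y - (r + s) / 2 * y) \<le> - ((s - r) / 2) * (z - y)" by blast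
  qed
  then have "negligible (\<Union>(r, s)\<in>{(r, s). r \<in> \<rat> \<and> s \<in> \<rat> \<and> r < s}. J r s)"
  proof (intro negligible_countable_Union)
    have "countable {(r :: real, s :: real). r \<in> \<rat> \<and> s \<in> \<rat> \<and> r < s}"
      by (rule countable_subset[of _ "\<rat> \<times> \<rat>"]) (auto intro: countable_rat)
    then show "countable ((\<lambda>(r, s). J r s) ` {(r, s). r \<in> \<rat> \<and> s \<in> \<rat> \<and> r < s})" by simp
  qed auto
  ultimately have "negligible ({u, v} \<union> I \<union> (\<Union>(r, s)\<in>{(r, s). r \<in> \<rat> \<and> s \<in> \<rat> \<and> r < s}. J r s))"
    by (intro negligible_Un) auto
  moreover have "{x \<in> {u..v}. \<not> f differentiable (at x)}
      \<subseteq> {u, v} \<union> I \<union> (\<Union>(r, s)\<in>{(r, s). r \<in> \<rat> \<and> s \<in> \<rat> \<and> r < s}. J r s)"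
  proof
    fix x assume x: "x \<in> {x \<in> {u..v}. \<not> f differentiable (at x)}"
    show "x \<in> {u, v} \<union> I \<union> (\<Union>(r, s)\<in>{(r, s). r \<in> \<rat> \<and> s \<in> \<rat> \<and> r < s}. J r s)"
    proof (rule ccontr)
      assume n: "\<not> ?thesis"
      then have xi: "x \<in> {u<..<v}" using x by auto
      then obtain M where "\<not> (\<exists>\<^sub>F h in at 0. M \<le> \<bar>?q x h\<bar>)"
        using n unfolding I_def by blast
      then have "\<forall>\<^sub>F h in at 0. \<bar>?q x h\<bar> \<le> M"
        unfolding not_frequently by (rule eventually_mono) simp
      moreover have "(\<forall>\<^sub>F h in at 0. r < ?q x h) \<or> (\<forall>\<^sub>F h in at 0. ?q x h < s)"
        if "r \<in> \<rat>" "s \<in> \<rat>" "r < s" for r s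
        using n that xi by (force simp: J_def frequently_def not_le)
      ultimately obtain l where "(?q x \<longlongrightarrow> l) (at 0)"
        using tendsto_if_no_oscillation[of "at (0::real)" "?q x" M] by auto
      then have "(f has_field_derivative l) (at x)" by (simp add: DERIV_def)
      then show False using x by (auto simp: real_differentiable_def)
    qed
  qed
  ultimately show ?thesis by (rule negligible_subset)
qed

section \<open>Absolutely continuous functions\<close>

definition interval_system :: "real \<Rightarrow> real \<Rightarrow> (real \<times> real) set \<Rightarrow> bool" where
  "interval_system u v D \<longleftrightarrow> finite D \<and> (\<forall>(x, y)\<in>D. u \<le> x \<and> x \<le> y \<and> y \<le> v)
      \<and> disjoint_family_on (\<lambda>(x, y). {x<..<y}) D"

lemma interval_system_subset: "interval_system u v D \<Longrightarrow> D' \<subseteq> D \<Longrightarrow> interval_system u v D'"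
  unfolding interval_system_def by (auto intro: finite_subset disjoint_family_on_mono)

lemma abs_cont_on_altdef:
  "abs_cont_on u v f \<longleftrightarrow> (\<forall>\<epsilon>>0. \<exists>\<delta>>0. \<forall>D. interval_system u v D \<and> (\<Sum>(x, y)\<in>D. y - x) < \<delta>
      \<longrightarrow> (\<Sum>(x, y)\<in>D. dist (f x) (f y)) < \<epsilon>)"
  unfolding abs_cont_on_def interval_system_def by (simp only: conj_assoc)

text \<open>Closure under sums, products, coordinate projections and composition with smooth
  functions all reduce to this comparison of increments.\<close>

lemma abs_cont_on_dominated2:
  assumes f: "abs_cont_on u v f" and g: "abs_cont_on u v g"
    and le: "\<And>x y. u \<le> x \<Longrightarrow> x \<le> y \<Longrightarrow> y \<le> v \<Longrightarrow> dist (h x) (h y) \<le> C * (dist (f x) (f y) + dist (g x) (g y))"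
  shows "abs_cont_on u v h"
  unfolding abs_cont_on_altdef
proof (intro allI impI)
  fix e :: real assume "e > 0"
  define C' where "C' = \<bar>C\<bar> + 1"
  have "C' > 0" by (simp add: C'_def)
  then have e: "e / (2 * C') > 0" using \<open>e > 0\<close> by simp
  obtain d where d: "d > 0" "\<And>D. interval_system u v D \<Longrightarrow> (\<Sum>(x, y)\<in>D. y - x) < d \<Longrightarrow>
      (\<Sum>(x, y)\<in>D. dist (f x) (f y)) < e / (2 * C')"
    using f[unfolded abs_cont_on_altdef, rule_format, OF e] by auto
  obtain d' where d': "d' > 0" "\<And>D. interval_system u v D \<Longrightarrow> (\<Sum>(x, y)\<in>D. y - x) < d' \<Longrightarrow>
      (\<Sum>(x, y)\<in>D. dist (g x) (g y)) < e / (2 * C')"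
    using g[unfolded abs_cont_on_altdef, rule_format, OF e] by auto
  show "\<exists>\<delta>>0. \<forall>D. interval_system u v D \<and> (\<Sum>(x, y)\<in>D. y - x) < \<delta>
      \<longrightarrow> (\<Sum>(x, y)\<in>D. dist (h x) (h y)) < e"
  proof (intro exI conjI allI impI)
    show "min d d' > 0" using d(1) d'(1) by simp
    fix D assume D: "interval_system u v D \<and> (\<Sum>(x, y)\<in>D. y - x) < min d d'"
    have "(\<Sum>(x, y)\<in>D. dist (h x) (h y)) \<le> (\<Sum>(x, y)\<in>D. C' * (dist (f x) (f y) + dist (g x) (g y)))"
    proof (rule sum_mono, clarify)
      fix x y assume "(x, y) \<in> D"
      then have "dist (h x) (h y) \<le> C * (dist (f x) (f y) + dist (g x) (g y))"
        using D le unfolding interval_system_def by blast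
      also have "\<dots> \<le> C' * (dist (f x) (f y) + dist (g x) (g y))"
        by (intro mult_right_mono) (auto simp: C'_def)
      finally show "dist (h x) (h y) \<le> C' * (dist (f x) (f y) + dist (g x) (g y))" .
    qed
    also have "\<dots> = C' * ((\<Sum>(x, y)\<in>D. dist (f x) (f y)) + (\<Sum>(x, y)\<in>D. dist (g x) (g y)))"
      by (simp add: sum_distrib_left case_prod_unfold sum.distrib distrib_left)
    also have "\<dots> < C' * (e / (2 * C') + e / (2 * C'))"
      using d(2)[of D] d'(2)[of D] D \<open>C' > 0\<close> by (intro mult_strict_left_mono add_strict_mono) auto
    also have "\<dots> = e" using \<open>C' > 0\<close> by (simp add: field_simps)
    finally show "(\<Sum>(x, y)\<in>D. dist (h x) (h y)) < e" .
  qed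
qed

lemma abs_cont_on_dominated:
  assumes f: "abs_cont_on u v f"
    and le: "\<And>x y. u \<le> x \<Longrightarrow> x \<le> y \<Longrightarrow> y \<le> v \<Longrightarrow> dist (g x) (g y) \<le> C * dist (f x) (f y)"
  shows "abs_cont_on u v g"
proof (rule abs_cont_on_dominated2[OF f f, of _ "C / 2"])
  fix x y assume "u \<le> x" "x \<le> y" "y \<le> v"
  from le[OF this] show "dist (g x) (g y) \<le> C / 2 * (dist (f x) (f y) + dist (f x) (f y))" by simp
qed

lemma abs_cont_on_id: "abs_cont_on u v (\<lambda>x :: real. x)"
  unfolding abs_cont_on_altdef
proof (intro allI impI)
  fix e :: real assume "e > 0"
  show "\<exists>\<delta>>0. \<forall>D. interval_system u v D \<and> (\<Sum>(x, y)\<in>D. y - x) < \<delta>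
      \<longrightarrow> (\<Sum>(x, y)\<in>D. dist x y) < e"
  proof (intro exI conjI allI impI)
    show "e > 0" by fact
    fix D assume D: "interval_system u v D \<and> (\<Sum>(x, y)\<in>D. y - x) < e"
    have "(\<Sum>(x, y)\<in>D. dist x y) = (\<Sum>(x, y)\<in>D. y - x)"
      by (rule sum.cong) (use D in \<open>auto simp: interval_system_def dist_real_def\<close>)
    then show "(\<Sum>(x, y)\<in>D. dist x y) < e" using D by simp
  qed
qed

lemma abs_cont_on_lipschitz:
  assumes "\<And>x y. u \<le> x \<Longrightarrow> x \<le> y \<Longrightarrow> y \<le> v \<Longrightarrow> dist (g x) (g y) \<le> C * (y - x)"
  shows "abs_cont_on u v g"
  by (rule abs_cont_on_dominated[OF abs_cont_on_id, of _ _ _ C])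
    (use assms in \<open>auto simp: dist_real_def abs_minus_commute\<close>)

lemma abs_cont_on_subinterval:
  assumes "abs_cont_on u v f" "u \<le> u'" "v' \<le> v"
  shows "abs_cont_on u' v' f"
proof -
  have "interval_system u v D" if "interval_system u' v' D" for D
    using that assms(2,3) unfolding interval_system_def by fastforce
  then show ?thesis using assms(1) unfolding abs_cont_on_altdef by meson
qed

lemma abs_cont_on_uniform:
  assumes f: "abs_cont_on u v f" and "e > 0"
  shows "\<exists>d>0. \<forall>x\<in>{u..v}. \<forall>y\<in>{u..v}. dist x y < d \<longrightarrow> dist (f x) (f y) < e"
proof -
  obtain d where d: "d > 0" "\<And>D. interval_system u v D \<Longrightarrow> (\<Sum>(x, y)\<in>D. y - x) < d \<Longrightarrow>
      (\<Sum>(x, y)\<in>D. dist (f x) (f y)) < e"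
    using f[unfolded abs_cont_on_altdef, rule_format, OF \<open>e > 0\<close>] by auto
  have 1: "dist (f x) (f y) < e" if "u \<le> x" "x \<le> y" "y \<le> v" "y - x < d" for x y
    using d(2)[of "{(x, y)}"] that by (auto simp: interval_system_def disjoint_family_on_def)
  have "dist (f x) (f y) < e" if "x \<in> {u..v}" "y \<in> {u..v}" "dist x y < d" for x y
    using 1[of x y] 1[of y x] that by (cases "x \<le> y") (auto simp: dist_real_def dist_commute)
  then show ?thesis using d(1) by blast
qed

lemma abs_cont_on_continuous:
  assumes "abs_cont_on u v f"
  shows "continuous_on {u..v} f"
  unfolding continuous_on_iff using abs_cont_on_uniform[OF assms] by (metis dist_commute)

section \<open>From absolute continuity to bounded variation\<close>

lemma subset_sum_between:
  fixes l :: "'a \<Rightarrow> real"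
  assumes "b > 0" "finite D" "\<And>i. i \<in> D \<Longrightarrow> l i < b" "b \<le> sum l D"
  shows "\<exists>D'\<subseteq>D. b \<le> sum l D' \<and> sum l D' < 2 * b"
  using assms(2-)
proof (induction D rule: finite_induct)
  case empty
  then show ?case using assms(1) by simp
next
  case (insert i D)
  show ?case
  proof (cases "b \<le> sum l D")
    case True
    then obtain D' where "D' \<subseteq> D" "b \<le> sum l D'" "sum l D' < 2 * b"
      using insert.IH insert.prems(1) by blast
    then show ?thesis by (intro exI[of _ D']) auto
  next
    case False
    then have "sum l (insert i D) < 2 * b"
      using insert.hyps insert.prems(1)[of i] by simp
    then show ?thesis using insert.prems(2) by blast
  qed
qed

text \<open>Induction by batches: as long as the total length is at least \<open>d\<close>, a
  subfamily of length between \<open>d\<close> and \<open>2 * d\<close> can be removed. It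
  contributes less than 1 and pays for this with its length; the summand 1 is for the final
  remainder.\<close>

lemma sum_dist_le_sum_length:
  assumes d: "d > 0" "\<And>D. interval_system u v D \<Longrightarrow> (\<Sum>(x, y)\<in>D. y - x) < 2 * d \<Longrightarrow>
      (\<Sum>(x, y)\<in>D. dist (f x) (f y)) < 1"
    and D: "interval_system u v D" "\<And>x y. (x, y) \<in> D \<Longrightarrow> y - x < d"
  shows "(\<Sum>(x, y)\<in>D. dist (f x) (f y)) \<le> 1 + (\<Sum>(x, y)\<in>D. y - x) / d"
  using D
proof (induction "card D" arbitrary: D rule: less_induct)
  case less
  let ?l = "\<lambda>(x, y). y - x :: real" and ?f = "\<lambda>(x, y). dist (f x) (f y)"
  have fin: "finite D" and nn: "\<And>i. i \<in> D \<Longrightarrow> 0 \<le> ?l i \<and> ?l i < d"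
    using less.prems by (auto simp: interval_system_def)
  show ?case
  proof (cases "d \<le> sum ?l D")
    case False
    moreover have "0 \<le> sum ?l D" by (rule sum_nonneg) (use nn in auto)
    ultimately show ?thesis
      using d(2)[OF less.prems(1)] d(1) by (smt (verit) divide_nonneg_pos)
  next
    case True
    obtain D' where D': "D' \<subseteq> D" "d \<le> sum ?l D'" "sum ?l D' < 2 * d"
      using subset_sum_between[OF d(1) fin _ True] nn by blast
    have "D' \<noteq> {}" using D'(2) d(1) by auto
    then have "card (D - D') < card D"
      using D'(1) fin by (metis Diff_subset card_seteq double_diff linorder_not_le Diff_empty subset_refl Diff_eq_empty_iff subset_empty)
    moreover have "interval_system u v (D - D')"
      by (rule interval_system_subset[OF less.prems(1)]) auto
    ultimately have "sum ?f (D - D') \<le> 1 + sum ?l (D - D') / d"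
      by (rule less.hyps) (use less.prems(2) in auto)
    moreover have "sum ?f D' < 1"
      using d(2)[OF interval_system_subset[OF less.prems(1) D'(1)]] D'(3) by simp
    moreover have "1 \<le> sum ?l D' / d" using D'(2) d(1) by simp
    moreover have "sum ?f D = sum ?f (D - D') + sum ?f D'" "sum ?l D = sum ?l (D - D') + sum ?l D'"
      by (rule sum.subset_diff[OF D'(1) fin])+
    ultimately show ?thesis by (simp add: add_divide_distrib)
  qed
qed

lemma interval_system_division:
  fixes u v :: real
  assumes d: "d division_of {u..v}"
  shows "interval_system u v ((\<lambda>K. (Inf K, Sup K)) ` d)" "inj_on (\<lambda>K. (Inf K, Sup K)) d"
proof -
  note cell = division_interval_eq[OF d]
  show inj: "inj_on (\<lambda>K. (Inf K, Sup K)) d"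
    by (rule inj_onI) (metis cell(1) prod.inject)
  have "disjoint_family_on (\<lambda>(x, y). {x<..<y}) ((\<lambda>K. (Inf K, Sup K)) ` d)"
    unfolding disjoint_family_on_def
  proof (intro ballI impI)
    fix m n assume "m \<in> (\<lambda>K. (Inf K, Sup K)) ` d" "n \<in> (\<lambda>K. (Inf K, Sup K)) ` d" "m \<noteq> n"
    then obtain K K' where K: "K \<in> d" "K' \<in> d" "m = (Inf K, Sup K)" "n = (Inf K', Sup K')" "K \<noteq> K'" by auto
    have "interior K \<inter> interior K' = {}" using d K by auto
    moreover have "interior K = {Inf K<..<Sup K}" "interior K' = {Inf K'<..<Sup K'}"
      using cell(1)[OF K(1)] cell(1)[OF K(2)] by (metis interior_atLeastAtMost_real)+
    ultimately show "(case m of (x, y) \<Rightarrow> {x<..<y}) \<inter> (case n of (x, y) \<Rightarrow> {x<..<y}) = {}" using K by simp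
  qed
  moreover have "finite d" using d by auto
  ultimately show "interval_system u v ((\<lambda>K. (Inf K, Sup K)) ` d)"
    unfolding interval_system_def using cell(2-4) by auto
qed

text \<open>Cells shorter than \<open>r\<close> are estimated in batches. A longer cell changes
  \<open>f\<close> by at most \<open>2 * C\<close>, which is charged to its length at rate
  \<open>2 * C / r\<close>, so the number of cells does not enter.\<close>

lemma abs_cont_on_bounded_var:
  fixes f :: "real \<Rightarrow> real"
  assumes f: "abs_cont_on u v f" and uv: "u \<le> v"
  shows "bounded_var u v f"
proof -
  obtain e where e: "e > 0" "\<And>D. interval_system u v D \<Longrightarrow> (\<Sum>(x, y)\<in>D. y - x) < e \<Longrightarrow>
      (\<Sum>(x, y)\<in>D. dist (f x) (f y)) < 1"
    using f[unfolded abs_cont_on_altdef, rule_format, of 1] by auto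
  define r where "r = e / 2"
  have r: "r > 0" "2 * r = e" using e by (auto simp: r_def)
  have "bounded (f ` {u..v})"
    by (intro compact_imp_bounded compact_continuous_image abs_cont_on_continuous f compact_Icc)
  then obtain C where C: "\<And>x. x \<in> {u..v} \<Longrightarrow> \<bar>f x\<bar> \<le> C" by (force simp: bounded_iff)
  have "C \<ge> 0" using C[of u] uv by force
  show ?thesis unfolding bounded_var_def
  proof (intro exI allI impI)
    fix d assume d: "d division_of {u..v}"
    let ?p = "\<lambda>K. (Inf K, Sup K) :: real \<times> real" and ?l = "\<lambda>(x, y). y - x :: real"
    let ?f = "\<lambda>(x, y). dist (f x) (f y)"
    define D where "D = ?p ` d"
    define S where "S = {i \<in> D. ?l i < r}"
    have sys: "interval_system u v D" and inj: "inj_on ?p d"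
      using interval_system_division[OF d] by (auto simp: D_def)
    then have fin: "finite D" and SD: "S \<subseteq> D" and nn: "\<And>i. i \<in> D \<Longrightarrow> 0 \<le> ?l i"
      by (auto simp: interval_system_def S_def)
    have len: "sum ?l D = v - u"
      using division_telescope[OF uv d, of "\<lambda>x. x"] unfolding D_def by (simp add: sum.reindex[OF inj])
    have "variation_on f d = sum ?f D"
      unfolding D_def variation_on_def by (simp add: sum.reindex[OF inj] dist_real_def abs_minus_commute)
    also have "\<dots> = sum ?f S + sum ?f (D - S)"
      using sum.subset_diff[OF SD fin, of ?f] by simp
    also have "sum ?f S \<le> 1 + sum ?l S / r"
      by (rule sum_dist_le_sum_length[OF r(1), of u v]) (use e r interval_system_subset[OF sys SD] in \<open>auto simp: S_def\<close>)
    also have "\<dots> \<le> 1 + (v - u) / r"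
      using sum_mono2[OF fin SD, of ?l] nn r(1) len by (simp add: divide_right_mono)
    also have "sum ?f (D - S) \<le> (\<Sum>i\<in>D - S. 2 * C / r * ?l i)"
    proof (rule sum_mono)
      fix i assume i: "i \<in> D - S"
      obtain x y where xy: "i = (x, y)" by force
      have "x \<in> {u..v}" "y \<in> {u..v}" using i sys unfolding xy interval_system_def by auto
      then have "dist (f x) (f y) \<le> 2 * C" using C[of x] C[of y] by (auto simp: dist_real_def)
      also have "\<dots> = 2 * C / r * r" using r(1) by simp
      also have "\<dots> \<le> 2 * C / r * (y - x)"
        using i r(1) \<open>C \<ge> 0\<close> unfolding xy S_def by (intro mult_left_mono) auto
      finally show "?f i \<le> 2 * C / r * ?l i" by (simp add: xy)
    qed
    also have "\<dots> = 2 * C / r * sum ?l (D - S)" by (simp add: sum_distrib_left)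
    also have "\<dots> \<le> 2 * C / r * (v - u)"
      using sum_mono2[OF fin, of "D - S" ?l] nn len \<open>C \<ge> 0\<close> r(1) by (intro mult_left_mono) auto
    finally show "variation_on f d \<le> 1 + (v - u) / r + 2 * C / r * (v - u)" by simp
  qed
qed

lemma abs_cont_on_differentiable_ae:
  fixes f :: "real \<Rightarrow> real"
  assumes "abs_cont_on u v f" "u \<le> v"
  shows "negligible {x \<in> {u..v}. \<not> f differentiable (at x)}"
  using bounded_var_differentiable_ae[OF abs_cont_on_bounded_var[OF assms] assms(2)] .

section \<open>Fundamental theorem of calculus for absolutely continuous functions\<close>

text \<open>Off the exceptional set the gauge controls difference quotients as usual; on it the gauge keeps
  the intervals inside an open set of small measure, where absolute continuity applies.\<close>

theorem abs_cont_on_has_integral: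
  fixes f :: "real \<Rightarrow> real"
  assumes f: "abs_cont_on a b f" and "a \<le> b" and N: "negligible N"
    and der: "\<And>x. x \<in> {a..b} - N \<Longrightarrow> (f has_vector_derivative f' x) (at x within {a..b})"
  shows "(f' has_integral (f b - f a)) {a..b}"
proof -
  \<comment> \<open>With the value 0 on \<open>N\<close>, a cell tagged in \<open>N\<close>
    contributes only its increment of \<open>f\<close>.\<close>
  define g where "g x = (if x \<in> N then 0 else f' x)" for x
  have "(g has_integral (f b - f a)) (cbox a b)"
    unfolding has_integral
  proof (intro allI impI)
    fix e :: real assume e: "e > 0"
    define e1 where "e1 = e / (2 * (b - a + 1))"
    have e1: "e1 > 0" "e1 * (b - a) < e / 2"
      using e \<open>a \<le> b\<close> by (auto simp: e1_def field_simps)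
    obtain \<delta> where \<delta>: "\<delta> > 0" "\<And>D. interval_system a b D \<Longrightarrow> (\<Sum>(x, y)\<in>D. y - x) < \<delta> \<Longrightarrow>
        (\<Sum>(x, y)\<in>D. dist (f x) (f y)) < e / 2"
      using f[unfolded abs_cont_on_altdef, rule_format, of "e / 2"] e by auto
    obtain U where U: "open U" "N \<subseteq> U" "U - N \<in> lmeasurable" "emeasure lebesgue (U - N) < ennreal \<delta>"
      using sets_lebesgue_outer_open[OF _ \<open>\<delta> > 0\<close>] N negligible_imp_sets by metis
    have Um: "U \<in> lmeasurable"
      using U(2,3) N by (metis Diff_partition fmeasurable.Un negligible_imp_measurable)
    have "measure lebesgue U \<le> measure lebesgue (U - N) + measure lebesgue N"
      using measure_Un_le[of "U - N" lebesgue N] U(2,3) N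
      by (simp add: negligible_imp_sets Un_absorb2 fmeasurableD)
    moreover have "measure lebesgue (U - N) < \<delta>"
      using U(3,4) \<open>\<delta> > 0\<close> by (simp add: emeasure_eq_measure2 fmeasurableD2 emeasure_eq_ennreal_measure ennreal_less_iff)
    ultimately have Ud: "measure lebesgue U < \<delta>" using negligible_imp_measure0[OF N] by simp
    have "\<exists>d>0. (x \<in> N \<longrightarrow> ball x d \<subseteq> U) \<and> (x \<in> {a..b} - N \<longrightarrow>
           (\<forall>y\<in>{a..b}. norm (y - x) < d \<longrightarrow> norm (f y - f x - (y - x) *\<^sub>R f' x) \<le> e1 * norm (y - x)))" for x
    proof (cases "x \<in> {a..b} - N")
      case True
      then have "\<exists>d>0. \<forall>y\<in>{a..b}. norm (y - x) < d \<longrightarrow> norm (f y - f x - (y - x) *\<^sub>R f' x) \<le> e1 * norm (y - x)"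
        using der[OF True, unfolded has_vector_derivative_def has_derivative_within_alt] e1(1) by blast
      with True show ?thesis by blast
    next
      case False
      show ?thesis
      proof (cases "x \<in> N")
        case True
        then obtain r where "r > 0" "ball x r \<subseteq> U" using U(1,2) openE by blast
        then show ?thesis using True by blast
      next
        case False
        then show ?thesis using \<open>x \<notin> {a..b} - N\<close> zero_less_one by blast
      qed
    qed
    then obtain d where d: "\<And>x. d x > 0" "\<And>x. x \<in> N \<Longrightarrow> ball x (d x) \<subseteq> U"
      "\<And>x y. x \<in> {a..b} - N \<Longrightarrow> y \<in> {a..b} \<Longrightarrow> norm (y - x) < d x \<Longrightarrow>
          norm (f y - f x - (y - x) *\<^sub>R f' x) \<le> e1 * norm (y - x)"
      by metis
    show "\<exists>\<gamma>. gauge \<gamma> \<and> (\<forall>\<D>. \<D> tagged_division_of cbox a b \<and> \<gamma> fine \<D> \<longrightarrow>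
          norm ((\<Sum>(x, k)\<in>\<D>. measure lborel k *\<^sub>R g x) - (f b - f a)) < e)"
    proof (intro exI conjI allI impI)
      show "gauge (\<lambda>x. ball x (d x))" using d(1) gauge_ball_dependent by blast
      fix p assume "p tagged_division_of cbox a b \<and> (\<lambda>x. ball x (d x)) fine p"
      then have p: "p tagged_division_of {a..b}" and fine: "(\<lambda>x. ball x (d x)) fine p" by auto
      note pD = tagged_division_ofD[OF p]
      have cell: "K = {Inf K..Sup K}" "a \<le> Inf K" "Inf K \<le> x" "x \<le> Sup K" "Sup K \<le> b" "x \<in> {a..b}"
        if "(x, K) \<in> p" for x K
      proof -
        have "K \<in> snd ` p" using that by force
        note c = division_interval_eq[OF division_of_tagged_division[OF p] this]
        show "K = {Inf K..Sup K}" "a \<le> Inf K" "Sup K \<le> b" by (rule c)+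
        have "x \<in> {Inf K..Sup K}" using pD(2)[OF that] c(1) by simp
        then show "Inf K \<le> x" "x \<le> Sup K" "x \<in> {a..b}"
          using c(2,4) unfolding atLeastAtMost_iff by linarith+
      qed
      let ?r = "\<lambda>(x, K). measure lborel K *\<^sub>R g x - (f (Sup K) - f (Inf K))"
      \<comment> \<open>Degenerate cells are left out of \<open>q\<close>: their increment vanishes,
        and without them distinct elements of \<open>q\<close> have distinct end points, so that
        \<open>q\<close> is an interval system.\<close>
      define q where "q = {i \<in> p. fst i \<in> N \<and> Inf (snd i) < Sup (snd i)}"
      have fin: "finite p" and qp: "q \<subseteq> p" using pD(1) by (auto simp: q_def)
      have cont: "measure lborel K = Sup K - Inf K" if "(x, K) \<in> p" for x K
        using cell[OF that] by (metis content_real order_trans)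
      have eq: "sum ?r p = (\<Sum>(x, K)\<in>p. measure lborel K *\<^sub>R g x) - (f b - f a)"
        using additive_tagged_division_1[OF \<open>a \<le> b\<close> p, of f]
        by (simp add: sum_subtractf case_prod_unfold)
      have "norm (sum ?r (p - q)) \<le> (\<Sum>i\<in>p - q. e1 * measure lborel (snd i))"
      proof (rule sum_norm_le)
        fix i assume i: "i \<in> p - q"
        obtain x K where xK: "i = (x, K)" by force
        then have K: "(x, K) \<in> p" using i by simp
        note c = cell[OF K]
        show "norm (?r i) \<le> e1 * measure lborel (snd i)"
        proof (cases "x \<in> N")
          case True
          then have "Inf K = Sup K" using i c xK by (force simp: q_def)
          then show ?thesis using cont[OF K] by (simp add: xK)
        next
          case False
          then have x: "x \<in> {a..b} - N" using c by simp
          have "K \<subseteq> ball x (d x)" using fine K by (auto simp: fine_def)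
          then have "Inf K \<in> ball x (d x)" "Sup K \<in> ball x (d x)" using c(1,3,4) by (metis atLeastAtMost_iff order_refl order_trans subsetD)+
          then have "norm (f (Inf K) - f x - (Inf K - x) *\<^sub>R f' x) \<le> e1 * norm (Inf K - x)"
            "norm (f (Sup K) - f x - (Sup K - x) *\<^sub>R f' x) \<le> e1 * norm (Sup K - x)"
            using c(2-5) d(3)[OF x, of "Inf K"] d(3)[OF x, of "Sup K"]
            by (simp_all add: dist_real_def abs_minus_commute)
          moreover have "e1 * norm (Inf K - x) + e1 * norm (Sup K - x) = e1 * (Sup K - Inf K)"
            using c by (simp add: algebra_simps)
          moreover have eq: "?r i = (f (Inf K) - f x - (Inf K - x) *\<^sub>R f' x) - (f (Sup K) - f x - (Sup K - x) *\<^sub>R f' x)"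
            using False by (simp add: xK g_def cont[OF K] left_diff_distrib)
          moreover have "e1 * measure lborel (snd i) = e1 * (Sup K - Inf K)"
            using cont[OF K] by (simp add: xK)
          ultimately show ?thesis unfolding eq
            using norm_triangle_ineq4[of "f (Inf K) - f x - (Inf K - x) *\<^sub>R f' x"
                "f (Sup K) - f x - (Sup K - x) *\<^sub>R f' x"] by linarith
        qed
      qed
      also have "(\<Sum>i\<in>p - q. e1 * measure lborel (snd i)) \<le> (\<Sum>i\<in>p. e1 * measure lborel (snd i))"
        using e1(1) fin by (intro sum_mono2) auto
      also have "(\<Sum>i\<in>p. e1 * measure lborel (snd i)) = e1 * (b - a)"
        using additive_content_tagged_division[of p a b] p \<open>a \<le> b\<close>
        by (simp add: sum_distrib_left[symmetric] case_prod_unfold)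
      finally have n1: "norm (sum ?r (p - q)) \<le> e1 * (b - a)" .
      have n2: "norm (sum ?r q) < e / 2"
      proof -
        let ?p = "\<lambda>(x :: real, K). (Inf K, Sup K) :: real \<times> real"
        have ne: "i = j" if "i \<in> q" "j \<in> q" "interior (snd i) \<inter> interior (snd j) \<noteq> {}" for i j
          using that pD(5) qp by (metis prod.collapse subsetD)
        have int: "interior (snd i) = {Inf (snd i)<..<Sup (snd i)}" if "i \<in> q" for i
          using that qp cell(1) by (metis interior_atLeastAtMost_real prod.collapse subsetD)
        have inj: "inj_on ?p q"
        proof (rule inj_onI)
          fix i j assume ij: "i \<in> q" "j \<in> q" "?p i = ?p j"
          then have "interior (snd i) = interior (snd j)" "interior (snd i) \<noteq> {}"
            using int by (auto simp: case_prod_unfold q_def)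
          then show "i = j" using ne ij by blast
        qed
        have "disjoint_family_on (\<lambda>(x, y). {x<..<y}) (?p ` q)"
          unfolding disjoint_family_on_def
        proof (intro ballI impI)
          fix m n assume "m \<in> ?p ` q" "n \<in> ?p ` q" "m \<noteq> n"
          then obtain i j where "i \<in> q" "j \<in> q" "m = ?p i" "n = ?p j" "i \<noteq> j" by blast
          then show "(case m of (x, y) \<Rightarrow> {x<..<y}) \<inter> (case n of (x, y) \<Rightarrow> {x<..<y}) = {}"
            using ne[of i j] int[of i] int[of j] by (auto simp: case_prod_unfold)
        qed
        moreover have "\<forall>(x, y)\<in>?p ` q. a \<le> x \<and> x \<le> y \<and> y \<le> b"
          using cell qp by (fastforce simp: q_def)
        ultimately have sys: "interval_system a b (?p ` q)"
          using finite_subset[OF qp fin] by (simp add: interval_system_def)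
        have "(\<Sum>(x, y)\<in>?p ` q. y - x) = (\<Sum>i\<in>q. measure lebesgue (interior (snd i)))"
          by (subst sum.reindex[OF inj], rule sum.cong) (auto simp: int case_prod_unfold q_def)
        also have "\<dots> = measure lebesgue (\<Union>i\<in>q. interior (snd i))"
        proof (rule measure_UNION'[symmetric])
          show "finite q" by (rule finite_subset[OF qp fin])
          show "interior (snd i) \<in> lmeasurable" if "i \<in> q" for i
            using lmeasurable_box[of "Inf (snd i)" "Sup (snd i)"] int[OF that] by simp
          show "pairwise (\<lambda>i j. disjnt (interior (snd i)) (interior (snd j))) q"
            unfolding pairwise_def disjnt_def using ne by blast
        qed
        also have "\<dots> \<le> measure lebesgue U"
        proof (rule measure_mono_fmeasurable)
          show "(\<Union>i\<in>q. interior (snd i)) \<subseteq> U"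
          proof (rule UN_least)
            fix i assume i: "i \<in> q"
            have "snd i \<subseteq> ball (fst i) (d (fst i))" 
              using fine i qp unfolding fine_def by (metis (no_types, lifting) case_prod_beta subsetD)
            then show "interior (snd i) \<subseteq> U" using d(2)[of "fst i"] i interior_subset[of "snd i"]
              by (auto simp: q_def)
          qed
          show "(\<Union>i\<in>q. interior (snd i)) \<in> sets lebesgue" 
            by (intro sets_completionI_sets) (simp add: borel_open open_UN)
        qed (fact Um)
        finally have "(\<Sum>(x, y)\<in>?p ` q. dist (f x) (f y)) < e / 2" using \<delta>(2)[OF sys] Ud by simp
        moreover have "norm (sum ?r q) \<le> (\<Sum>i\<in>q. (\<lambda>(x, y). dist (f x) (f y)) (?p i))"
          by (rule sum_norm_le) (auto simp: q_def g_def dist_real_def)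
        ultimately show ?thesis by (simp add: sum.reindex[OF inj])
      qed
      have split: "sum ?r p = sum ?r (p - q) + sum ?r q" by (rule sum.subset_diff[OF qp fin])
      have "norm (sum ?r p) \<le> norm (sum ?r (p - q)) + norm (sum ?r q)"
        unfolding split by (rule norm_triangle_ineq)
      also have "\<dots> < e" using n1 n2 e1(2) by linarith
      finally show "norm ((\<Sum>(x, k)\<in>p. measure lborel k *\<^sub>R g x) - (f b - f a)) < e"
        unfolding eq .
    qed
  qed
  then have "(g has_integral (f b - f a)) {a..b}" by simp
  then show ?thesis
    by (rule has_integral_spike[OF N, rotated]) (auto simp: g_def)
qed

text \<open>By the fundamental theorem on each cell, the sums of the norms of the integrals of
  \<open>f'\<close> over a division are variations of \<open>f\<close>, which are bounded.\<close>

theorem abs_cont_on_absolutely_integrable: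
  fixes f :: "real \<Rightarrow> real"
  assumes f: "abs_cont_on a b f" and "a \<le> b" and N: "negligible N"
    and der: "\<And>x. x \<in> {a..b} - N \<Longrightarrow> (f has_vector_derivative f' x) (at x within {a..b})"
  shows "f' absolutely_integrable_on {a..b}"
proof -
  obtain B where B: "\<And>d. d division_of {a..b} \<Longrightarrow> variation_on f d \<le> B"
    using abs_cont_on_bounded_var[OF assms(1,2)] unfolding bounded_var_def by blast
  have "f' absolutely_integrable_on cbox a b"
  proof (rule bounded_variation_absolutely_integrable_interval)
    show "f' integrable_on cbox a b" using abs_cont_on_has_integral[OF assms] by auto
    fix d assume "d division_of cbox a b"
    then have d: "d division_of {a..b}" by simp
    have "integral K f' = f (Sup K) - f (Inf K)" if K: "K \<in> d" for K
    proof -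
      note c = division_interval_eq[OF d K]
      have "(f' has_integral (f (Sup K) - f (Inf K))) {Inf K..Sup K}"
      proof (rule abs_cont_on_has_integral[OF abs_cont_on_subinterval[OF f] c(3) N])
        fix x assume "x \<in> {Inf K..Sup K} - N"
        then show "(f has_vector_derivative f' x) (at x within {Inf K..Sup K})"
          using c(2,4) by (intro has_vector_derivative_within_subset[OF der]) auto
      qed (use c in auto)
      then show ?thesis using c(1) by (metis integral_unique)
    qed
    then have "(\<Sum>K\<in>d. norm (integral K f')) = variation_on f d"
      unfolding variation_on_def by (intro sum.cong) auto
    then show "(\<Sum>K\<in>d. norm (integral K f')) \<le> B" using B[OF d] by simp
  qed
  then show ?thesis by simp
qed

section \<open>Closure properties of absolute continuity\<close>

lemma abs_cont_on_add:
  fixes f g :: "real \<Rightarrow> real"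
  assumes "abs_cont_on u v f" "abs_cont_on u v g"
  shows "abs_cont_on u v (\<lambda>t. f t + g t)"
  by (rule abs_cont_on_dominated2[OF assms, of _ 1]) (simp add: dist_real_def)

lemma abs_cont_on_minus:
  fixes f :: "real \<Rightarrow> real"
  assumes "abs_cont_on u v f"
  shows "abs_cont_on u v (\<lambda>t. - f t)"
  by (rule abs_cont_on_dominated[OF assms, of _ 1]) (simp add: dist_real_def)

lemma abs_cont_on_diff:
  fixes f g :: "real \<Rightarrow> real"
  assumes "abs_cont_on u v f" "abs_cont_on u v g"
  shows "abs_cont_on u v (\<lambda>t. f t - g t)"
  using abs_cont_on_add[OF assms(1) abs_cont_on_minus[OF assms(2)]] by simp

lemma abs_cont_on_mult:
  fixes f g :: "real \<Rightarrow> real"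
  assumes f: "abs_cont_on u v f" and g: "abs_cont_on u v g"
  shows "abs_cont_on u v (\<lambda>t. f t * g t)"
proof -
  have "bounded (f ` {u..v})" "bounded (g ` {u..v})"
    by (intro compact_imp_bounded compact_continuous_image abs_cont_on_continuous f g compact_Icc)+
  then obtain A B where A: "\<And>x. x \<in> {u..v} \<Longrightarrow> \<bar>f x\<bar> \<le> A" and B: "\<And>x. x \<in> {u..v} \<Longrightarrow> \<bar>g x\<bar> \<le> B"
    by (force simp: bounded_iff)
  show ?thesis
  proof (rule abs_cont_on_dominated2[OF f g, of _ "max A B"])
    fix x y assume xy: "u \<le> x" "x \<le> y" "y \<le> v"
    have "\<bar>f x * g x - f y * g y\<bar> = \<bar>f x * (g x - g y) + g y * (f x - f y)\<bar>"
      by (simp add: algebra_simps)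
    also have "\<dots> \<le> \<bar>f x\<bar> * \<bar>g x - g y\<bar> + \<bar>g y\<bar> * \<bar>f x - f y\<bar>"
      by (metis abs_mult abs_triangle_ineq)
    also have "\<dots> \<le> max A B * \<bar>g x - g y\<bar> + max A B * \<bar>f x - f y\<bar>"
      using A[of x] B[of y] xy by (intro add_mono mult_right_mono) auto
    finally show "dist (f x * g x) (f y * g y) \<le> max A B * (dist (f x) (f y) + dist (g x) (g y))"
      by (simp add: dist_real_def algebra_simps)
  qed
qed

lemma abs_cont_on_const: "abs_cont_on u v (\<lambda>_. c)"
  by (rule abs_cont_on_lipschitz[of _ _ _ 0]) auto

lemma abs_cont_on_reflect:
  assumes f: "abs_cont_on 0 1 f"
  shows "abs_cont_on 0 1 (\<lambda>t. f (1 - t))"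
  unfolding abs_cont_on_altdef
proof (intro allI impI)
  fix e :: real assume "e > 0"
  obtain d where d: "d > 0" "\<And>D. interval_system 0 1 D \<Longrightarrow> (\<Sum>(x, y)\<in>D. y - x) < d \<Longrightarrow>
      (\<Sum>(x, y)\<in>D. dist (f x) (f y)) < e"
    using f[unfolded abs_cont_on_altdef, rule_format, OF \<open>e > 0\<close>] by auto
  let ?r = "\<lambda>(x, y). (1 - y, 1 - x) :: real \<times> real"
  have inj: "inj_on ?r D" for D by (auto simp: inj_on_def)
  have "(\<Sum>(x, y)\<in>D. dist (f (1 - x)) (f (1 - y))) < e"
    if D: "interval_system 0 1 D" "(\<Sum>(x, y)\<in>D. y - x) < d" for D
  proof -
    have "disjoint_family_on (\<lambda>(x, y). {x<..<y}) (?r ` D)"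
      unfolding disjoint_family_on_def
    proof (intro ballI impI)
      fix m n assume "m \<in> ?r ` D" "n \<in> ?r ` D" "m \<noteq> n"
      then obtain i j where ij: "i \<in> D" "j \<in> D" "m = ?r i" "n = ?r j" "i \<noteq> j" by blast
      then have "(case i of (x, y) \<Rightarrow> {x<..<y}) \<inter> (case j of (x, y) \<Rightarrow> {x<..<y}) = {}"
        using D(1) unfolding interval_system_def disjoint_family_on_def by blast
      then have no: False if "1 - z \<in> {fst i<..<snd i}" "1 - z \<in> {fst j<..<snd j}" for z
        using that by (auto simp: case_prod_unfold)
      show "(case m of (x, y) \<Rightarrow> {x<..<y}) \<inter> (case n of (x, y) \<Rightarrow> {x<..<y}) = {}"
      proof (rule equals0I)
        fix z assume "z \<in> (case m of (x, y) \<Rightarrow> {x<..<y}) \<inter> (case n of (x, y) \<Rightarrow> {x<..<y})"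
        then show False using ij(3,4) by (intro no[of z]) (auto simp: case_prod_unfold)
      qed
    qed
    then have "interval_system 0 1 (?r ` D)" using D(1) by (auto simp: interval_system_def)
    moreover have "(\<Sum>(x, y)\<in>?r ` D. y - x) < d"
      by (subst sum.reindex[OF inj]) (use D(2) in \<open>simp add: case_prod_unfold comp_def\<close>)
    ultimately have "(\<Sum>(x, y)\<in>?r ` D. dist (f x) (f y)) < e" by (rule d(2))
    then show ?thesis
      by (subst (asm) sum.reindex[OF inj]) (simp add: case_prod_unfold comp_def dist_commute)
  qed
  then show "\<exists>\<delta>>0. \<forall>D. interval_system 0 1 D \<and> (\<Sum>(x, y)\<in>D. y - x) < \<delta>
      \<longrightarrow> (\<Sum>(x, y)\<in>D. dist (f (1 - x)) (f (1 - y))) < e"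
    using d(1) by blast
qed

lemma abs_cont_on_C1_compose:
  fixes f G :: "real \<Rightarrow> real"
  assumes f: "abs_cont_on u v f" and im: "f ` {u..v} \<subseteq> {a..b}"
    and G: "\<And>z. z \<in> {a..b} \<Longrightarrow> (G has_real_derivative g z) (at z within {a..b})"
    and g: "continuous_on {a..b} g"
  shows "abs_cont_on u v (\<lambda>t. G (f t))"
proof -
  have "bounded (g ` {a..b})" by (intro compact_imp_bounded compact_continuous_image g compact_Icc)
  then obtain B where B: "\<And>z. z \<in> {a..b} \<Longrightarrow> norm (g z) \<le> B" by (force simp: bounded_iff)
  show ?thesis
  proof (rule abs_cont_on_dominated[OF f, of _ B])
    fix x y assume "u \<le> x" "x \<le> y" "y \<le> v"
    then have "f x \<in> {a..b}" "f y \<in> {a..b}" using im by (auto simp: image_subset_iff)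
    then show "dist (G (f x)) (G (f y)) \<le> B * dist (f x) (f y)"
      using field_differentiable_bound[of "{a..b}" G g B "f x" "f y"] G B
      by (simp add: dist_norm)
  qed
qed

lemma continuous_antiderivative:
  fixes f :: "real \<Rightarrow> real"
  assumes "continuous_on UNIV f" "0 \<le> a"
  shows "\<exists>G. G 0 = 0 \<and> (\<forall>x\<in>{0..a}. (G has_real_derivative f x) (at x))"
proof -
  \<comment> \<open>The interval is enlarged so that \<open>0\<close> and \<open>a\<close> become
    interior points and the derivative there is two-sided.\<close>
  obtain g where g: "\<And>x. x \<in> {-1..a + 1} \<Longrightarrow> (g has_vector_derivative f x) (at x within {-1..a + 1})"
    using antiderivative_continuous[of "-1" "a + 1" f] assms continuous_on_subset by blast
  have "((\<lambda>x. g x - g 0) has_real_derivative f x) (at x)" if "x \<in> {0..a}" for x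
  proof -
    have "x \<in> interior {-1..a + 1}" using that assms(2) by (simp add: interior_atLeastAtMost_real)
    moreover have "(g has_real_derivative f x) (at x within {-1..a + 1})"
      using g[of x] that by (simp add: has_real_derivative_iff_has_vector_derivative)
    ultimately have "(g has_real_derivative f x) (at x)" by (simp only: at_within_interior)
    from DERIV_diff[OF this DERIV_const[of "g 0"]] show ?thesis by simp
  qed
  then show ?thesis by (intro exI[of _ "\<lambda>x. g x - g 0"]) auto
qed

lemma nonneg_integral_zero_imp_negligible:
  fixes f :: "real \<Rightarrow> real"
  assumes f: "f absolutely_integrable_on S" and nn: "\<And>x. x \<in> S - N \<Longrightarrow> 0 \<le> f x" and N: "negligible N"
    and zero: "integral S f = 0"
  shows "negligible {x \<in> S. f x \<noteq> 0}"
proof -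
  have "AE x in lebesgue. x \<notin> N" using N by (simp add: AE_not_in negligible_iff_null_sets)
  then have pos: "AE x in lebesgue. 0 \<le> indicat_real S x *\<^sub>R f x"
    by eventually_elim (use nn in \<open>auto simp: indicator_def\<close>)
  have "(LINT x|lebesgue. indicat_real S x *\<^sub>R f x) = 0"
    using set_lebesgue_integral_eq_integral(2)[OF f] zero by (simp add: set_lebesgue_integral_def)
  then have "AE x in lebesgue. indicat_real S x *\<^sub>R f x = 0"
    using integral_nonneg_eq_0_iff_AE[OF _ pos] f by (simp add: set_integrable_def)
  then obtain M where "M \<in> null_sets lebesgue" "{x \<in> space lebesgue. \<not> indicat_real S x *\<^sub>R f x = 0} \<subseteq> M"
    unfolding eventually_ae_filter by blast
  then have "negligible M" "{x \<in> S. f x \<noteq> 0} \<subseteq> M"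
    by (auto simp: negligible_iff_null_sets indicator_def)
  then show ?thesis by (rule negligible_subset)
qed

section \<open>The calibration of the resistance\<close>

lemma one_plus_square_pos: "0 < (1 + s\<^sup>2 :: real)"
  by (simp add: add_pos_nonneg)

lemma continuous_times_absolutely_integrable:
  fixes f g :: "real \<Rightarrow> real"
  assumes "continuous_on {u..v} f" "g absolutely_integrable_on {u..v}"
  shows "(\<lambda>t. f t * g t) absolutely_integrable_on {u..v}"
proof (rule absolutely_integrable_bounded_measurable_product_real)
  show "f \<in> borel_measurable (lebesgue_on {u..v})"
    by (rule continuous_imp_measurable_on_sets_lebesgue[OF assms(1)]) auto
  show "bounded (f ` {u..v})"
    by (intro compact_imp_bounded compact_continuous_image assms(1) compact_Icc)
qed (use assms in auto)

lemma AE_imp_negligible: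
  assumes "AE t\<in>S in lebesgue. P t"
  shows "negligible {t \<in> S. \<not> P t}"
proof -
  obtain M where "M \<in> null_sets lebesgue" "{t \<in> space lebesgue. \<not> (t \<in> S \<longrightarrow> P t)} \<subseteq> M"
    using assms unfolding eventually_ae_filter by blast
  then have "negligible M" "{t \<in> S. \<not> P t} \<subseteq> M" by (auto simp: negligible_iff_null_sets)
  then show ?thesis by (rule negligible_subset)
qed

lemma negligible_imp_AE:
  assumes "negligible M" "\<And>t. t \<in> S - M \<Longrightarrow> P t"
  shows "AE t\<in>S in lebesgue. P t"
proof -
  have "AE t in lebesgue. t \<notin> M" using assms(1) by (simp add: AE_not_in negligible_iff_null_sets)
  then show ?thesis by eventually_elim (use assms(2) in auto)
qed

text \<open>These are the derivative of \<open>\<lambda>s. s ^ 3 / (1 + s\<^sup>2)\<close> and the corresponding Legendre transform.\<close>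

definition slope_cost :: "real \<Rightarrow> real" where
  "slope_cost s = (s ^ 4 + 3 * s\<^sup>2) / (1 + s\<^sup>2)\<^sup>2"

definition slope_cost_conj :: "real \<Rightarrow> real" where
  "slope_cost_conj s = 2 * s ^ 3 / (1 + s\<^sup>2)\<^sup>2"

definition resistance :: "real \<Rightarrow> real \<Rightarrow> real" where
  "resistance p q = (pos_part q) ^ 3 / (p\<^sup>2 + q\<^sup>2)"

text \<open>The Weierstrass excess: the height of \<open>resistance\<close> at \<open>(p, q)\<close>
  above its tangent plane at \<open>(1, s)\<close>.\<close>

definition resistance_gap :: "real \<Rightarrow> real \<Rightarrow> real \<Rightarrow> real" where
  "resistance_gap s p q = resistance p q - slope_cost s * q + slope_cost_conj s * p"

lemma slope_cost_01: "0 \<le> s \<Longrightarrow> s \<le> 1 \<Longrightarrow> 0 \<le> slope_cost s \<and> slope_cost s \<le> 1"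
proof -
  assume s: "0 \<le> s" "s \<le> 1"
  have "s\<^sup>2 \<le> 1" using s by (simp add: power_le_one)
  moreover have "s ^ 4 + 3 * s\<^sup>2 = (1 + s\<^sup>2)\<^sup>2 - (1 - s\<^sup>2)" by (simp add: algebra_simps power2_eq_square power4_eq_xxxx)
  ultimately have "s ^ 4 + 3 * s\<^sup>2 \<le> (1 + s\<^sup>2)\<^sup>2" by linarith
  moreover have "(1 + s\<^sup>2)\<^sup>2 > 0" using one_plus_square_pos[of s] by (rule zero_less_power)
  ultimately show ?thesis using s by (simp add: slope_cost_def)
qed

text \<open>Tangency makes \<open>q = s * p\<close> a double zero of the numerator. The cofactor is
  linear, and for \<open>p\<close>, \<open>q\<close>, \<open>s\<close> nonnegative the condition
  \<open>s \<le> 1\<close> makes both of its terms nonnegative.\<close>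

lemma resistance_gap_eq:
  assumes "0 \<le> q" "p\<^sup>2 + q\<^sup>2 \<noteq> 0"
  shows "resistance_gap s p q * ((p\<^sup>2 + q\<^sup>2) * (1 + s\<^sup>2)\<^sup>2) = (q - s * p)\<^sup>2 * ((1 - s\<^sup>2) * q + 2 * s * p)"
proof -
  have n: "(1 + s\<^sup>2)\<^sup>2 \<noteq> 0" using one_plus_square_pos[of s] by simp
  define Q where "Q = p\<^sup>2 + q\<^sup>2"
  define S where "S = (1 + s\<^sup>2)\<^sup>2"
  have "resistance_gap s p q * (Q * S) = q ^ 3 * S - (s ^ 4 + 3 * s\<^sup>2) * q * Q + 2 * s ^ 3 * p * Q"
    using assms n unfolding resistance_gap_def resistance_def slope_cost_def slope_cost_conj_def
      pos_part_def Q_def[symmetric] S_def[symmetric] by (simp add: field_simps)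
  also have "\<dots> = (q - s * p)\<^sup>2 * ((1 - s\<^sup>2) * q + 2 * s * p)"
    unfolding Q_def S_def by algebra
  finally show ?thesis by (simp add: Q_def S_def)
qed

lemma resistance_gap_neg:
  "q \<le> 0 \<Longrightarrow> resistance_gap s p q = slope_cost s * (- q) + slope_cost_conj s * p"
  by (simp add: resistance_gap_def resistance_def pos_part_def max_def)

lemma slope_cost_conj_nonneg: "0 \<le> s \<Longrightarrow> 0 \<le> slope_cost_conj s"
  by (simp add: slope_cost_conj_def)

lemma continuous_on_slope_cost_conj: "continuous_on UNIV slope_cost_conj"
proof -
  have "(1 + s\<^sup>2)\<^sup>2 \<noteq> 0" for s :: real using one_plus_square_pos[of s] by simp
  then show ?thesis unfolding slope_cost_conj_def by (intro continuous_intros) auto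
qed

lemma resistance_gap_nonneg:
  assumes s: "0 \<le> s" "s \<le> 1" and p: "0 \<le> p"
  shows "0 \<le> resistance_gap s p q"
proof (cases "q \<le> 0")
  case True
  then show ?thesis
    using slope_cost_01[OF s] slope_cost_conj_nonneg[OF s(1)] p
    unfolding resistance_gap_neg[OF True] by (intro add_nonneg_nonneg mult_nonneg_nonneg) auto
next
  case False
  then have Q: "p\<^sup>2 + q\<^sup>2 > 0" by (simp add: add_nonneg_pos)
  have S: "(1 + s\<^sup>2)\<^sup>2 > 0" using one_plus_square_pos[of s] by (rule zero_less_power)
  have "s\<^sup>2 \<le> 1" using s by (simp add: power_le_one)
  then have "0 \<le> (q - s * p)\<^sup>2 * ((1 - s\<^sup>2) * q + 2 * s * p)" using False s p by simp
  then have "0 \<le> resistance_gap s p q * ((p\<^sup>2 + q\<^sup>2) * (1 + s\<^sup>2)\<^sup>2)"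
    using resistance_gap_eq[of q p s] False Q by simp
  then show ?thesis using mult_pos_pos[OF Q S] by (simp add: zero_le_mult_iff)
qed

text \<open>At \<open>s = 0\<close> the tangent plane is zero, so every non-ascending direction is
  free. At \<open>s = 1\<close> the linear cofactor degenerates to \<open>2 * p\<close>, and
  vertical directions join the slope 1. Strictly in between the cofactor is positive and only the
  direction of tangency remains.\<close>

lemma resistance_gap_zero_imp:
  assumes s: "0 \<le> s" "s \<le> 1" and p: "0 \<le> p" and ne: "p \<noteq> 0 \<or> q \<noteq> 0"
    and z: "resistance_gap s p q = 0"
  shows "s = 0 \<Longrightarrow> q \<le> 0" "0 < s \<Longrightarrow> s < 1 \<Longrightarrow> q = s * p" "s = 1 \<Longrightarrow> p \<le> q"
proof -
  have 1: "(q - s * p)\<^sup>2 * ((1 - s\<^sup>2) * q + 2 * s * p) = 0" if "q \<ge> 0"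
    using resistance_gap_eq[of q p s] that ne z by auto
  have neg: False if "q < 0" "0 < s"
  proof -
    have "slope_cost s > 0"
      using that(2) one_plus_square_pos[of s] unfolding slope_cost_def
      by (intro divide_pos_pos add_pos_pos zero_less_power mult_pos_pos) auto
    then have "slope_cost s * (- q) > 0" using that(1) by (simp add: mult_pos_neg)
    moreover have "slope_cost_conj s * p \<ge> 0" using slope_cost_conj_nonneg[OF s(1)] p by simp
    ultimately show False using z resistance_gap_neg[of q s p] that by simp
  qed
  show "q \<le> 0" if "s = 0"
    using 1 that by (cases "q \<ge> 0") auto
  show "q = s * p" if "0 < s" "s < 1"
  proof -
    have "q \<ge> 0" using neg that by force
    have "s\<^sup>2 < 1" using that by (simp add: power_less_one_iff abs_square_less_1)
    then have "(1 - s\<^sup>2) * q \<ge> 0" "2 * s * p \<ge> 0" using \<open>q \<ge> 0\<close> p that by auto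
    moreover have "(1 - s\<^sup>2) * q > 0 \<or> 2 * s * p > 0"
      using ne \<open>s\<^sup>2 < 1\<close> \<open>q \<ge> 0\<close> p that by auto
    ultimately have "(1 - s\<^sup>2) * q + 2 * s * p > 0" by linarith
    then show ?thesis using 1[OF \<open>q \<ge> 0\<close>] by simp
  qed
  show "p \<le> q" if "s = 1"
  proof -
    have "q \<ge> 0" using neg that by force
    then show ?thesis using 1[OF \<open>q \<ge> 0\<close>] that by auto
  qed
qed

lemma resistance_gap_zero:
  assumes "0 \<le> s" "s \<le> 1" "0 \<le> p" "q = s * p \<or> s = 1 \<and> p = 0 \<and> 0 \<le> q"
  shows "resistance_gap s p q = 0"
proof (cases "p\<^sup>2 + q\<^sup>2 = 0")
  case True
  then have "p = 0" "q = 0" by (auto simp: sum_power2_eq_zero_iff)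
  then show ?thesis by (simp add: resistance_gap_def resistance_def pos_part_def)
next
  case False
  have "q \<ge> 0" using assms by auto
  have "(q - s * p)\<^sup>2 * ((1 - s\<^sup>2) * q + 2 * s * p) = 0" using assms by auto
  moreover have "(p\<^sup>2 + q\<^sup>2) * (1 + s\<^sup>2)\<^sup>2 \<noteq> 0"
    using False one_plus_square_pos[of s] by simp
  ultimately show ?thesis using resistance_gap_eq[OF \<open>q \<ge> 0\<close> False, of s] by (metis mult_eq_0_iff)
qed

section \<open>Inverting the slope cost\<close>

text \<open>The equation \<open>slope_cost s = m\<close> is quadratic in \<open>s\<^sup>2\<close>; the root is written so that \<open>m = 1\<close>
  causes no division by \<open>0\<close>.\<close>

definition slope_of :: "real \<Rightarrow> real" where
  "slope_of m = sqrt (2 * m / (3 - 2 * m + sqrt (9 - 8 * m)))"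

lemma slope_of_0 [simp]: "slope_of 0 = 0" and slope_of_1 [simp]: "slope_of 1 = 1"
  by (simp_all add: slope_of_def)

lemma slope_of_sq:
  assumes "0 \<le> m" "m \<le> 1"
  shows "0 \<le> slope_of m" "slope_of m \<le> 1" "(slope_of m)\<^sup>2 = 2 * m / (3 - 2 * m + sqrt (9 - 8 * m))"
    "1 \<le> sqrt (9 - 8 * m)" "2 \<le> 3 - 2 * m + sqrt (9 - 8 * m)"
proof -
  show r: "1 \<le> sqrt (9 - 8 * m)" using assms by simp
  then show d: "2 \<le> 3 - 2 * m + sqrt (9 - 8 * m)" using assms by linarith
  then have pos: "0 \<le> 2 * m / (3 - 2 * m + sqrt (9 - 8 * m))" using assms by simp
  then show "0 \<le> slope_of m" and sq: "(slope_of m)\<^sup>2 = 2 * m / (3 - 2 * m + sqrt (9 - 8 * m))"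
    by (auto simp: slope_of_def)
  have "2 * m / (3 - 2 * m + sqrt (9 - 8 * m)) \<le> 1" using assms d by (simp add: divide_le_eq)
  then show "slope_of m \<le> 1" by (simp add: slope_of_def)
qed

lemma slope_cost_slope_of:
  assumes "0 \<le> m" "m \<le> 1"
  shows "slope_cost (slope_of m) = m"
proof -
  define r where "r = sqrt (9 - 8 * m)"
  define w where "w = (slope_of m)\<^sup>2"
  have r: "r\<^sup>2 = 9 - 8 * m" "1 \<le> r" and d: "3 - 2 * m + r > 0"
    using slope_of_sq(4,5)[OF assms] assms by (auto simp: r_def)
  have w: "w * (3 - 2 * m + r) = 2 * m"
    using slope_of_sq(3)[OF assms] d by (simp add: w_def r_def)
  have "m = (9 - r\<^sup>2) / 8" using r by simp
  \<comment> \<open>In terms of \<open>w = s\<^sup>2\<close> the equation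
    \<open>slope_cost s = m\<close> reads \<open>(1 - m) * w\<^sup>2 + (3 - 2 * m) * w = m\<close>,
    with discriminant \<open>9 - 8 * m\<close>. It is verified after multiplication by the squared
    denominator of \<open>w\<close>.\<close>
  have "((1 - m) * w\<^sup>2 + (3 - 2 * m) * w - m) * (3 - 2 * m + r)\<^sup>2 = 0"
  proof -
    have "((1 - m) * w\<^sup>2 + (3 - 2 * m) * w - m) * (3 - 2 * m + r)\<^sup>2
      = (1 - m) * (w * (3 - 2 * m + r))\<^sup>2 + (3 - 2 * m) * (w * (3 - 2 * m + r)) * (3 - 2 * m + r)
        - m * (3 - 2 * m + r)\<^sup>2" by algebra
    also have "\<dots> = 0" unfolding w using r(1) by algebra
    finally show ?thesis .
  qed
  then have "(1 - m) * w\<^sup>2 + (3 - 2 * m) * w - m = 0" using d by simp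
  then have "w\<^sup>2 + 3 * w = m * (1 + w)\<^sup>2" by algebra
  moreover have "(1 + w)\<^sup>2 > 0" unfolding w_def by (intro zero_less_power one_plus_square_pos)
  ultimately have "(w\<^sup>2 + 3 * w) / (1 + w)\<^sup>2 = m" by simp
  then show ?thesis by (simp add: slope_cost_def w_def power_mult[symmetric])
qed

lemma slope_of_pos: "0 < m \<Longrightarrow> m \<le> 1 \<Longrightarrow> 0 < slope_of m"
  using slope_cost_slope_of[of m] slope_of_sq(1)[of m]
  by (cases "slope_of m = 0") (auto simp: slope_cost_def)

lemma slope_of_less_1: "0 \<le> m \<Longrightarrow> m < 1 \<Longrightarrow> slope_of m < 1"
  using slope_cost_slope_of[of m] slope_of_sq(2)[of m]
  by (cases "slope_of m = 1") (auto simp: slope_cost_def)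

lemma slope_of_mono:
  assumes "0 \<le> m" "m \<le> n" "n \<le> 1"
  shows "slope_of m \<le> slope_of n"
proof -
  have "2 * m / (3 - 2 * m + sqrt (9 - 8 * m)) \<le> 2 * n / (3 - 2 * n + sqrt (9 - 8 * n))"
  proof (rule frac_le)
    show "3 - 2 * n + sqrt (9 - 8 * n) \<le> 3 - 2 * m + sqrt (9 - 8 * m)"
    proof -
      have "sqrt (9 - 8 * n) \<le> sqrt (9 - 8 * m)" using assms by (intro real_sqrt_le_mono) auto
      then show ?thesis using assms by linarith
    qed
    show "0 < 3 - 2 * n + sqrt (9 - 8 * n)" using slope_of_sq(5)[of n] assms by linarith
  qed (use assms in auto)
  then show ?thesis by (simp add: slope_of_def)
qed

lemma continuous_on_slope_of: "continuous_on {0..1} slope_of"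
proof -
  have "3 - 2 * x + sqrt (9 - 8 * x) \<noteq> 0" if "x \<in> {0..1}" for x
    using slope_of_sq(5)[of x] that by auto
  then show ?thesis unfolding slope_of_def by (intro continuous_intros) auto
qed

text \<open>The momentum at abscissa \<open>\<xi>\<close>: \<open>k\<close> is its uncut value at
  the right wall, \<open>l\<close> the multiplier of the area. The cut-offs place it in the domain
  of \<open>slope_of\<close> for all real parameters, so that continuity in \<open>(k, l)\<close>
  holds on the whole plane.\<close>

definition costate :: "real \<Rightarrow> real \<Rightarrow> real \<Rightarrow> real \<Rightarrow> real" where
  "costate a k l \<xi> = min 1 (max 0 (k - l * (a - \<xi>)))"

definition opt_slope :: "real \<Rightarrow> real \<Rightarrow> real \<Rightarrow> real \<Rightarrow> real" where
  "opt_slope a k l \<xi> = slope_of (costate a k l \<xi>)"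

lemma costate_01: "0 \<le> costate a k l \<xi>" "costate a k l \<xi> \<le> 1"
  by (auto simp: costate_def)

lemma opt_slope_01: "0 \<le> opt_slope a k l \<xi>" "opt_slope a k l \<xi> \<le> 1"
  using slope_of_sq(1,2)[OF costate_01] by (auto simp: opt_slope_def)

lemma slope_cost_opt_slope: "slope_cost (opt_slope a k l \<xi>) = costate a k l \<xi>"
  unfolding opt_slope_def by (rule slope_cost_slope_of[OF costate_01])

lemma continuous_on_opt_slope: "continuous_on UNIV (\<lambda>(k, l, \<xi>). opt_slope a k l \<xi>)"
proof -
  have "continuous_on UNIV (slope_of \<circ> (\<lambda>(k, l, \<xi>). costate a k l \<xi>))"
  proof (rule continuous_on_compose)
    show "continuous_on UNIV (\<lambda>(k, l, \<xi>). costate a k l \<xi>)"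
      unfolding costate_def case_prod_unfold by (intro continuous_intros)
    show "continuous_on (range (\<lambda>(k, l, \<xi>). costate a k l \<xi>)) slope_of"
      by (rule continuous_on_subset[OF continuous_on_slope_of]) (auto simp: costate_01)
  qed
  then show ?thesis by (simp add: opt_slope_def comp_def case_prod_unfold)
qed

lemma continuous_on_opt_slope': "continuous_on S (opt_slope a k l)"
proof -
  have "continuous_on S (\<lambda>\<xi>. (\<lambda>(k, l, \<xi>). opt_slope a k l \<xi>) (k, l, \<xi>))"
    by (rule continuous_on_compose2[OF continuous_on_opt_slope]) (auto intro!: continuous_intros)
  then show ?thesis by simp
qed

section \<open>Calculus along a single admissible curve\<close>

locale adm_curve =
  fixes a h L :: real and \<gamma> :: curve
  assumes a_pos: "a > 0" and h_pos: "h > 0" and adm: "\<gamma> \<in> admissible a h L"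
begin

definition "x t = fst (\<gamma> t)"
definition "y t = snd (\<gamma> t)"
definition "p t = fst (vel \<gamma> t)"
definition "q t = snd (vel \<gamma> t)"

text \<open>The end points belong to the exceptional set because the two-sided derivative there
  depends on values of the curve outside \<open>{0..1}\<close>.\<close>

definition "N = {0, 1} \<union> {t \<in> {0..1}. \<not> x differentiable (at t)} \<union> {t \<in> {0..1}. \<not> y differentiable (at t)}
   \<union> {t \<in> {0<..<1}. \<not> norm (vel \<gamma> t) \<noteq> 0} \<union> {t \<in> {0<..<1}. \<not> fst (vel \<gamma> t) \<ge> 0}"

lemma ac: "abs_cont_on 0 1 \<gamma>"
  and ends: "x 0 = 0" "y 0 = 0" "x 1 = a" "y 1 = h"
  and inj: "inj_on \<gamma> {0..1}"
  using adm by (auto simp: admissible_def x_def y_def)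

lemma range_x: "t \<in> {0..1} \<Longrightarrow> x t \<in> {0..a}" and range_y: "t \<in> {0..1} \<Longrightarrow> y t \<in> {0..h}"
  using adm unfolding admissible_def x_def y_def by (auto simp: image_subset_iff mem_Times_iff)

lemma ac_x: "abs_cont_on 0 1 x" and ac_y: "abs_cont_on 0 1 y"
  unfolding x_def y_def
  by (rule abs_cont_on_dominated[OF ac, of _ 1]; simp add: dist_fst_le dist_snd_le)+

lemma continuous_x: "continuous_on {0..1} x" and continuous_y: "continuous_on {0..1} y"
  using abs_cont_on_continuous ac_x ac_y by auto

lemma negligible_N: "negligible N"
  unfolding N_def
proof (intro negligible_Un)
  show "negligible {t \<in> {0<..<1}. \<not> norm (vel \<gamma> t) \<noteq> 0}" "negligible {t \<in> {0<..<1}. \<not> fst (vel \<gamma> t) \<ge> 0}"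
    by (rule AE_imp_negligible, use adm in \<open>simp add: admissible_def\<close>)+
qed (use abs_cont_on_differentiable_ae[OF ac_x] abs_cont_on_differentiable_ae[OF ac_y] in auto)

lemma velocity:
  assumes "t \<in> {0..1} - N"
  shows "(x has_real_derivative p t) (at t)" "(y has_real_derivative q t) (at t)"
    "0 \<le> p t" "p t \<noteq> 0 \<or> q t \<noteq> 0"
proof -
  obtain x' y' where d: "(x has_real_derivative x') (at t)" "(y has_real_derivative y') (at t)"
    using assms unfolding N_def real_differentiable_def by blast
  then have "((\<lambda>t. (x t, y t)) has_vector_derivative (x', y')) (at t)"
    unfolding has_real_derivative_iff_has_vector_derivative by (rule has_vector_derivative_Pair)
  then have "vel \<gamma> t = (x', y')" by (simp add: x_def y_def vector_derivative_at)
  then show "(x has_real_derivative p t) (at t)" "(y has_real_derivative q t) (at t)"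
    using d by (auto simp: p_def q_def)
  have "norm (vel \<gamma> t) \<noteq> 0" "fst (vel \<gamma> t) \<ge> 0" using assms unfolding N_def by force+
  then show "0 \<le> p t" "p t \<noteq> 0 \<or> q t \<noteq> 0" by (auto simp: p_def q_def prod_eq_iff)
qed

lemma ftc:
  assumes "0 \<le> u" "u \<le> v" "v \<le> 1" "abs_cont_on 0 1 \<Phi>"
    and "\<And>t. t \<in> {u..v} - N \<Longrightarrow> (\<Phi> has_real_derivative \<phi> t) (at t)"
  shows "(\<phi> has_integral \<Phi> v - \<Phi> u) {u..v}" "\<phi> absolutely_integrable_on {u..v}"
proof -
  have ac: "abs_cont_on u v \<Phi>" by (rule abs_cont_on_subinterval[OF assms(4) assms(1,3)])
  have d: "(\<Phi> has_vector_derivative \<phi> t) (at t within {u..v})" if "t \<in> {u..v} - N" for t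
    using assms(5)[OF that] by (simp add: has_real_derivative_iff_has_vector_derivative has_vector_derivative_at_within)
  show "(\<phi> has_integral \<Phi> v - \<Phi> u) {u..v}"
    by (rule abs_cont_on_has_integral[OF ac assms(2) negligible_N d])
  show "\<phi> absolutely_integrable_on {u..v}"
    by (rule abs_cont_on_absolutely_integrable[OF ac assms(2) negligible_N d])
qed

text \<open>The additional null set \<open>M\<close> admits sign information that holds only almost
  everywhere, such as that drawn from a gap vanishing off a null set.\<close>

lemma ftc_mono:
  assumes "0 \<le> u" "u \<le> v" "v \<le> 1" "abs_cont_on 0 1 \<Phi>"
    and "\<And>t. t \<in> {u..v} - N \<Longrightarrow> (\<Phi> has_real_derivative \<phi> t) (at t)"
    and M: "negligible M" "\<And>t. t \<in> {u<..<v} - (N \<union> M) \<Longrightarrow> 0 \<le> \<phi> t"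
  shows "\<Phi> u \<le> \<Phi> v"
proof -
  have neg: "negligible (N \<union> M \<union> {u, v})" using negligible_N M(1) by (simp add: negligible_Un negligible_finite)
  have "((\<lambda>t. if t \<in> N \<union> M \<union> {u, v} then 0 else \<phi> t) has_integral \<Phi> v - \<Phi> u) {u..v}"
    by (rule has_integral_spike[OF neg _ ftc(1)[OF assms(1-5)]]) auto
  then have "0 \<le> \<Phi> v - \<Phi> u"
    by (rule has_integral_nonneg) (use M(2) in auto)
  then show ?thesis by simp
qed

lemma x_mono: "0 \<le> s \<Longrightarrow> s \<le> t \<Longrightarrow> t \<le> 1 \<Longrightarrow> x s \<le> x t"
  by (rule ftc_mono[OF _ _ _ ac_x, of s t p "{}"]) (auto intro: velocity)

lemma integrable_p: "p absolutely_integrable_on {0..1}" and integrable_q: "q absolutely_integrable_on {0..1}"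
  by (rule ftc(2)[of 0 1 x], use ac_x velocity in auto) (rule ftc(2)[of 0 1 y], use ac_y velocity in auto)

lemma integrable_xq: "(\<lambda>t. x t * q t) absolutely_integrable_on {0..1}"
  and integrable_yp: "(\<lambda>t. y t * p t) absolutely_integrable_on {0..1}"
  by (intro continuous_times_absolutely_integrable continuous_x continuous_y integrable_p integrable_q)+

lemma integral_xq: "integral {0..1} (\<lambda>t. x t * q t) = a * h - L"
  using set_lebesgue_integral_eq_integral(2)[OF integrable_xq] adm
  by (simp add: admissible_def x_def q_def)

lemma ac_xy: "abs_cont_on 0 1 (\<lambda>t. x t * y t)"
  by (rule abs_cont_on_mult[OF ac_x ac_y])

text \<open>Integration by parts turns the constraint into its geometric form: \<open>L\<close> is
  the area under the curve.\<close>

lemma integral_yp: "integral {0..1} (\<lambda>t. y t * p t) = L"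
proof -
  have "((\<lambda>t. x t * q t + y t * p t) has_integral x 1 * y 1 - x 0 * y 0) {0..1}"
    by (rule ftc(1)[OF _ _ _ ac_xy]) (auto intro!: derivative_eq_intros velocity)
  then have "integral {0..1} (\<lambda>t. x t * q t + y t * p t) = a * h"
    by (simp add: ends integral_unique)
  moreover have "integral {0..1} (\<lambda>t. x t * q t + y t * p t)
      = integral {0..1} (\<lambda>t. x t * q t) + integral {0..1} (\<lambda>t. y t * p t)"
    by (intro integral_add set_lebesgue_integral_eq_integral(1) integrable_xq integrable_yp)
  ultimately show ?thesis using integral_xq by simp
qed

text \<open>The integrand lies between 0 and the norm of \<open>q\<close>, which is
  integrable.\<close>

lemma integrable_resistance: "(\<lambda>t. resistance (p t) (q t)) absolutely_integrable_on {0..1}"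
proof (rule measurable_bounded_by_integrable_imp_absolutely_integrable)
  have m: "p \<in> borel_measurable (lebesgue_on {0..1})" "q \<in> borel_measurable (lebesgue_on {0..1})"
    by (intro integrable_imp_measurable set_lebesgue_integral_eq_integral(1) integrable_p integrable_q)+
  show "(\<lambda>t. resistance (p t) (q t)) \<in> borel_measurable (lebesgue_on {0..1})"
    unfolding resistance_def pos_part_def
    by (intro borel_measurable_divide borel_measurable_power borel_measurable_add borel_measurable_max m borel_measurable_const)
  show "(\<lambda>t. norm (q t)) integrable_on {0..1}"
    using integrable_q absolutely_integrable_on_def by blast
  fix t :: real
  show "norm (resistance (p t) (q t)) \<le> norm (q t)"
  proof (cases "q t \<le> 0")
    case True
    then show ?thesis by (simp add: resistance_def pos_part_def max_def)
  next
    case False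
    have "q t * (q t)\<^sup>2 \<le> q t * ((p t)\<^sup>2 + (q t)\<^sup>2)"
      using False by (intro mult_left_mono) auto
    then have "q t ^ 3 \<le> q t * ((p t)\<^sup>2 + (q t)\<^sup>2)"
      by (simp add: power3_eq_cube power2_eq_square)
    then have "q t ^ 3 / ((p t)\<^sup>2 + (q t)\<^sup>2) \<le> q t"
      using False by (simp add: divide_le_eq add_nonneg_pos)
    moreover have "0 \<le> q t ^ 3 / ((p t)\<^sup>2 + (q t)\<^sup>2)" using False by simp
    ultimately show ?thesis using False by (simp add: resistance_def pos_part_def max_def)
  qed
qed auto

lemma functional_F_eq: "functional_F \<gamma> = integral {0..1} (\<lambda>t. resistance (p t) (q t))"
  using set_lebesgue_integral_eq_integral(2)[OF integrable_resistance]
  by (simp add: functional_F_def resistance_def p_def q_def)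

text \<open>Since \<open>x\<close> is nondecreasing, the lower cut-off of the costate stops acting
  at a single time \<open>t0\<close>. The alternative makes the boundary term
  \<open>(k - l * (a - x t0)) * y t0\<close> of a later integration by parts vanish: either the
  first factor is 0, or \<open>t0 = 0\<close> and the curve starts at height 0.\<close>

lemma switching_time:
  assumes "0 < k" "0 \<le> l"
  shows "\<exists>t0\<in>{0..1}. (t0 = 0 \<or> k - l * (a - x t0) = 0) \<and> (\<forall>t\<in>{t0..1}. 0 \<le> k - l * (a - x t))"
proof (cases "0 \<le> k - l * a")
  case True
  have "0 \<le> k - l * (a - x t)" if "t \<in> {0..1}" for t
  proof -
    have "l * (a - x t) \<le> l * a" using range_x[OF that] assms by (intro mult_left_mono) auto
    then show ?thesis using True by linarith
  qed
  then show ?thesis by (intro bexI[of _ 0]) auto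
next
  case False
  have "\<exists>t\<ge>0. t \<le> 1 \<and> k - l * (a - x t) = 0"
    by (rule IVT') (use False assms in \<open>auto simp: ends intro!: continuous_intros continuous_x\<close>)
  then obtain t0 where t0: "0 \<le> t0" "t0 \<le> 1" "k - l * (a - x t0) = 0" by blast
  have "0 \<le> k - l * (a - x t)" if "t \<in> {t0..1}" for t
  proof -
    have "l * (a - x t) \<le> l * (a - x t0)"
      using x_mono[of t0 t] that t0 assms by (intro mult_left_mono) auto
    then show ?thesis using t0(3) by linarith
  qed
  then show ?thesis using t0 by (intro bexI[of _ t0]) auto
qed

lemma costate_before:
  assumes "0 \<le> l" "t0 = 0 \<or> k - l * (a - x t0) = 0" "t0 \<le> 1" "t \<in> {0<..<t0}"
  shows "costate a k l (x t) = 0"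
proof -
  have "k - l * (a - x t0) = 0" using assms(2,4) by auto
  moreover have "l * (a - x t0) \<le> l * (a - x t)"
    using x_mono[of t t0] assms by (intro mult_left_mono) auto
  ultimately have "k - l * (a - x t) \<le> 0" by linarith
  then show ?thesis by (simp add: costate_def)
qed

lemma costate_eq:
  assumes "k \<le> 1" "0 \<le> l" "t \<in> {0..1}" "0 \<le> k - l * (a - x t)"
  shows "costate a k l (x t) = k - l * (a - x t)"
proof -
  have "0 \<le> l * (a - x t)" using range_x[OF assms(3)] assms(2) by simp
  then show ?thesis using assms by (simp add: costate_def)
qed

definition "gap k l t = resistance_gap (opt_slope a k l (x t)) (p t) (q t)"

lemma continuous_slope: "continuous_on {0..1} (\<lambda>t. opt_slope a k l (x t))"
  by (rule continuous_on_compose2[OF continuous_on_opt_slope'[of UNIV] continuous_x]) auto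

lemma continuous_costate: "continuous_on {0..1} (\<lambda>t. costate a k l (x t))"
  unfolding costate_def by (intro continuous_intros continuous_x)

lemma continuous_conj: "continuous_on {0..1} (\<lambda>t. slope_cost_conj (opt_slope a k l (x t)))"
  by (rule continuous_on_compose2[OF continuous_on_slope_cost_conj continuous_slope]) auto

lemma gap_eq: "gap k l t = resistance (p t) (q t) - costate a k l (x t) * q t
    + slope_cost_conj (opt_slope a k l (x t)) * p t"
  by (simp add: gap_def resistance_gap_def slope_cost_opt_slope)

lemma integrable_costate_q: "(\<lambda>t. costate a k l (x t) * q t) absolutely_integrable_on {0..1}"
  by (intro continuous_times_absolutely_integrable continuous_costate integrable_q)

lemma integrable_conj_p: "(\<lambda>t. slope_cost_conj (opt_slope a k l (x t)) * p t) absolutely_integrable_on {0..1}"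
  by (intro continuous_times_absolutely_integrable continuous_conj integrable_p)

lemma integrable_gap: "gap k l absolutely_integrable_on {0..1}"
  unfolding gap_eq[abs_def]
  by (intro set_integral_add(1) set_integral_diff(1) integrable_resistance integrable_costate_q integrable_conj_p)

text \<open>The costate is the affine function \<open>k - l (a - x)\<close> of the area multiplier, cut off at \<open>0\<close>; up to the
  time \<open>t0\<close> the cut-off part is bounded below through the constraint \<open>0 \<le> y\<close>.\<close>

lemma calibration:
  assumes k: "0 < k" "k \<le> 1" and l: "0 \<le> l"
    and G: "G 0 = 0" "\<And>\<xi>. \<xi> \<in> {0..a} \<Longrightarrow> (G has_real_derivative slope_cost_conj (opt_slope a k l \<xi>)) (at \<xi>)"
    and t0: "t0 \<in> {0..1}" "t0 = 0 \<or> k - l * (a - x t0) = 0" "\<And>t. t \<in> {t0..1} \<Longrightarrow> 0 \<le> k - l * (a - x t)"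
  shows "functional_F \<gamma> = k * h - l * L - G a + integral {0..1} (gap k l) + l * integral {0..t0} (\<lambda>t. y t * p t)"
proof -
  have acG: "abs_cont_on 0 1 (\<lambda>t. G (x t))"
  proof (rule abs_cont_on_C1_compose[OF ac_x])
    show "x ` {0..1} \<subseteq> {0..a}" using range_x by blast
    show "(G has_real_derivative slope_cost_conj (opt_slope a k l z)) (at z within {0..a})" if "z \<in> {0..a}" for z
      using G(2)[OF that] by (rule has_field_derivative_at_within)
    show "continuous_on {0..a} (\<lambda>z. slope_cost_conj (opt_slope a k l z))"
      by (rule continuous_on_compose2[OF continuous_on_slope_cost_conj continuous_on_opt_slope']) auto
  qed
  \<comment> \<open>This term is exact: its integrand is the derivative of \<open>G (x t)\<close>,
    so only the end points count.\<close>
  have "((\<lambda>t. slope_cost_conj (opt_slope a k l (x t)) * p t) has_integral G (x 1) - G (x 0)) {0..1}"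
  proof (rule ftc(1)[OF _ _ _ acG])
    fix t assume t: "t \<in> {0..1} - N"
    then have "(G has_real_derivative slope_cost_conj (opt_slope a k l (x t))) (at (x t))"
      using range_x[of t] by (intro G(2)) auto
    from DERIV_chain2[OF this velocity(1)[OF t]]
    show "((\<lambda>t. G (x t)) has_real_derivative slope_cost_conj (opt_slope a k l (x t)) * p t) (at t)" .
  qed auto
  then have IG: "integral {0..1} (\<lambda>t. slope_cost_conj (opt_slope a k l (x t)) * p t) = G a"
    using G(1) by (simp add: ends integral_unique)
  let ?A = "\<lambda>t. k - l * (a - x t)"
  let ?I = "integral {0..t0} (\<lambda>t. y t * p t)"
  have yp: "(\<lambda>t. y t * p t) integrable_on {0..1}"
    by (rule set_lebesgue_integral_eq_integral(1)[OF integrable_yp])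
  have cq: "(\<lambda>t. costate a k l (x t) * q t) integrable_on {0..1}"
    by (rule set_lebesgue_integral_eq_integral(1)[OF integrable_costate_q])
  have yp2: "integral {t0..1} (\<lambda>t. y t * p t) = L - ?I"
    using Henstock_Kurzweil_Integration.integral_combine[OF _ _ yp, of t0] t0(1) integral_yp by simp
  \<comment> \<open>Integrating \<open>?A t * q t\<close> by parts produces
    \<open>l * (y t * p t)\<close>, and with it the area constraint.\<close>
  have "((\<lambda>t. ?A t * q t + l * (y t * p t)) has_integral ?A 1 * y 1 - ?A t0 * y t0) {t0..1}"
  proof (rule ftc(1))
    have "dist (?A s) (?A t) \<le> l * dist (x s) (x t)" for s t
    proof -
      have "?A s - ?A t = l * (x s - x t)" by (simp add: algebra_simps)
      then show ?thesis using l by (simp add: dist_real_def abs_mult)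
    qed
    then show "abs_cont_on 0 1 (\<lambda>t. ?A t * y t)"
      by (intro abs_cont_on_mult[OF abs_cont_on_dominated[OF ac_x] ac_y])
    fix t assume "t \<in> {t0..1} - N"
    then have t: "t \<in> {0..1} - N" using t0(1) by auto
    show "((\<lambda>t. ?A t * y t) has_real_derivative ?A t * q t + l * (y t * p t)) (at t)"
      using velocity(1,2)[OF t] by (auto intro!: derivative_eq_intros)
  qed (use t0(1) in auto)
  moreover have "?A 1 * y 1 - ?A t0 * y t0 = k * h" using t0(2) ends by auto
  ultimately have A: "((\<lambda>t. ?A t * q t + l * (y t * p t)) has_integral k * h) {t0..1}" by simp
  have "(\<lambda>t. y t * p t) integrable_on {t0..1}"
    by (rule integrable_subinterval_real[OF yp]) (use t0(1) in auto)
  then have "((\<lambda>t. l * (y t * p t)) has_integral l * (L - ?I)) {t0..1}"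
    using yp2 has_integral_mult_right integrable_integral by metis
  from has_integral_diff[OF A this]
  have "((\<lambda>t. ?A t * q t) has_integral k * h - l * (L - ?I)) {t0..1}" by simp
  then have "((\<lambda>t. costate a k l (x t) * q t) has_integral k * h - l * (L - ?I)) {t0..1}"
    by (rule has_integral_eq[rotated]) (use costate_eq[OF k(2) l] t0 in auto)
  then have c2: "integral {t0..1} (\<lambda>t. costate a k l (x t) * q t) = k * h - l * (L - ?I)"
    by (rule integral_unique)
  have "((\<lambda>t. costate a k l (x t) * q t) has_integral 0) {0..t0}"
    by (rule has_integral_spike[of "{0, t0}" _ _ "\<lambda>_. 0"])
      (use costate_before[OF l t0(2)] t0(1) in \<open>auto simp: negligible_finite\<close>)
  then have "integral {0..t0} (\<lambda>t. costate a k l (x t) * q t) = 0" by (rule integral_unique)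
  then have IC: "integral {0..1} (\<lambda>t. costate a k l (x t) * q t) = k * h - l * (L - ?I)"
    using Henstock_Kurzweil_Integration.integral_combine[OF _ _ cq, of t0] t0(1) c2 by simp
  have "integral {0..1} (gap k l) = integral {0..1} (\<lambda>t. resistance (p t) (q t))
      - integral {0..1} (\<lambda>t. costate a k l (x t) * q t)
      + integral {0..1} (\<lambda>t. slope_cost_conj (opt_slope a k l (x t)) * p t)"
    unfolding gap_eq[abs_def]
    using set_lebesgue_integral_eq_integral(1)[OF integrable_resistance] cq
      set_lebesgue_integral_eq_integral(1)[OF integrable_conj_p]
    by (simp add: integral_add integral_diff integrable_diff)
  then show ?thesis unfolding functional_F_eq IC IG by (simp add: algebra_simps)
qed

lemma gap_nonneg: "t \<in> {0..1} - N \<Longrightarrow> 0 \<le> gap k l t"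
  unfolding gap_def by (intro resistance_gap_nonneg opt_slope_01 velocity)

lemma integral_gap_nonneg: "0 \<le> integral {0..1} (gap k l)"
proof -
  have "((\<lambda>t. if t \<in> N then 0 else gap k l t) has_integral integral {0..1} (gap k l)) {0..1}"
    by (rule has_integral_spike[OF negligible_N _ integrable_integral])
      (use set_lebesgue_integral_eq_integral(1)[OF integrable_gap] in auto)
  then show ?thesis by (rule has_integral_nonneg) (use gap_nonneg in auto)
qed

lemma integral_yp_nonneg:
  assumes "t0 \<in> {0..1}"
  shows "0 \<le> integral {0..t0} (\<lambda>t. y t * p t)"
proof -
  have "(\<lambda>t. y t * p t) integrable_on {0..t0}"
    by (rule integrable_subinterval_real[OF set_lebesgue_integral_eq_integral(1)[OF integrable_yp]])
      (use assms in auto)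
  then have "((\<lambda>t. if t \<in> N then 0 else y t * p t) has_integral integral {0..t0} (\<lambda>t. y t * p t)) {0..t0}"
    by (intro has_integral_spike[OF negligible_N _ integrable_integral]) auto
  then show ?thesis by (rule has_integral_nonneg) (use velocity(3) range_y assms in auto)
qed

text \<open>The only terms of the calibration identity that depend on the curve are the integral of
  the gap and \<open>l\<close> times that of \<open>y t * p t\<close> up to \<open>t0\<close>. Both
  are nonnegative, so equality annihilates the former.\<close>

lemma functional_F_lower:
  assumes k: "0 < k" "k \<le> 1" and l: "0 \<le> l"
    and G: "G 0 = 0" "\<And>\<xi>. \<xi> \<in> {0..a} \<Longrightarrow> (G has_real_derivative slope_cost_conj (opt_slope a k l \<xi>)) (at \<xi>)"
  shows "k * h - l * L - G a \<le> functional_F \<gamma>"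
    and "functional_F \<gamma> = k * h - l * L - G a \<Longrightarrow> negligible {t \<in> {0..1}. gap k l t \<noteq> 0}"
proof -
  obtain t0 where t0: "t0 \<in> {0..1}" "t0 = 0 \<or> k - l * (a - x t0) = 0" "\<And>t. t \<in> {t0..1} \<Longrightarrow> 0 \<le> k - l * (a - x t)"
    using switching_time[OF k(1) l] by blast
  note eq = calibration[OF k l G t0]
  have "0 \<le> l * integral {0..t0} (\<lambda>t. y t * p t)" using integral_yp_nonneg[OF t0(1)] l by simp
  with eq integral_gap_nonneg[of k l] show "k * h - l * L - G a \<le> functional_F \<gamma>" by linarith
  assume "functional_F \<gamma> = k * h - l * L - G a"
  with eq integral_gap_nonneg[of k l] \<open>0 \<le> l * _\<close> have "integral {0..1} (gap k l) = 0" by linarith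
  then show "negligible {t \<in> {0..1}. gap k l t \<noteq> 0}"
    using nonneg_integral_zero_imp_negligible[OF integrable_gap _ negligible_N, of k l] gap_nonneg[of _ k l]
    by blast
qed

text \<open>The assumption \<open>flat\<close> removes the loss caused by the cut-off: as long as
  the costate is 0, the curve runs along the bottom.\<close>

lemma functional_F_attained:
  assumes k: "0 < k" "k \<le> 1" and l: "0 \<le> l"
    and G: "G 0 = 0" "\<And>\<xi>. \<xi> \<in> {0..a} \<Longrightarrow> (G has_real_derivative slope_cost_conj (opt_slope a k l \<xi>)) (at \<xi>)"
    and M: "negligible M" and gap: "\<And>t. t \<in> {0..1} - (N \<union> M) \<Longrightarrow> gap k l t = 0"
    and flat: "\<And>t. t \<in> {0..1} \<Longrightarrow> costate a k l (x t) = 0 \<Longrightarrow> y t = 0"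
  shows "functional_F \<gamma> = k * h - l * L - G a"
proof -
  obtain t0 where t0: "t0 \<in> {0..1}" "t0 = 0 \<or> k - l * (a - x t0) = 0" "\<And>t. t \<in> {t0..1} \<Longrightarrow> 0 \<le> k - l * (a - x t)"
    using switching_time[OF k(1) l] by blast
  have "negligible (N \<union> M)" using M negligible_N by simp
  then have "integral {0..1} (gap k l) = integral {0..1} (\<lambda>_ :: real. 0)"
    by (rule integral_spike) (use gap in auto)
  moreover have "integral {0..t0} (\<lambda>t. y t * p t) = integral {0..t0} (\<lambda>_ :: real. 0)"
    by (rule integral_spike[of "{0, t0}"])
      (use costate_before[OF l t0(2)] flat t0(1) in \<open>auto simp: negligible_finite\<close>)
  ultimately show ?thesis using calibration[OF k l G t0] by simp
qed

end

section \<open>Uniqueness of calibrated curves\<close>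

text \<open>The sum of the coordinates serves as a common parameter. On \<open>C\<close> it
  determines the point, so both curves visit the same points in the order of increasing sums, and
  \<open>\<phi>\<close> sends \<open>t\<close> to the time at which \<open>\<eta>\<close> has the
  sum of \<open>\<gamma> t\<close>.\<close>

lemma reparam_same_sums:
  fixes \<gamma> \<eta> :: curve
  defines "s \<equiv> \<lambda>z :: real \<times> real. fst z + snd z"
  assumes cont: "continuous_on {0..1} (\<lambda>t. s (\<gamma> t))" "continuous_on {0..1} (\<lambda>t. s (\<eta> t))"
    and mono: "mono_on {0..1} (\<lambda>t. s (\<gamma> t))" "mono_on {0..1} (\<lambda>t. s (\<eta> t))"
    and ends: "\<gamma> 0 = \<eta> 0" "\<gamma> 1 = \<eta> 1"
    and C: "\<gamma> ` {0..1} \<subseteq> C" "\<eta> ` {0..1} \<subseteq> C" "inj_on s C" and inj: "inj_on \<eta> {0..1}"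
  shows "reparam \<eta> \<gamma>"
proof -
  have inj_s: "u = v" if "u \<in> {0..1}" "v \<in> {0..1}" "s (\<eta> u) = s (\<eta> v)" for u v
    using that C(2,3) inj by (metis image_subset_iff inj_onD)
  have "\<exists>u\<in>{0..1}. s (\<eta> u) = s (\<gamma> t)" if t: "t \<in> {0..1}" for t
  proof -
    have "s (\<eta> 0) \<le> s (\<gamma> t)" "s (\<gamma> t) \<le> s (\<eta> 1)"
      using mono_onD[OF mono(1), of 0 t] mono_onD[OF mono(1), of t 1] t ends by auto
    then show ?thesis using IVT'[of "\<lambda>t. s (\<eta> t)" 0 "s (\<gamma> t)" 1] cont(2) by force
  qed
  then obtain \<phi> where \<phi>: "\<And>t. t \<in> {0..1} \<Longrightarrow> \<phi> t \<in> {0..1}" "\<And>t. t \<in> {0..1} \<Longrightarrow> s (\<eta> (\<phi> t)) = s (\<gamma> t)"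
    by metis
  have "mono_on {0..1} \<phi>"
  proof (rule mono_onI, rule ccontr)
    fix t t' :: real assume t: "t \<in> {0..1}" "t' \<in> {0..1}" "t \<le> t'" "\<not> \<phi> t \<le> \<phi> t'"
    then have "s (\<eta> (\<phi> t')) \<le> s (\<eta> (\<phi> t))" using mono_onD[OF mono(2), of "\<phi> t'" "\<phi> t"] \<phi>(1) by simp
    moreover have "s (\<gamma> t) \<le> s (\<gamma> t')" using mono_onD[OF mono(1) t(1-3)] .
    ultimately have "s (\<eta> (\<phi> t)) = s (\<eta> (\<phi> t'))"
      using \<phi>(2)[OF t(1)] \<phi>(2)[OF t(2)] by linarith
    then have "\<phi> t = \<phi> t'" by (rule inj_s[OF \<phi>(1)[OF t(1)] \<phi>(1)[OF t(2)]])
    then show False using t(4) by simp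
  qed
  moreover have "\<phi> ` {0..1} = {0..1}"
  proof (intro equalityI subsetI)
    fix u :: real assume u: "u \<in> {0..1}"
    have "s (\<gamma> 0) \<le> s (\<eta> u)" "s (\<eta> u) \<le> s (\<gamma> 1)"
      using mono_onD[OF mono(2), of 0 u] mono_onD[OF mono(2), of u 1] u ends by auto
    then obtain t where "t \<in> {0..1}" "s (\<gamma> t) = s (\<eta> u)"
      using IVT'[of "\<lambda>t. s (\<gamma> t)" 0 "s (\<eta> u)" 1] cont(1) by force
    then have "s (\<eta> (\<phi> t)) = s (\<eta> u)" using \<phi>(2) by simp
    then have "\<phi> t = u" by (rule inj_s[OF \<phi>(1)[OF \<open>t \<in> {0..1}\<close>] u])
    then show "u \<in> \<phi> ` {0..1}" using \<open>t \<in> {0..1}\<close> by blast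
  qed (use \<phi>(1) in auto)
  moreover have "\<gamma> t = \<eta> (\<phi> t)" if "t \<in> {0..1}" for t
    using C \<phi> that by (metis image_subset_iff inj_onD)
  ultimately show ?thesis unfolding reparam_def by blast
qed

text \<open>The graph of \<open>Y\<close> with the vertical ray above its right end. For
  nondecreasing \<open>Y\<close> this is a chain in the componentwise order, on which the sum of the
  coordinates is injective.\<close>

definition profile_chain :: "real \<Rightarrow> (real \<Rightarrow> real) \<Rightarrow> (real \<times> real) set" where
  "profile_chain a Y = {(\<xi>, \<eta>). \<xi> \<in> {0..a} \<and> (\<eta> = Y \<xi> \<or> \<xi> = a \<and> Y a \<le> \<eta>)}"

lemma inj_on_profile_chain:
  assumes "mono_on {0..a} Y"
  shows "inj_on (\<lambda>z. fst z + snd z) (profile_chain a Y)"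
proof (rule inj_onI, clarify)
  have lt: False if "(\<xi>, \<eta>) \<in> profile_chain a Y" "(\<xi>', \<eta>') \<in> profile_chain a Y" "\<xi> + \<eta> = \<xi>' + \<eta>'" "\<xi> < \<xi>'"
    for \<xi> \<eta> \<xi>' \<eta>'
  proof -
    have "\<eta> = Y \<xi>" "Y \<xi>' \<le> \<eta>'" "Y \<xi> \<le> Y \<xi>'"
      using that mono_onD[OF assms, of \<xi> \<xi>'] by (auto simp: profile_chain_def)
    then show False using that(3,4) by linarith
  qed
  fix \<xi> \<eta> \<xi>' \<eta>' assume *: "(\<xi>, \<eta>) \<in> profile_chain a Y" "(\<xi>', \<eta>') \<in> profile_chain a Y"
    "fst (\<xi>, \<eta>) + snd (\<xi>, \<eta>) = fst (\<xi>', \<eta>') + snd (\<xi>', \<eta>')"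
  then show "\<xi> = \<xi>' \<and> \<eta> = \<eta>'" using lt[of \<xi> \<eta> \<xi>' \<eta>'] lt[of \<xi>' \<eta>' \<xi> \<eta>] by fastforce
qed

section \<open>Curves along which the gap vanishes\<close>

context adm_curve
begin

lemma last_time_below:
  "\<exists>t0\<in>{0..1}. (\<forall>t\<in>{0<..<t0}. x t \<le> c) \<and> (\<forall>t\<in>{t0<..1}. c < x t)"
proof -
  \<comment> \<open>For \<open>c < 0\<close> no time qualifies; inserting 0 then gives
    \<open>t0 = 0\<close>.\<close>
  define B where "B = insert 0 {t \<in> {0..1}. x t \<le> c}"
  have B: "B \<subseteq> {0..1}" "B \<noteq> {}" "0 \<in> B" by (auto simp: B_def)
  then have bdd: "bdd_above B" by (meson bdd_above_Icc bdd_above_mono)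
  have "0 \<le> Sup B" using cSup_upper[OF B(3) bdd] .
  moreover have "Sup B \<le> 1" using cSup_least[OF B(2)] B(1) by force
  moreover have "x t \<le> c" if "t \<in> {0<..<Sup B}" for t
  proof -
    have "t < Sup B" using that by simp
    then obtain t' where "t' \<in> B" "t < t'" using less_cSup_iff[OF B(2) bdd] by blast
    then show ?thesis using x_mono[of t t'] that by (auto simp: B_def)
  qed
  moreover have "c < x t" if "t \<in> {Sup B<..1}" for t
    using cSup_upper[OF _ bdd, of t] that \<open>0 \<le> Sup B\<close> by (force simp: B_def)
  ultimately show ?thesis by (intro bexI[of _ "Sup B"]) auto
qed

lemma first_time_right:
  "\<exists>t1\<in>{0<..1}. (\<forall>t\<in>{0..<t1}. x t < a) \<and> (\<forall>t\<in>{t1..1}. x t = a)"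
proof -
  let ?B = "{t \<in> {0..1}. x t = a}"
  have "closed ?B" by (rule continuous_closed_preimage_constant[OF continuous_x closed_atLeastAtMost])
  moreover have "bounded ?B" by (rule bounded_subset[of "{0..1}"]) auto
  ultimately have "compact ?B" by (simp add: compact_eq_bounded_closed)
  then obtain t1 where t1: "t1 \<in> ?B" "\<And>t. t \<in> ?B \<Longrightarrow> t1 \<le> t"
    using compact_attains_inf[of ?B] ends(3) by force
  have "t1 \<noteq> 0" using t1(1) ends(1) a_pos by auto
  moreover have "x t < a" if "t \<in> {0..<t1}" for t
    using t1(1) t1(2)[of t] range_x[of t] that by (cases "x t = a") auto
  moreover have "x t = a" if "t \<in> {t1..1}" for t
    using x_mono[of t1 t] range_x[of t] that t1(1) by auto
  ultimately show ?thesis using t1(1) by (intro bexI[of _ t1]) auto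
qed

lemma ac_profile:
  assumes Y: "\<And>\<xi>. \<xi> \<in> {0..a} \<Longrightarrow> (Y has_real_derivative g \<xi>) (at \<xi>)" "continuous_on {0..a} g"
  shows "abs_cont_on 0 1 (\<lambda>t. Y (x t))"
    "t \<in> {0..1} - N \<Longrightarrow> ((\<lambda>t. Y (x t)) has_real_derivative g (x t) * p t) (at t)"
proof -
  show "abs_cont_on 0 1 (\<lambda>t. Y (x t))"
    by (rule abs_cont_on_C1_compose[OF ac_x _ _ Y(2)])
      (use range_x Y(1) in \<open>auto intro: has_field_derivative_at_within\<close>)
  assume t: "t \<in> {0..1} - N"
  then show "((\<lambda>t. Y (x t)) has_real_derivative g (x t) * p t) (at t)"
    using DERIV_chain2[OF Y(1)[OF range_x] velocity(1)[OF t]] by auto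
qed

text \<open>On the wall the curve is simple exactly through \<open>y\<close>, which is therefore
  injective and continuous, hence strictly monotone. It cannot decrease because it ends at the
  maximal height \<open>h\<close>.\<close>

lemma y_strict_mono_on_wall:
  assumes t1: "0 \<le> t1" "\<And>t. t \<in> {t1..1} \<Longrightarrow> x t = a" and uv: "t1 \<le> u" "u < v" "v \<le> 1"
  shows "y u < y v"
proof -
  have inj: "inj_on y {t1..1}"
  proof (rule inj_onI)
    fix s t assume st: "s \<in> {t1..1}" "t \<in> {t1..1}" "y s = y t"
    then have "\<gamma> s = \<gamma> t" using t1(2)[of s] t1(2)[of t] by (simp add: x_def y_def prod_eq_iff)
    then show "s = t" using inj st t1(1) by (auto dest: inj_onD)
  qed
  have ne: "y u \<noteq> y v" using inj_onD[OF inj, of u v] uv by auto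
  have top: "y u \<le> h" "y v \<le> h" using range_y[of u] range_y[of v] uv t1(1) by auto
  show ?thesis
  proof (cases "v = 1")
    case True
    then show ?thesis using ne top ends by simp
  next
    case False
    have "continuous_on {u..1} y"
      by (rule continuous_on_subset[OF continuous_y]) (use uv t1(1) in auto)
    moreover have "inj_on y {u..1}" by (rule inj_on_subset[OF inj]) (use uv in auto)
    ultimately have "(y u < y v \<and> y v < y 1) \<or> (y 1 < y v \<and> y v < y u)"
      using continuous_inj_imp_mono[of u v 1 y] uv False by auto
    then show ?thesis using top ends by auto
  qed
qed

text \<open>There are three regimes. While the costate is 0, the vanishing gap yields only
  \<open>q t \<le> 0\<close>, and \<open>y t \<ge> 0\<close> keeps the curve on the bottom. While
  the costate lies strictly between 0 and 1, the velocity has exactly the prescribed slope. On the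
  right wall, simplicity of the curve takes over. The assumption \<open>nd\<close> excludes costate
  1 before the wall, where vertical pieces would be free.\<close>

lemma minimizer_on_chain:
  assumes k: "0 < k" "k \<le> 1" and l: "0 \<le> l"
    and Y: "Y 0 = 0" "\<And>\<xi>. \<xi> \<in> {0..a} \<Longrightarrow> (Y has_real_derivative opt_slope a k l \<xi>) (at \<xi>)"
    and Ymono: "mono_on {0..a} Y"
    and M: "negligible {t \<in> {0..1}. gap k l t \<noteq> 0}"
    and nd: "\<And>\<xi>. \<xi> \<in> {0..<a} \<Longrightarrow> costate a k l \<xi> < 1"
  shows "\<gamma> ` {0..1} \<subseteq> profile_chain a Y" "mono_on {0..1} y"
proof -
  let ?M = "{t \<in> {0..1}. gap k l t \<noteq> 0}"
  let ?s = "\<lambda>t. opt_slope a k l (x t)"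
  have Yx: "abs_cont_on 0 1 (\<lambda>t. Y (x t))"
    "\<And>t. t \<in> {0..1} - N \<Longrightarrow> ((\<lambda>t. Y (x t)) has_real_derivative ?s t * p t) (at t)"
    using ac_profile[OF Y(2) continuous_on_opt_slope'] by blast+
  have gap0: "resistance_gap (?s t) (p t) (q t) = 0" if "t \<in> {0..1} - (N \<union> ?M)" for t
    using that by (auto simp: gap_def)
  \<comment> \<open>\<open>c\<close> is the abscissa at which the costate becomes positive; for
    \<open>l = 0\<close> it is positive everywhere, which is encoded by a value left of the
    rectangle.\<close>
  define c where "c = (if l = 0 then -1 else a - k / l)"
  have below: "costate a k l \<xi> = 0" if "\<xi> \<le> c" "0 \<le> \<xi>" for \<xi>
  proof -
    have "l > 0" "\<xi> \<le> a - k / l" using that l by (auto simp: c_def split: if_splits)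
    then have "k \<le> l * (a - \<xi>)" by (simp add: field_simps)
    then show ?thesis by (simp add: costate_def)
  qed
  have above: "0 < costate a k l \<xi>" if "c < \<xi>" for \<xi>
  proof -
    have "l * (a - \<xi>) < k"
    proof (cases "l = 0")
      case False
      then have "l > 0" "a - k / l < \<xi>" using that l by (auto simp: c_def)
      then show ?thesis by (simp add: field_simps)
    qed (use k in simp)
    then show ?thesis by (simp add: costate_def)
  qed
  obtain t0 where t0: "t0 \<in> {0..1}" "\<And>t. t \<in> {0<..<t0} \<Longrightarrow> x t \<le> c" "\<And>t. t \<in> {t0<..1} \<Longrightarrow> c < x t"
    using last_time_below[of c] by blast
  obtain t1 where t1: "t1 \<in> {0<..1}" "\<And>t. t \<in> {0..<t1} \<Longrightarrow> x t < a" "\<And>t. t \<in> {t1..1} \<Longrightarrow> x t = a"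
    using first_time_right by blast
  have "\<not> a \<le> c" using below[of a] a_pos k by (auto simp: costate_def)
  then have t01: "t0 \<le> t1" using t0(2)[of t1] t1(1) t1(3)[of t1] by force
  have s0: "?s t = 0" if "t \<in> {0<..<t0}" for t
    using below[OF t0(2)[OF that]] range_x[of t] that t0(1) by (simp add: opt_slope_def)
  have y0: "y t = 0" and Y0: "Y (x t) = 0" if t: "t \<in> {0..t0}" for t
  proof -
    have "- y 0 \<le> - y t"
    proof (rule ftc_mono[of 0 t "\<lambda>t. - y t" "\<lambda>t. - q t" ?M, OF _ _ _ _ _ M])
      show "abs_cont_on 0 1 (\<lambda>t. - y t)" by (rule abs_cont_on_minus[OF ac_y])
      show "((\<lambda>t. - y t) has_real_derivative - q \<tau>) (at \<tau>)" if "\<tau> \<in> {0..t} - N" for \<tau>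
        using velocity(2)[of \<tau>] that t t0(1) by (auto intro!: derivative_eq_intros)
      fix \<tau> assume \<tau>: "\<tau> \<in> {0<..<t} - (N \<union> ?M)"
      then have "\<tau> \<in> {0..1} - (N \<union> ?M)" using t t0(1) by auto
      moreover have "?s \<tau> = 0" using \<tau> t by (intro s0) auto
      ultimately show "0 \<le> - q \<tau>"
        using resistance_gap_zero_imp(1)[of "?s \<tau>" "p \<tau>" "q \<tau>"] velocity(3,4)[of \<tau>] gap0[of \<tau>] by auto
    qed (use t t0(1) in auto)
    then show "y t = 0" using range_y[of t] ends t t0(1) by auto
    have der: "((\<lambda>t. Y (x t)) has_real_derivative ?s \<tau> * p \<tau>) (at \<tau>)" if "\<tau> \<in> {0..t} - N" for \<tau>
      using Yx(2)[of \<tau>] that t t0(1) by auto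
    have zero: "?s \<tau> * p \<tau> = 0" if "\<tau> \<in> {0<..<t} - (N \<union> {})" for \<tau>
      using s0[of \<tau>] that t by auto
    have "Y (x 0) \<le> Y (x t)"
    proof (rule ftc_mono[OF _ _ _ Yx(1) der negligible_empty])
      show "0 \<le> ?s \<tau> * p \<tau>" if "\<tau> \<in> {0<..<t} - (N \<union> {})" for \<tau> by (simp only: zero[OF that] minus_zero order_refl)
    qed (use t t0(1) in auto)
    moreover have "- Y (x 0) \<le> - Y (x t)"
    proof (rule ftc_mono[of 0 t "\<lambda>t. - Y (x t)" "\<lambda>t. - (?s t * p t)" "{}", OF _ _ _ _ _ negligible_empty])
      show "abs_cont_on 0 1 (\<lambda>t. - Y (x t))" by (rule abs_cont_on_minus[OF Yx(1)])
      show "((\<lambda>t. - Y (x t)) has_real_derivative - (?s \<tau> * p \<tau>)) (at \<tau>)" if "\<tau> \<in> {0..t} - N" for \<tau>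
        by (rule DERIV_minus[OF der[OF that]])
      show "0 \<le> - (?s \<tau> * p \<tau>)" if "\<tau> \<in> {0<..<t} - (N \<union> {})" for \<tau> by (simp only: zero[OF that] minus_zero order_refl)
    qed (use t t0(1) in auto)
    ultimately show "Y (x t) = 0" using Y(1) ends by simp
  qed
  have yY: "y t = Y (x t)" if t: "t \<in> {t0..t1}" for t
  proof -
    have ac: "abs_cont_on 0 1 (\<lambda>t. y t - Y (x t))" "abs_cont_on 0 1 (\<lambda>t. Y (x t) - y t)"
      by (rule abs_cont_on_diff[OF ac_y Yx(1)]) (rule abs_cont_on_diff[OF Yx(1) ac_y])
    have der: "((\<lambda>t. y t - Y (x t)) has_real_derivative q \<tau> - ?s \<tau> * p \<tau>) (at \<tau>)"
      "((\<lambda>t. Y (x t) - y t) has_real_derivative ?s \<tau> * p \<tau> - q \<tau>) (at \<tau>)" if "\<tau> \<in> {t0..t} - N" for \<tau>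
      using Yx(2)[of \<tau>] velocity(2)[of \<tau>] that t t0(1) t1(1) by (auto intro!: DERIV_diff)
    have zero: "q \<tau> = ?s \<tau> * p \<tau>" if \<tau>: "\<tau> \<in> {t0<..<t} - (N \<union> ?M)" for \<tau>
    proof -
      have \<tau>1: "\<tau> \<in> {0..1} - (N \<union> ?M)" using \<tau> t t0(1) t1(1) by auto
      have "0 < costate a k l (x \<tau>)" using \<tau> \<tau>1 by (intro above t0(3)) auto
      moreover have "costate a k l (x \<tau>) < 1"
        using t1(2)[of \<tau>] range_x[of \<tau>] \<tau> t \<tau>1 by (intro nd) auto
      ultimately have "0 < ?s \<tau>" "?s \<tau> < 1"
        unfolding opt_slope_def by (auto intro: slope_of_pos slope_of_less_1)
      then show ?thesis
        using resistance_gap_zero_imp(2)[of "?s \<tau>" "p \<tau>" "q \<tau>"] velocity(3,4)[of \<tau>] gap0[OF \<tau>1] \<tau>1 by auto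
    qed
    have "y t0 - Y (x t0) \<le> y t - Y (x t)"
      by (rule ftc_mono[OF _ _ _ ac(1) der(1) M]) (use zero t t0(1) t1(1) in auto)
    moreover have "Y (x t0) - y t0 \<le> Y (x t) - y t"
      by (rule ftc_mono[OF _ _ _ ac(2) der(2) M]) (use zero t t0(1) t1(1) in auto)
    ultimately show ?thesis using y0[of t0] Y0[of t0] t0(1) by simp
  qed
  have graph: "y t = Y (x t)" if "t \<in> {0..t1}" for t
    using yY[of t] y0[of t] Y0[of t] that by (cases "t \<le> t0") auto
  have wall: "y u \<le> y v" if "t1 \<le> u" "u \<le> v" "v \<le> 1" for u v
    using y_strict_mono_on_wall[of t1 u v] t1 that by (cases "u = v") auto
  have rise: "y u \<le> y v" if "0 \<le> u" "u \<le> v" "v \<le> t1" for u v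
    using graph[of u] graph[of v] mono_onD[OF Ymono, of "x u" "x v"] x_mono[of u v] range_x[of u] range_x[of v]
      that t1(1) by auto
  show "mono_on {0..1} y"
  proof (rule mono_onI)
    fix u v :: real assume "u \<in> {0..1}" "v \<in> {0..1}" "u \<le> v"
    then show "y u \<le> y v"
      using wall[of u v] rise[of u v] rise[of u t1] wall[of t1 v] t1(1)
      by (cases "v \<le> t1"; cases "u \<le> t1") auto
  qed
  show "\<gamma> ` {0..1} \<subseteq> profile_chain a Y"
  proof
    fix z assume "z \<in> \<gamma> ` {0..1}"
    then obtain t where t: "t \<in> {0..1}" "z = (x t, y t)" by (auto simp: x_def y_def)
    show "z \<in> profile_chain a Y"
    proof (cases "t \<le> t1")
      case True
      then show ?thesis using graph[of t] range_x[OF t(1)] t by (auto simp: profile_chain_def)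
    next
      case False
      then have "x t = a" "y t1 \<le> y t" using t1(3)[of t] wall[of t1 t] t by auto
      then show ?thesis using graph[of t1] t1(1) t1(3)[of t1] t a_pos by (auto simp: profile_chain_def)
    qed
  qed
qed

text \<open>With costate identically \<open>1\<close> the gap only gives slope at least \<open>1\<close>; that the curve follows the
  diagonal up to the wall is then forced by the area constraint.\<close>

lemma minimizer_on_diagonal:
  assumes L: "2 * L = a\<^sup>2" and M: "negligible {t \<in> {0..1}. gap 1 0 t \<noteq> 0}"
  shows "\<gamma> ` {0..1} \<subseteq> profile_chain a (\<lambda>\<xi>. \<xi>)" "mono_on {0..1} y"
proof -
  let ?M = "{t \<in> {0..1}. gap 1 0 t \<noteq> 0}"
  have pq: "p t \<le> q t" if "t \<in> {0..1} - (N \<union> ?M)" for t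
    using resistance_gap_zero_imp(3)[of 1 "p t" "q t"] velocity(3,4)[of t] that
    by (auto simp: gap_def opt_slope_def costate_def)
  have ac: "abs_cont_on 0 1 (\<lambda>t. y t - x t)"
    by (rule abs_cont_on_diff[OF ac_y ac_x])
  have inc: "y u - x u \<le> y v - x v" if "0 \<le> u" "u \<le> v" "v \<le> 1" for u v
    by (rule ftc_mono[OF that ac, of "\<lambda>t. q t - p t", OF _ M])
      (use velocity pq that in \<open>auto intro!: DERIV_diff\<close>)
  then show ymono: "mono_on {0..1} y"
    using x_mono by (intro mono_onI) (smt (verit) atLeastAtMost_iff)
  have pos: "0 \<le> y t - x t" if "t \<in> {0..1}" for t using inc[of 0 t] that ends by simp
  have "((\<lambda>t. x t * p t) has_integral x 1 * x 1 / 2 - x 0 * x 0 / 2) {0..1}"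
  proof (rule ftc(1))
    show "abs_cont_on 0 1 (\<lambda>t. x t * x t / 2)"
      by (rule abs_cont_on_dominated[OF abs_cont_on_mult[OF ac_x ac_x], of _ 1])
        (simp add: dist_real_def abs_divide diff_divide_distrib[symmetric])
  qed (auto intro!: derivative_eq_intros velocity simp: field_simps)
  then have xp: "integral {0..1} (\<lambda>t. x t * p t) = a\<^sup>2 / 2"
    by (simp add: ends integral_unique power2_eq_square)
  have xpi: "(\<lambda>t. x t * p t) absolutely_integrable_on {0..1}"
    by (intro continuous_times_absolutely_integrable continuous_x integrable_p)
  have int: "(\<lambda>t. (y t - x t) * p t) absolutely_integrable_on {0..1}"
    by (intro continuous_times_absolutely_integrable continuous_intros continuous_x continuous_y integrable_p)
  \<comment> \<open>The area under the curve exceeds that under the diagonal by the integral of the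
    nonnegative function \<open>(y t - x t) * p t\<close>, so this function vanishes almost
    everywhere.\<close>
  have "integral {0..1} (\<lambda>t. y t * p t - x t * p t) = L - a\<^sup>2 / 2"
    using integral_diff[OF set_lebesgue_integral_eq_integral(1)[OF integrable_yp]
        set_lebesgue_integral_eq_integral(1)[OF xpi]] xp integral_yp by simp
  then have "integral {0..1} (\<lambda>t. (y t - x t) * p t) = 0" using L by (simp add: left_diff_distrib)
  then have Z: "negligible {t \<in> {0..1}. (y t - x t) * p t \<noteq> 0}"
    by (intro nonneg_integral_zero_imp_negligible[OF int _ negligible_N]) (use pos velocity(3) in auto)
  obtain t1 where t1: "t1 \<in> {0<..1}" "\<And>t. t \<in> {0..<t1} \<Longrightarrow> x t < a" "\<And>t. t \<in> {t1..1} \<Longrightarrow> x t = a"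
    using first_time_right by blast
  have diag: "y t = x t" if t: "t \<in> {0..<t1}" for t
  proof (rule ccontr)
    assume "y t \<noteq> x t"
    then have "0 < y t - x t" using pos[of t] t t1(1) by auto
    \<comment> \<open>The excess \<open>y t - x t\<close> never decreases. Once it is positive,
      \<open>p\<close> vanishes almost everywhere afterwards and \<open>x\<close> can no longer
      reach \<open>a\<close>.\<close>
    then have gt: "0 < y \<tau> - x \<tau>" if "\<tau> \<in> {t..1}" for \<tau> using inc[of t \<tau>] t that by auto
    have "- x t \<le> - x 1"
    proof (rule ftc_mono[of t 1 "\<lambda>t. - x t" "\<lambda>t. - p t", OF _ _ _ _ _ Z])
      show "abs_cont_on 0 1 (\<lambda>t. - x t)" by (rule abs_cont_on_minus[OF ac_x])
      show "((\<lambda>t. - x t) has_real_derivative - p \<tau>) (at \<tau>)" if "\<tau> \<in> {t..1} - N" for \<tau>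
        using velocity(1)[of \<tau>] that t by (auto intro!: derivative_eq_intros)
      show "0 \<le> - p \<tau>" if "\<tau> \<in> {t<..<1} - (N \<union> {t \<in> {0..1}. (y t - x t) * p t \<noteq> 0})" for \<tau>
        using gt[of \<tau>] that t by auto
    qed (use t t1(1) in auto)
    then show False using t1(2)[OF t] ends by simp
  qed
  show "\<gamma> ` {0..1} \<subseteq> profile_chain a (\<lambda>\<xi>. \<xi>)"
  proof
    fix z assume "z \<in> \<gamma> ` {0..1}"
    then obtain t where t: "t \<in> {0..1}" "z = (x t, y t)" by (auto simp: x_def y_def)
    show "z \<in> profile_chain a (\<lambda>\<xi>. \<xi>)"
      using diag[of t] t1(3)[of t] pos[OF t(1)] range_x[OF t(1)] t by (cases "t < t1") (auto simp: profile_chain_def)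
  qed
qed

end

section \<open>Existence of the multipliers\<close>

lemma opt_slope_antimono:
  assumes "l \<le> l'" "\<xi> \<le> a"
  shows "opt_slope a k l' \<xi> \<le> opt_slope a k l \<xi>"
proof -
  have "l * (a - \<xi>) \<le> l' * (a - \<xi>)" using assms by (intro mult_right_mono) auto
  then have "costate a k l' \<xi> \<le> costate a k l \<xi>" by (simp add: costate_def)
  then show ?thesis unfolding opt_slope_def by (intro slope_of_mono costate_01)
qed

text \<open>The area under the graph with this slope and value 0 at 0, integrated by parts: the
  slope at \<open>\<xi>\<close> lifts everything over the remaining width \<open>a - \<xi>\<close>.
  A vertical segment on the right wall adds nothing to it.\<close>

definition area_of :: "real \<Rightarrow> real \<Rightarrow> real \<Rightarrow> real" where
  "area_of a k l = integral {0..a} (\<lambda>\<xi>. (a - \<xi>) * opt_slope a k l \<xi>)"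

definition height_of :: "real \<Rightarrow> real \<Rightarrow> real \<Rightarrow> real" where
  "height_of a k l = integral {0..a} (opt_slope a k l)"

lemma continuous_on_area_of: "continuous_on UNIV (\<lambda>(k, l). area_of a k l)"
  and continuous_on_height_of: "continuous_on UNIV (\<lambda>(k, l). height_of a k l)"
proof -
  have c: "continuous_on (UNIV \<times> cbox 0 a) (\<lambda>z :: (real \<times> real) \<times> real. opt_slope a (fst (fst z)) (snd (fst z)) (snd z))"
  proof -
    have "continuous_on (UNIV \<times> cbox 0 a)
        (\<lambda>z :: (real \<times> real) \<times> real. (\<lambda>(k, l, \<xi>). opt_slope a k l \<xi>) (fst (fst z), snd (fst z), snd z))"
      by (rule continuous_on_compose2[OF continuous_on_opt_slope]) (auto intro!: continuous_intros)
    then show ?thesis by simp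
  qed
  have "continuous_on UNIV (\<lambda>z. integral (cbox 0 a) (\<lambda>\<xi>. (a - \<xi>) * opt_slope a (fst z) (snd z) \<xi>))"
    by (rule integral_continuous_on_param) (unfold case_prod_unfold, intro continuous_intros c)
  then show "continuous_on UNIV (\<lambda>(k, l). area_of a k l)"
    by (simp add: area_of_def case_prod_unfold)
  have "continuous_on UNIV (\<lambda>z. integral (cbox 0 a) (\<lambda>\<xi>. opt_slope a (fst z) (snd z) \<xi>))"
    by (rule integral_continuous_on_param) (unfold case_prod_unfold, intro c)
  then show "continuous_on UNIV (\<lambda>(k, l). height_of a k l)"
    by (simp add: height_of_def case_prod_unfold)
qed

lemma opt_slope_l0: "0 \<le> k \<Longrightarrow> k \<le> 1 \<Longrightarrow> opt_slope a k 0 \<xi> = slope_of k"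
  by (simp add: opt_slope_def costate_def)

lemma area_of_l0:
  assumes "0 < a" "0 \<le> k" "k \<le> 1"
  shows "area_of a k 0 = slope_of k * a\<^sup>2 / 2" "height_of a k 0 = slope_of k * a"
proof -
  have "((\<lambda>\<xi>. (a - \<xi>) * slope_of k) has_integral (a * a - a\<^sup>2 / 2) * slope_of k - (a * 0 - 0\<^sup>2 / 2) * slope_of k) {0..a}"
    using assms by (intro fundamental_theorem_of_calculus)
      (auto simp: has_real_derivative_iff_has_vector_derivative[symmetric] intro!: derivative_eq_intros)
  note int = integral_unique[OF this]
  show "area_of a k 0 = slope_of k * a\<^sup>2 / 2"
    unfolding area_of_def opt_slope_l0[OF assms(2,3)] int by (simp add: power2_eq_square)
  have "opt_slope a k 0 = (\<lambda>_. slope_of k)" by (rule ext) (rule opt_slope_l0[OF assms(2,3)])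
  then show "height_of a k 0 = slope_of k * a" using assms by (simp add: height_of_def)
qed

lemma continuous_area_integrand: "continuous_on S (\<lambda>\<xi>. (a - \<xi>) * opt_slope a k l \<xi>)"
  by (intro continuous_intros continuous_on_opt_slope')

text \<open>At distance more than \<open>1 / l\<close> from the wall the costate is cut off to 0,
  and nearer to it the slope is at most 1. Large \<open>l\<close> thus makes the area small, as the
  intermediate value argument for \<open>l\<close> requires.\<close>

lemma area_of_bound:
  assumes "0 < a" "k \<le> 1" "0 < l"
  shows "area_of a k l \<le> a / l"
proof -
  have "area_of a k l \<le> integral {0..a} (\<lambda>\<xi>. 1 / l)"
    unfolding area_of_def
  proof (rule integral_le)
    show "(\<lambda>\<xi>. (a - \<xi>) * opt_slope a k l \<xi>) integrable_on {0..a}"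
      by (rule integrable_continuous_real[OF continuous_area_integrand])
    fix \<xi> assume \<xi>: "\<xi> \<in> {0..a}"
    show "(a - \<xi>) * opt_slope a k l \<xi> \<le> 1 / l"
    proof (cases "l * (a - \<xi>) \<le> 1")
      case True
      have "(a - \<xi>) * opt_slope a k l \<xi> \<le> (a - \<xi>) * 1"
        using \<xi> opt_slope_01 by (intro mult_left_mono) auto
      also have "\<dots> \<le> 1 / l" using True assms(3) by (simp add: field_simps)
      finally show ?thesis .
    next
      case False
      then show ?thesis using assms by (simp add: opt_slope_def costate_def)
    qed
  qed auto
  then show ?thesis using assms by simp
qed

text \<open>Slopes decrease with \<open>l\<close>, so for equal areas a continuous nonnegative
  difference has integral 0 and the slopes agree everywhere. Close to the wall the costate is not
  cut off and reveals \<open>l\<close>.\<close>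

lemma area_of_inj:
  assumes a: "0 < a" and k: "0 < k" "k \<le> 1" and l: "0 \<le> l" "l \<le> l'" and eq: "area_of a k l = area_of a k l'"
  shows "l = l'"
proof -
  let ?d = "\<lambda>\<xi>. (a - \<xi>) * opt_slope a k l \<xi> - (a - \<xi>) * opt_slope a k l' \<xi>"
  have "integral {0..a} ?d = area_of a k l - area_of a k l'"
    unfolding area_of_def by (intro integral_diff integrable_continuous_real continuous_area_integrand)
  then have "integral {0..a} ?d = 0" using eq by simp
  moreover have "0 \<le> ?d \<xi>" if "\<xi> \<in> {0..a}" for \<xi>
    using opt_slope_antimono[OF l(2), of \<xi> a k] that by (simp add: mult_left_mono)
  moreover have "continuous_on {0..a} ?d" by (intro continuous_on_diff continuous_area_integrand)
  ultimately have z: "?d \<xi> = 0" if "\<xi> \<in> {0..a}" for \<xi>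
    using integral_eq_0_iff[of 0 a ?d] a that by blast
  \<comment> \<open>A distance from the wall small enough that \<open>l' * e < k\<close>, so that
    both costates are still positive.\<close>
  define e where "e = min (a / 2) (k / (2 * (l' + 1)))"
  have e: "0 < e" "e \<le> a" "l' * e < k"
  proof -
    show "0 < e" "e \<le> a" using a k l by (auto simp: e_def)
    have "l' * e \<le> l' * (k / (2 * (l' + 1)))" using l by (intro mult_left_mono) (auto simp: e_def)
    also have "\<dots> < k" using k l by (simp add: field_simps) (smt (verit) mult_nonneg_nonneg mult_pos_pos)
    finally show "l' * e < k" .
  qed
  have "opt_slope a k l (a - e) = opt_slope a k l' (a - e)" using z[of "a - e"] e by (simp add: left_diff_distrib)
  then have "costate a k l (a - e) = costate a k l' (a - e)"
    by (metis slope_cost_opt_slope)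
  moreover have "l * e \<le> l' * e" using l e by (intro mult_right_mono) auto
  moreover have "0 \<le> l * e" using l e by simp
  ultimately have "l * e = l' * e" using e(3) k by (simp add: costate_def min_absorb2)
  then show ?thesis using e by simp
qed

text \<open>The parameters realizing the prescribed area form the graph of a function \<open>k \<mapsto> l\<close>, which is
  continuous because its graph is closed; the height is then adjusted along this graph.\<close>

lemma multiplier_exists:
  assumes a: "0 < a" and h: "0 < h" and L: "0 < L" "2 * L \<le> a\<^sup>2" "2 * L \<le> a * h"
  shows "\<exists>k l. 0 < k \<and> k \<le> 1 \<and> 0 \<le> l \<and> area_of a k l = L \<and> height_of a k l \<le> h
      \<and> (k = 1 \<or> height_of a k l = h)"
proof -
  \<comment> \<open>\<open>s0\<close> is the constant slope whose graph encloses area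
    \<open>L\<close>; the bound \<open>2 * L \<le> a\<^sup>2\<close> says \<open>s0 \<le> 1\<close>.
    The corresponding \<open>k0\<close>, taken with \<open>l = 0\<close>, starts the family: for
    \<open>k \<ge> k0\<close> some \<open>l \<ge> 0\<close> restores the area.\<close>
  define s0 where "s0 = 2 * L / a\<^sup>2"
  have s0: "0 < s0" "s0 \<le> 1" using a L by (auto simp: s0_def)
  obtain k0 where k0: "k0 \<in> {0..1}" "slope_of k0 = s0"
    using IVT'[of slope_of 0 s0 1] s0 continuous_on_slope_of by auto
  then have k0p: "0 < k0" using s0 by (cases "k0 = 0") auto
  \<comment> \<open>By \<open>area_of_bound\<close> the area at \<open>lm\<close> is at most
    \<open>L / 2\<close>.\<close>
  define lm where "lm = 2 * a / L"
  have lm: "lm > 0" using a L by (simp add: lm_def)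
  have ex: "\<exists>l\<in>{0..lm}. area_of a k l = L" if k: "k \<in> {k0..1}" for k
  proof -
    have "s0 \<le> slope_of k" using slope_of_mono[of k0 k] k k0 by auto
    then have "s0 * a\<^sup>2 \<le> slope_of k * a\<^sup>2" by (intro mult_right_mono) auto
    then have "L \<le> area_of a k 0" using area_of_l0[OF a, of k] k k0 a by (simp add: s0_def)
    moreover have "area_of a k lm \<le> L" using area_of_bound[OF a _ lm, of k] k a L by (simp add: lm_def)
    moreover have "continuous_on {0..lm} (\<lambda>l. area_of a k l)"
    proof -
      have "continuous_on {0..lm} (\<lambda>l. (\<lambda>(k, l). area_of a k l) (k, l))"
        by (rule continuous_on_compose2[OF continuous_on_area_of]) (auto intro!: continuous_intros)
      then show ?thesis by simp
    qed
    ultimately show ?thesis using IVT2'[of "area_of a k" lm L 0] lm by force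
  qed
  then obtain f where f: "\<And>k. k \<in> {k0..1} \<Longrightarrow> f k \<in> {0..lm}" "\<And>k. k \<in> {k0..1} \<Longrightarrow> area_of a k (f k) = L"
    by metis
  have uniq: "f k = l" if "k \<in> {k0..1}" "l \<in> {0..lm}" "area_of a k l = L" for k l
    using area_of_inj[OF a, of k "f k" l] area_of_inj[OF a, of k l "f k"] f[OF that(1)] that k0p
    by (cases "f k \<le> l") auto
  have contf: "continuous_on {k0..1} f"
  proof -
    have "(\<lambda>k. (k, f k)) ` {k0..1} = {z \<in> {k0..1} \<times> {0..lm}. (\<lambda>(k, l). area_of a k l) z = L}"
      using f uniq by (auto simp: image_iff)
    moreover have "closed {z \<in> {k0..1} \<times> {0..lm}. (\<lambda>(k, l). area_of a k l) z = L}"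
      by (rule continuous_closed_preimage_constant)
        (auto intro: continuous_on_subset[OF continuous_on_area_of] closed_Times)
    ultimately have "closed ((\<lambda>k. (k, f k)) ` {k0..1})" by simp
    then have "closedin (top_of_set ({k0..1} \<times> {0..lm})) ((\<lambda>k. (k, f k)) ` {k0..1})"
      using f by (intro closed_subset) auto
    then show ?thesis
      using continuous_closed_graph_eq[of "{0..lm}" f "{k0..1}"] f by (simp add: Pi_iff)
  qed
  have k01: "k0 \<in> {k0..1}" "1 \<in> {k0..1}" using k0 by auto
  have "f k0 = 0"
    \<comment> \<open>At \<open>k0\<close> the graph is a straight line of height
      \<open>2 * L / a\<close>, which is at most \<open>h\<close> because
      \<open>2 * L \<le> a * h\<close>.\<close>
    using area_of_l0[OF a, of k0] k0 a lm by (intro uniq k01) (auto simp: s0_def)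
  then have "height_of a k0 (f k0) = 2 * L / a"
    using area_of_l0(2)[OF a, of k0] k0 a by (simp add: s0_def power2_eq_square)
  then have H0: "height_of a k0 (f k0) \<le> h" using a L(3) by (simp add: divide_le_eq mult.commute)
  show ?thesis
  \<comment> \<open>If even \<open>k = 1\<close> reaches at most height \<open>h\<close>, the
    remainder is climbed on the wall without loss; otherwise an intermediate \<open>k\<close> meets
    the height exactly.\<close>
  proof (cases "height_of a 1 (f 1) \<le> h")
    case True
    then show ?thesis using f[OF k01(2)] by (intro exI[of _ 1] exI[of _ "f 1"]) auto
  next
    case False
    have "continuous_on {k0..1} (\<lambda>k. (\<lambda>(k, l). height_of a k l) (k, f k))"
      by (rule continuous_on_compose2[OF continuous_on_height_of]) (auto intro!: continuous_intros contf)
    then obtain k where k: "k \<in> {k0..1}" "height_of a k (f k) = h"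
      using IVT'[of "\<lambda>k. height_of a k (f k)" k0 h 1] H0 False k0 by force
    then show ?thesis using f[OF k(1)] k0p by (intro exI[of _ k] exI[of _ "f k"]) auto
  qed
qed

section \<open>The minimizer enclosing a small area\<close>

lemma solutions_iff:
  "\<gamma> \<in> solutions a h L \<longleftrightarrow>
    \<gamma> \<in> admissible a h L \<and> (\<forall>\<eta>\<in>admissible a h L. functional_F \<gamma> \<le> functional_F \<eta>)"
  by (auto simp: solutions_def is_arg_min_def not_less)

lemma vel_eq:
  assumes "((\<lambda>t. fst (\<gamma> t)) has_real_derivative p) (at t)" "((\<lambda>t. snd (\<gamma> t)) has_real_derivative q) (at t)"
  shows "vel \<gamma> t = (p, q)"
  using has_vector_derivative_Pair[of "\<lambda>t. fst (\<gamma> t)" p t UNIV "\<lambda>t. snd (\<gamma> t)" q] assms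
  by (simp add: has_real_derivative_iff_has_vector_derivative vector_derivative_at)

text \<open>For explicit curves with monotone coordinates, the coordinate sum controls everything:
  its strict growth gives simplicity, its Lipschitz bound gives absolute continuity. The function
  \<open>\<Phi>\<close> evaluates the area constraint as an antiderivative.\<close>

lemma admissible_monotoneI:
  fixes \<gamma> :: curve
  assumes mono: "\<And>s t. 0 \<le> s \<Longrightarrow> s \<le> t \<Longrightarrow> t \<le> 1 \<Longrightarrow> fst (\<gamma> s) \<le> fst (\<gamma> t) \<and> snd (\<gamma> s) \<le> snd (\<gamma> t)"
    and strict: "\<And>s t. 0 \<le> s \<Longrightarrow> s < t \<Longrightarrow> t \<le> 1 \<Longrightarrow> fst (\<gamma> s) + snd (\<gamma> s) < fst (\<gamma> t) + snd (\<gamma> t)"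
    and lip: "\<And>s t. 0 \<le> s \<Longrightarrow> s \<le> t \<Longrightarrow> t \<le> 1 \<Longrightarrow>
        fst (\<gamma> t) + snd (\<gamma> t) - (fst (\<gamma> s) + snd (\<gamma> s)) \<le> C * (t - s)"
    and ends: "\<gamma> 0 = (0, 0)" "\<gamma> 1 = (a, h)"
    and M: "negligible M"
    and vel: "\<And>t. t \<in> {0<..<1} - M \<Longrightarrow> ((\<lambda>t. fst (\<gamma> t)) has_real_derivative p t) (at t)"
      "\<And>t. t \<in> {0<..<1} - M \<Longrightarrow> ((\<lambda>t. snd (\<gamma> t)) has_real_derivative q t) (at t)"
      "\<And>t. t \<in> {0<..<1} - M \<Longrightarrow> 0 \<le> p t \<and> (p t \<noteq> 0 \<or> q t \<noteq> 0)"
    and \<Phi>: "abs_cont_on 0 1 \<Phi>"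
      "\<And>t. t \<in> {0<..<1} - M \<Longrightarrow> (\<Phi> has_real_derivative fst (\<gamma> t) * q t) (at t)"
      "\<Phi> 1 - \<Phi> 0 = a * h - L"
  shows "\<gamma> \<in> admissible a h L"
proof -
  have v: "vel \<gamma> t = (p t, q t)" if "t \<in> {0<..<1} - M" for t
    by (rule vel_eq[OF vel(1)[OF that] vel(2)[OF that]])
  have "abs_cont_on 0 1 \<gamma>"
  proof (rule abs_cont_on_lipschitz[of _ _ _ C])
    fix s t :: real assume st: "0 \<le> s" "s \<le> t" "t \<le> 1"
    have "dist (\<gamma> s) (\<gamma> t) \<le> dist (fst (\<gamma> s)) (fst (\<gamma> t)) + dist (snd (\<gamma> s)) (snd (\<gamma> t))"
      unfolding dist_prod_def by (rule sqrt_sum_squares_le_sum) auto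
    also have "\<dots> = fst (\<gamma> t) + snd (\<gamma> t) - (fst (\<gamma> s) + snd (\<gamma> s))"
      using mono[OF st] by (simp add: dist_real_def)
    also have "\<dots> \<le> C * (t - s)" by (rule lip[OF st])
    finally show "dist (\<gamma> s) (\<gamma> t) \<le> C * (t - s)" .
  qed
  moreover have "\<gamma> ` {0..1} \<subseteq> {0..a} \<times> {0..h}"
  proof (rule image_subsetI)
    fix t :: real assume "t \<in> {0..1}"
    then show "\<gamma> t \<in> {0..a} \<times> {0..h}"
      using mono[of 0 t] mono[of t 1] ends by (simp add: mem_Times_iff)
  qed
  moreover have "inj_on \<gamma> {0..1}"
  proof (rule inj_onI)
    fix s t :: real assume "s \<in> {0..1}" "t \<in> {0..1}" "\<gamma> s = \<gamma> t"
    then show "s = t" using strict[of s t] strict[of t s] by (cases s t rule: linorder_cases) auto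
  qed
  moreover have "AE t\<in>{0<..<1} in lebesgue. norm (vel \<gamma> t) \<noteq> 0" "AE t\<in>{0<..<1} in lebesgue. fst (vel \<gamma> t) \<ge> 0"
    by (rule negligible_imp_AE[OF M], use v vel(3) in \<open>force simp: prod_eq_iff\<close>)+
  moreover have "(LINT t:{0..1}|lebesgue. fst (\<gamma> t) * snd (vel \<gamma> t)) = a * h - L"
  proof -
    have M': "negligible ({0, 1} \<union> M)" using M by simp
    have d: "(\<Phi> has_vector_derivative fst (\<gamma> t) * snd (vel \<gamma> t)) (at t within {0..1})"
      if "t \<in> {0..1} - ({0, 1} \<union> M)" for t
      using \<Phi>(2)[of t] v[of t] that
      by (auto simp: has_real_derivative_iff_has_vector_derivative intro: has_vector_derivative_at_within)
    show ?thesis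
      using set_lebesgue_integral_eq_integral(2)[OF abs_cont_on_absolutely_integrable[OF \<Phi>(1) _ M' d]]
        integral_unique[OF abs_cont_on_has_integral[OF \<Phi>(1) _ M' d]] \<Phi>(3) by simp
  qed
  ultimately show ?thesis using ends unfolding admissible_def by simp
qed

lemma antiderivative_has_integral:
  fixes Y :: "real \<Rightarrow> real"
  assumes "0 < a" "\<And>\<xi>. \<xi> \<in> {0..a} \<Longrightarrow> (Y has_real_derivative g \<xi>) (at \<xi>)"
  shows "integral {0..a} g = Y a - Y 0"
  by (rule integral_unique[OF fundamental_theorem_of_calculus])
    (use assms in \<open>auto simp: has_real_derivative_iff_has_vector_derivative[symmetric] intro: has_field_derivative_at_within\<close>)

lemma deriv_nonneg_mono_on:
  fixes Y :: "real \<Rightarrow> real"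
  assumes "\<And>\<xi>. \<xi> \<in> {0..a} \<Longrightarrow> (Y has_real_derivative g \<xi>) (at \<xi>)" "\<And>\<xi>. \<xi> \<in> {0..a} \<Longrightarrow> 0 \<le> g \<xi>"
  shows "mono_on {0..a} Y"
proof (rule mono_onI)
  fix r s assume "r \<in> {0..a}" "s \<in> {0..a}" "r \<le> s"
  then show "Y r \<le> Y s"
    by (intro DERIV_nonneg_imp_nondecreasing[of r s Y]) (use assms in \<open>meson atLeastAtMost_iff order_trans\<close>)+
qed

text \<open>The candidate follows the graph with slope \<open>opt_slope\<close> and then climbs the
  wall. It attains the calibration bound, so every solution has a gap vanishing almost everywhere;
  all solutions then lie on one chain and are reparametrizations of the candidate.\<close>

lemma low_area_solutions:
  assumes a: "0 < a" and h: "0 < h" and L: "0 < L" "2 * L \<le> a\<^sup>2" "2 * L \<le> a * h"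
  shows "\<exists>\<eta>\<in>solutions a h L. \<forall>\<gamma>\<in>solutions a h L. reparam \<eta> \<gamma>"
proof -
  obtain k l where k: "0 < k" "k \<le> 1" and l: "0 \<le> l" and area: "area_of a k l = L"
    and height: "height_of a k l \<le> h" "k = 1 \<or> height_of a k l = h"
    using multiplier_exists[OF a h L] by blast
  let ?g = "opt_slope a k l"
  obtain Y where Y: "Y 0 = 0" "\<And>\<xi>. \<xi> \<in> {0..a} \<Longrightarrow> (Y has_real_derivative ?g \<xi>) (at \<xi>)"
    using continuous_antiderivative[OF continuous_on_opt_slope'] a by (metis less_imp_le)
  have "continuous_on UNIV (\<lambda>\<xi>. \<xi> * ?g \<xi>)" by (intro continuous_intros continuous_on_opt_slope')
  then obtain Z where Z: "Z 0 = 0" "\<And>\<xi>. \<xi> \<in> {0..a} \<Longrightarrow> (Z has_real_derivative \<xi> * ?g \<xi>) (at \<xi>)"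
    using continuous_antiderivative[of "\<lambda>\<xi>. \<xi> * ?g \<xi>" a] a by (metis less_imp_le)
  have "continuous_on UNIV (\<lambda>\<xi>. slope_cost_conj (?g \<xi>))"
    by (rule continuous_on_compose2[OF continuous_on_slope_cost_conj continuous_on_opt_slope']) auto
  then obtain G where G: "G 0 = 0" "\<And>\<xi>. \<xi> \<in> {0..a} \<Longrightarrow> (G has_real_derivative slope_cost_conj (?g \<xi>)) (at \<xi>)"
    using continuous_antiderivative[of "\<lambda>\<xi>. slope_cost_conj (?g \<xi>)" a] a by (metis less_imp_le)
  have Ya: "Y a = height_of a k l"
    using antiderivative_has_integral[OF a Y(2)] Y(1) by (simp add: height_of_def)
  have "integral {0..a} (\<lambda>\<xi>. (a - \<xi>) * ?g \<xi>) = (a * Y a - Z a) - (a * Y 0 - Z 0)"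
    by (rule antiderivative_has_integral[OF a, of "\<lambda>\<xi>. a * Y \<xi> - Z \<xi>"])
      (auto intro!: derivative_eq_intros Y(2) Z(2) simp: algebra_simps)
  then have area': "a * Y a - Z a = L" using area Y(1) Z(1) by (simp add: area_of_def)
  have Ymono: "mono_on {0..a} Y" by (rule deriv_nonneg_mono_on[OF Y(2) opt_slope_01(1)])
  have "mono_on {0..a} (\<lambda>\<xi>. \<xi> - Y \<xi>)"
    by (rule deriv_nonneg_mono_on[of _ _ "\<lambda>\<xi>. 1 - ?g \<xi>"])
      (auto intro!: derivative_eq_intros Y(2) simp: opt_slope_01)
  then have Ylip: "Y \<xi>' - Y \<xi> \<le> \<xi>' - \<xi>" if "\<xi> \<in> {0..a}" "\<xi>' \<in> {0..a}" "\<xi> \<le> \<xi>'" for \<xi> \<xi>'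
    using mono_onD[of _ _ \<xi> \<xi>'] that by fastforce
  \<comment> \<open>\<open>K\<close> is the width plus the height left for the wall: the abscissa
    advances at speed \<open>K\<close> until time \<open>a / K\<close>, and the remaining time is
    spent climbing \<open>K - a = h - Y a\<close>.\<close>
  define K where "K = a + h - Y a"
  have K: "a \<le> K" "0 < K" using Ya height(1) a by (auto simp: K_def)
  define X where "X t = min a (K * t)" for t
  define \<eta> where "\<eta> = (\<lambda>t. (X t, Y (X t) + (K * t - X t)))"
  have X: "X t \<in> {0..a}" if "0 \<le> t" for t using that a K by (auto simp: X_def)
  have Xm: "X s \<le> X t" "X t - X s \<le> K * t - K * s" if "s \<le> t" for s t
  proof -
    have "K * s \<le> K * t" using that K by simp
    then show "X s \<le> X t" "X t - X s \<le> K * t - K * s"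
      unfolding X_def min_def by (smt (verit))+
  qed
  define p where "p t = (if K * t < a then K else 0)" for t
  have Xd: "(X has_real_derivative p t) (at t)" if "t \<noteq> a / K" for t
  proof (cases "K * t < a")
    case True
    have "((\<lambda>t. K * t) has_real_derivative K) (at t)" by (auto intro!: derivative_eq_intros)
    then have "(X has_real_derivative K) (at t)"
      by (rule has_field_derivative_transform_within_open[of _ _ _ "{..<a / K}"])
        (use True K in \<open>auto simp: X_def field_simps\<close>)
    then show ?thesis using True by (simp add: p_def)
  next
    case False
    then have "a / K < t" using that K by (simp add: field_simps less_le)
    have "((\<lambda>t. a) has_real_derivative 0) (at t)" by auto
    then have "(X has_real_derivative 0) (at t)"
      by (rule has_field_derivative_transform_within_open[of _ _ _ "{a / K<..}"])
        (use \<open>a / K < t\<close> K in \<open>auto simp: X_def field_simps\<close>)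
    then show ?thesis using False by (simp add: p_def)
  qed
  have YXd: "((\<lambda>t. Y (X t)) has_real_derivative ?g (X t) * p t) (at t)"
    "((\<lambda>t. Z (X t)) has_real_derivative (X t * ?g (X t)) * p t) (at t)" if "0 \<le> t" "t \<noteq> a / K" for t
    using DERIV_chain2[OF Y(2)[OF X] Xd] DERIV_chain2[OF Z(2)[OF X] Xd] that by blast+
  define q where "q t = ?g (X t) * p t + (K - p t)" for t
  have etad: "((\<lambda>t. fst (\<eta> t)) has_real_derivative p t) (at t)"
    "((\<lambda>t. snd (\<eta> t)) has_real_derivative q t) (at t)" if "0 \<le> t" "t \<noteq> a / K" for t
    using Xd[OF that(2)] YXd(1)[OF that] by (auto simp: \<eta>_def q_def intro!: derivative_eq_intros)
  have acX: "abs_cont_on 0 1 X"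
    by (rule abs_cont_on_lipschitz[of _ _ _ K])
      (use Xm in \<open>auto simp: dist_real_def right_diff_distrib abs_le_iff\<close>)
  have Xim: "X ` {0..1} \<subseteq> {0..a}" using X by force
  have acYX: "abs_cont_on 0 1 (\<lambda>t. Y (X t))"
    by (rule abs_cont_on_C1_compose[OF acX Xim has_field_derivative_at_within[OF Y(2)]])
      (auto intro: continuous_on_opt_slope')
  have acZX: "abs_cont_on 0 1 (\<lambda>t. Z (X t))"
    by (rule abs_cont_on_C1_compose[OF acX Xim has_field_derivative_at_within[OF Z(2)]])
      (auto intro!: continuous_intros continuous_on_opt_slope')
  \<comment> \<open>Climbing starts only when the abscissa has stopped; this kills the cross term in
    the derivative of \<open>\<Phi>\<close> below.\<close>
  have off: "p t * (K * t - X t) = 0" for t by (simp add: p_def X_def)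
  have adm: "\<eta> \<in> admissible a h L"
  \<comment> \<open>\<open>X t * Y (X t) - Z (X t)\<close> is the area under the graph up to
    abscissa \<open>X t\<close>, so \<open>\<Phi>\<close> is the product of the coordinates minus
    the area swept below the curve.\<close>
  proof (rule admissible_monotoneI[where M = "{a / K}" and C = "2 * K" and p = p and q = q
        and \<Phi> = "\<lambda>t. X t * (Y (X t) + (K * t - X t)) - (X t * Y (X t) - Z (X t))"])
    fix s t :: real assume st: "0 \<le> s" "s \<le> t" "t \<le> 1"
    have Ym: "Y (X s) \<le> Y (X t)" "Y (X t) - Y (X s) \<le> X t - X s"
      using mono_onD[OF Ymono X X, of s t] Ylip[OF X X, of s t] Xm(1)[OF st(2)] st by auto
    show "fst (\<eta> s) \<le> fst (\<eta> t) \<and> snd (\<eta> s) \<le> snd (\<eta> t)"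
      using Ym Xm[OF st(2)] by (simp add: \<eta>_def)
    show "fst (\<eta> t) + snd (\<eta> t) - (fst (\<eta> s) + snd (\<eta> s)) \<le> 2 * K * (t - s)"
      using Ym Xm[OF st(2)] by (simp add: \<eta>_def algebra_simps)
  next
    fix s t :: real assume st: "0 \<le> s" "s < t" "t \<le> 1"
    have "Y (X s) \<le> Y (X t)"
      using mono_onD[OF Ymono X X, of s t] Xm(1)[of s t] st by auto
    moreover have "K * s < K * t" using st K by simp
    ultimately show "fst (\<eta> s) + snd (\<eta> s) < fst (\<eta> t) + snd (\<eta> t)" by (simp add: \<eta>_def)
  next
    show "\<eta> 0 = (0, 0)" "\<eta> 1 = (a, h)" using Y(1) K a by (auto simp: \<eta>_def X_def K_def)
    show "negligible {a / K}" by simp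
  next
    fix t assume t: "t \<in> {0<..<1} - {a / K}"
    then show "((\<lambda>t. fst (\<eta> t)) has_real_derivative p t) (at t)"
      "((\<lambda>t. snd (\<eta> t)) has_real_derivative q t) (at t)" using etad[of t] by auto
    show "0 \<le> p t \<and> (p t \<noteq> 0 \<or> q t \<noteq> 0)" using K by (auto simp: p_def q_def)
    have "((\<lambda>t. X t * (Y (X t) + (K * t - X t)) - (X t * Y (X t) - Z (X t))) has_real_derivative
        X t * q t + p t * (K * t - X t)) (at t)"
      using Xd[of t] YXd[of t] t by (auto simp: q_def intro!: derivative_eq_intros) (simp add: algebra_simps)
    then show "((\<lambda>t. X t * (Y (X t) + (K * t - X t)) - (X t * Y (X t) - Z (X t))) has_real_derivative
        fst (\<eta> t) * q t) (at t)" by (simp add: \<eta>_def off)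
  next
    show "abs_cont_on 0 1 (\<lambda>t. X t * (Y (X t) + (K * t - X t)) - (X t * Y (X t) - Z (X t)))"
    proof (intro abs_cont_on_diff abs_cont_on_mult abs_cont_on_add acX acYX acZX)
    qed (rule abs_cont_on_const abs_cont_on_id)+
    have "X 1 = a" "X 0 = 0" using K a by (auto simp: X_def)
    then show "X 1 * (Y (X 1) + (K * 1 - X 1)) - (X 1 * Y (X 1) - Z (X 1))
      - (X 0 * (Y (X 0) + (K * 0 - X 0)) - (X 0 * Y (X 0) - Z (X 0))) = a * h - L"
      using area' Z(1) by (simp add: K_def algebra_simps)
  qed
  interpret \<eta>: adm_curve a h L \<eta> by unfold_locales (use a h adm in auto)
  have x: "\<eta>.x t = X t" and y: "\<eta>.y t = Y (X t) + (K * t - X t)" for t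
    unfolding \<eta>.x_def \<eta>.y_def by (simp_all add: \<eta>_def)
  have F\<eta>: "functional_F \<eta> = k * h - l * L - G a"
  proof (rule \<eta>.functional_F_attained[OF k l G, of "{a / K}"])
    fix t assume t: "t \<in> {0..1} - (\<eta>.N \<union> {a / K})"
    have "\<eta>.p t = p t" "\<eta>.q t = q t"
      using vel_eq[OF etad[of t]] t by (auto simp: \<eta>.p_def \<eta>.q_def)
    moreover have "resistance_gap (?g (X t)) (p t) (q t) = 0"
    proof (rule resistance_gap_zero[OF opt_slope_01])
      show "0 \<le> p t" using K by (simp add: p_def)
      show "q t = ?g (X t) * p t \<or> ?g (X t) = 1 \<and> p t = 0 \<and> 0 \<le> q t"
      proof (cases "K * t < a")
        case False
        \<comment> \<open>After time \<open>a / K\<close> the curve climbs the wall, so the graph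
          ends below \<open>h\<close>. Complementarity then gives \<open>k = 1\<close>, for which
          vertical motion has no gap.\<close>
        then have "a < K * t" using t K by (auto simp: field_simps less_le)
        also have "K * t \<le> K" using t K by simp
        finally have "Y a \<noteq> h" by (simp add: K_def)
        then have "k = 1" using height(2) Ya by simp
        then show ?thesis using False K by (simp add: p_def q_def X_def opt_slope_def costate_def)
      qed (simp add: p_def q_def)
    qed
    ultimately show "\<eta>.gap k l t = 0" by (simp add: \<eta>.gap_def x)
  next
    fix t :: real assume t: "t \<in> {0..1}" "costate a k l (\<eta>.x t) = 0"
    \<comment> \<open>The costate is nondecreasing in the abscissa, so it and the slope vanish on
      all of \<open>{0..X t}\<close>. The wall is excluded because the costate there is
      \<open>k > 0\<close>.\<close>
    have c: "k \<le> l * (a - X t)" using t(2) x by (auto simp: costate_def min_def max_def split: if_splits)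
    have z: "?g \<xi> = 0" if "\<xi> \<in> {0..X t}" for \<xi>
    proof -
      have "l * (a - X t) \<le> l * (a - \<xi>)" using that l by (intro mult_left_mono) auto
      then have "costate a k l \<xi> = 0" using c by (simp add: costate_def)
      then show ?thesis by (simp add: opt_slope_def)
    qed
    have "mono_on {0..X t} (\<lambda>\<xi>. - Y \<xi>)"
    proof (rule deriv_nonneg_mono_on)
      fix \<xi> assume "\<xi> \<in> {0..X t}"
      then show "((\<lambda>\<xi>. - Y \<xi>) has_real_derivative - ?g \<xi>) (at \<xi>)"
        using X[of t] t by (intro DERIV_minus Y(2)) auto
      show "0 \<le> - ?g \<xi>" using z[OF \<open>\<xi> \<in> {0..X t}\<close>] by simp
    qed
    from mono_onD[OF this, of 0 "X t"] have "Y (X t) \<le> 0" using X[of t] t Y(1) by simp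
    moreover have "0 \<le> Y (X t)" using mono_onD[OF Ymono, of 0 "X t"] X[of t] t Y(1) a by simp
    moreover have "X t \<noteq> a" using c k by auto
    ultimately show "\<eta>.y t = 0" by (auto simp: y X_def min_def split: if_splits)
  qed simp_all
  have sol: "\<eta> \<in> solutions a h L"
    unfolding solutions_iff
  proof (intro conjI ballI adm)
    fix \<gamma> assume "\<gamma> \<in> admissible a h L"
    then interpret \<gamma>: adm_curve a h L \<gamma> by unfold_locales (use a h in auto)
    show "functional_F \<eta> \<le> functional_F \<gamma>" using \<gamma>.functional_F_lower(1)[OF k l G] F\<eta> by simp
  qed
  have "\<exists>P. mono_on {0..a} P \<and> (\<forall>\<gamma>\<in>solutions a h L. \<gamma> ` {0..1} \<subseteq> profile_chain a P \<and> mono_on {0..1} (\<lambda>t. snd (\<gamma> t)))"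
  proof -
    have gap: "\<gamma> \<in> admissible a h L \<and> negligible {t \<in> {0..1}. adm_curve.gap a \<gamma> k l t \<noteq> 0}"
      if "\<gamma> \<in> solutions a h L" for \<gamma>
    proof -
      have "\<gamma> \<in> admissible a h L" "functional_F \<gamma> = functional_F \<eta>"
        using that sol by (auto simp: solutions_iff intro: antisym)
      then interpret \<gamma>: adm_curve a h L \<gamma> by unfold_locales (use a h in auto)
      show ?thesis using \<gamma>.functional_F_lower(2)[OF k l G] F\<eta> \<open>functional_F \<gamma> = functional_F \<eta>\<close> \<gamma>.adm by simp
    qed
    show ?thesis
    \<comment> \<open>A costate identically 1 is the degenerate case: the area must be
      \<open>a\<^sup>2 / 2\<close> and the chain is the diagonal. Otherwise the costate is below 1
      left of the wall.\<close>
    proof (cases "k = 1 \<and> l = 0")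
      case True
      then have L': "2 * L = a\<^sup>2" using area_of_l0(1)[OF a, of 1] area by simp
      show ?thesis
      proof (intro exI[of _ "\<lambda>\<xi>. \<xi>"] conjI ballI)
        show "mono_on {0..a} (\<lambda>\<xi>. \<xi>)" by (simp add: mono_on_def)
        fix \<gamma> assume "\<gamma> \<in> solutions a h L"
        note g = gap[OF this]
        then interpret \<gamma>: adm_curve a h L \<gamma> by unfold_locales (use a h in auto)
        show "\<gamma> ` {0..1} \<subseteq> profile_chain a (\<lambda>\<xi>. \<xi>)" "mono_on {0..1} (\<lambda>t. snd (\<gamma> t))"
          using \<gamma>.minimizer_on_diagonal[OF L'] g True by (simp_all add: \<gamma>.y_def[abs_def])
      qed
    next
      case False
      have nd: "costate a k l \<xi> < 1" if "\<xi> \<in> {0..<a}" for \<xi>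
      proof -
        have "k - l * (a - \<xi>) < 1"
        proof (cases "l = 0")
          case True
          then show ?thesis using False k by simp
        next
          case False
          then have "0 < l * (a - \<xi>)" using l that by simp
          then show ?thesis using k by linarith
        qed
        then show ?thesis by (simp add: costate_def)
      qed
      show ?thesis
      proof (intro exI[of _ Y] conjI ballI Ymono)
        fix \<gamma> assume "\<gamma> \<in> solutions a h L"
        note g = gap[OF this]
        then interpret \<gamma>: adm_curve a h L \<gamma> by unfold_locales (use a h in auto)
        show "\<gamma> ` {0..1} \<subseteq> profile_chain a Y" "mono_on {0..1} (\<lambda>t. snd (\<gamma> t))"
          using \<gamma>.minimizer_on_chain[OF k l Y Ymono _ nd] g by (simp_all add: \<gamma>.y_def[abs_def])
      qed
    qed
  qed
  then obtain P where P: "mono_on {0..a} P"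
    "\<And>\<gamma>. \<gamma> \<in> solutions a h L \<Longrightarrow> \<gamma> ` {0..1} \<subseteq> profile_chain a P"
    "\<And>\<gamma>. \<gamma> \<in> solutions a h L \<Longrightarrow> mono_on {0..1} (\<lambda>t. snd (\<gamma> t))" by blast
  have sum: "continuous_on {0..1} (\<lambda>t. fst (\<gamma> t) + snd (\<gamma> t)) \<and> mono_on {0..1} (\<lambda>t. fst (\<gamma> t) + snd (\<gamma> t))
      \<and> \<gamma> 0 = (0, 0) \<and> \<gamma> 1 = (a, h)" if "\<gamma> \<in> solutions a h L" for \<gamma>
  proof -
    have adm: "\<gamma> \<in> admissible a h L" using that by (simp add: solutions_iff)
    then interpret \<gamma>: adm_curve a h L \<gamma> by unfold_locales (use a h in auto)
    have "mono_on {0..1} (\<lambda>t. fst (\<gamma> t) + snd (\<gamma> t))"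
      using \<gamma>.x_mono mono_onD[OF P(3)[OF that]] by (intro mono_onI add_mono) (auto simp: \<gamma>.x_def)
    moreover have "continuous_on {0..1} (\<lambda>t. fst (\<gamma> t) + snd (\<gamma> t))"
      using \<gamma>.continuous_x \<gamma>.continuous_y unfolding \<gamma>.x_def[abs_def] \<gamma>.y_def[abs_def]
      by (intro continuous_on_add)
    ultimately show ?thesis using adm by (simp add: admissible_def)
  qed
  show ?thesis
  proof (intro bexI[OF _ sol] ballI)
    fix \<gamma> assume \<gamma>: "\<gamma> \<in> solutions a h L"
    show "reparam \<eta> \<gamma>"
      by (rule reparam_same_sums[OF _ _ _ _ _ _ P(2)[OF \<gamma>] P(2)[OF sol] inj_on_profile_chain[OF P(1)] \<eta>.inj])
        (use sum[OF \<gamma>] sum[OF sol] in auto)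
  qed
qed

section \<open>Point reflection\<close>

text \<open>The point reflection exchanges the two end points; reversing time lets the curve start
  at the origin again.\<close>

definition flip :: "real \<Rightarrow> real \<Rightarrow> curve \<Rightarrow> curve" where
  "flip a h \<gamma> = (\<lambda>t. (a, h) - \<gamma> (1 - t))"

lemma flip_flip [simp]: "flip a h (flip a h \<gamma>) = \<gamma>"
  by (simp add: flip_def)

lemma reparam_flip:
  assumes "reparam \<gamma> \<eta>"
  shows "reparam (flip a h \<gamma>) (flip a h \<eta>)"
proof -
  obtain \<phi> :: "real \<Rightarrow> real" where \<phi>: "mono_on {0..1} \<phi>" "\<phi> ` {0..1} = {0..1}" "\<forall>t\<in>{0..1}. \<eta> t = \<gamma> (\<phi> t)"
    using assms unfolding reparam_def by blast
  define \<psi> where "\<psi> t = 1 - \<phi> (1 - t)" for t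
  have refl: "(\<lambda>t. 1 - t) ` {0..1} = {0..1 :: real}" by (auto simp: image_iff intro!: bexI[of _ "1 - _"])
  have "mono_on {0..1} \<psi>" using mono_onD[OF \<phi>(1)] by (intro mono_onI) (simp add: \<psi>_def)
  moreover have "\<psi> ` {0..1} = (\<lambda>t. 1 - t) ` \<phi> ` (\<lambda>t. 1 - t) ` {0..1}"
  proof -
    have "\<psi> = (\<lambda>t. 1 - \<phi> (1 - t))" by (rule ext) (simp add: \<psi>_def)
    then show ?thesis by (simp only: image_image)
  qed
  then have "\<psi> ` {0..1} = {0..1}" by (simp only: refl \<phi>(2))
  moreover have "\<forall>t\<in>{0..1}. flip a h \<eta> t = flip a h \<gamma> (\<psi> t)"
    using \<phi>(3) by (simp add: flip_def \<psi>_def)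
  ultimately show ?thesis unfolding reparam_def by blast
qed

lemma integral_flip_01:
  fixes f :: "real \<Rightarrow> real"
  assumes "f absolutely_integrable_on {0..1}"
  shows "(\<lambda>t. f (1 - t)) absolutely_integrable_on {0..1}"
    "integral {0..1} (\<lambda>t. f (1 - t)) = integral {0..1} f"
proof -
  have int: "((\<lambda>t. g (1 - t)) has_integral i) {0..1}" if "(g has_integral i) {0..1}" for g :: "real \<Rightarrow> real" and i
  proof -
    have "(g has_integral i) (cbox 0 1)" using that by simp
    from has_integral_affinity[OF this, of "-1" 1]
    have "((\<lambda>t. g (1 - t)) has_integral i) ((\<lambda>t. 1 - t) ` {0..1})" by simp
    moreover have "(\<lambda>t. 1 - t) ` {0..1} = {0..1 :: real}" by (auto simp: image_iff intro!: bexI[of _ "1 - _"])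
    ultimately show ?thesis by simp
  qed
  have "f integrable_on {0..1}" "(\<lambda>t. norm (f t)) integrable_on {0..1}"
    using assms by (auto simp: absolutely_integrable_on_def)
  then show "(\<lambda>t. f (1 - t)) absolutely_integrable_on {0..1}"
    using int unfolding absolutely_integrable_on_def integrable_on_def by blast
  show "integral {0..1} (\<lambda>t. f (1 - t)) = integral {0..1} f"
    by (rule integral_unique[OF int[OF integrable_integral]]) fact
qed

text \<open>The signs from reflection and time reversal cancel: at \<open>t\<close> the new velocity
  is that of \<open>\<gamma>\<close> at \<open>1 - t\<close>, which preserves the functional and the
  sign condition. In the area constraint \<open>x\<close> is replaced by \<open>a - x\<close>, whose
  integral against \<open>q\<close> is \<open>a * h - (a * h - L)\<close>.\<close>

lemma flip_admissible:
  assumes "0 < a" "0 < h" "\<gamma> \<in> admissible a h L"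
  shows "flip a h \<gamma> \<in> admissible a h (a * h - L)" "functional_F (flip a h \<gamma>) = functional_F \<gamma>"
proof -
  interpret adm_curve a h L \<gamma> by unfold_locales (use assms in auto)
  let ?g = "flip a h \<gamma>"
  define M where "M = (\<lambda>t. 1 - t) ` N"
  have M: "negligible M"
    unfolding M_def by (rule negligible_differentiable_image_negligible[OF _ negligible_N])
      (auto intro!: derivative_intros differentiable_on_subset)
  have off: "1 - t \<in> {0..1} - N" if "t \<in> {0..1} - M" for t
  proof -
    have "1 - t \<notin> N"
    proof
      assume "1 - t \<in> N"
      then have "1 - (1 - t) \<in> M" unfolding M_def by (rule imageI)
      then show False using that by simp
    qed
    then show ?thesis using that by simp
  qed
  have v: "vel ?g t = (p (1 - t), q (1 - t))" if t: "t \<in> {0..1} - M" for t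
  proof (rule vel_eq)
    have "((\<lambda>t. 1 - t) has_real_derivative -1) (at t)" by (auto intro!: derivative_eq_intros)
    from DERIV_chain2[OF velocity(1)[OF off[OF t]] this] DERIV_chain2[OF velocity(2)[OF off[OF t]] this]
    have "((\<lambda>t. x (1 - t)) has_real_derivative - p (1 - t)) (at t)"
      "((\<lambda>t. y (1 - t)) has_real_derivative - q (1 - t)) (at t)" by simp_all
    then show "((\<lambda>t. fst (?g t)) has_real_derivative p (1 - t)) (at t)"
      "((\<lambda>t. snd (?g t)) has_real_derivative q (1 - t)) (at t)"
      by (auto simp: flip_def x_def y_def intro!: derivative_eq_intros)
  qed
  have LINT_eq: "(LINT t:{0..1}|lebesgue. f t) = integral {0..1} g"
    if g: "g absolutely_integrable_on {0..1}" and fg: "\<And>t. t \<in> {0..1} - M \<Longrightarrow> f t = g (1 - t)" for f g :: "real \<Rightarrow> real"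
  proof -
    have "f absolutely_integrable_on {0..1}"
      by (rule absolutely_integrable_spike[OF integral_flip_01(1)[OF g] M]) (use fg in auto)
    then have "(LINT t:{0..1}|lebesgue. f t) = integral {0..1} f"
      by (rule set_lebesgue_integral_eq_integral(2))
    also have "\<dots> = integral {0..1} (\<lambda>t. g (1 - t))"
      by (rule integral_spike[OF M]) (use fg in auto)
    finally show ?thesis using integral_flip_01(2)[OF g] by simp
  qed
  have "functional_F ?g = integral {0..1} (\<lambda>t. resistance (p t) (q t))"
    unfolding functional_F_def by (rule LINT_eq[OF integrable_resistance]) (simp add: v resistance_def)
  then show "functional_F ?g = functional_F \<gamma>" by (simp only: functional_F_eq)
  have adm': "\<gamma> 0 = (0, 0)" "\<gamma> 1 = (a, h)"
    using adm by (auto simp: admissible_def)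
  have "abs_cont_on 0 1 ?g"
    by (rule abs_cont_on_dominated[OF abs_cont_on_reflect[OF ac], of _ 1])
      (simp add: flip_def dist_norm norm_minus_commute)
  moreover have "?g ` {0..1} \<subseteq> {0..a} \<times> {0..h}"
  proof (rule image_subsetI)
    fix t :: real assume "t \<in> {0..1}"
    then show "?g t \<in> {0..a} \<times> {0..h}"
      using range_x[of "1 - t"] range_y[of "1 - t"] by (simp add: flip_def x_def y_def mem_Times_iff)
  qed
  moreover have "inj_on ?g {0..1}"
  proof (rule inj_onI)
    fix s t :: real assume "s \<in> {0..1}" "t \<in> {0..1}" "?g s = ?g t"
    then show "s = t" using inj_onD[OF inj, of "1 - s" "1 - t"] by (simp add: flip_def)
  qed
  moreover have "AE t\<in>{0<..<1} in lebesgue. norm (vel ?g t) \<noteq> 0"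
    by (rule negligible_imp_AE[OF M]) (use v velocity(4)[OF off] in \<open>force simp: prod_eq_iff\<close>)
  moreover have "AE t\<in>{0<..<1} in lebesgue. fst (vel ?g t) \<ge> 0"
    by (rule negligible_imp_AE[OF M]) (use v velocity(3)[OF off] in force)
  moreover have "(LINT t:{0..1}|lebesgue. fst (?g t) * snd (vel ?g t)) = a * h - (a * h - L)"
  proof -
    have aq: "(\<lambda>t. a * q t) absolutely_integrable_on {0..1}"
      by (intro continuous_times_absolutely_integrable integrable_q continuous_on_const)
    have "(LINT t:{0..1}|lebesgue. fst (?g t) * snd (vel ?g t)) = integral {0..1} (\<lambda>t. a * q t - x t * q t)"
    proof (rule LINT_eq[OF set_integral_diff(1)[OF aq integrable_xq]])
      fix t assume t: "t \<in> {0..1} - M"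
      have "fst (?g t) = a - x (1 - t)" by (simp add: flip_def x_def)
      then show "fst (?g t) * snd (vel ?g t) = a * q (1 - t) - x (1 - t) * q (1 - t)"
        by (simp add: v[OF t] left_diff_distrib)
    qed
    also have "\<dots> = a * integral {0..1} q - (a * h - L)"
      using integral_diff[OF set_lebesgue_integral_eq_integral(1)[OF aq] set_lebesgue_integral_eq_integral(1)[OF integrable_xq]]
        integral_xq by simp
    also have "integral {0..1} q = h"
      using ftc(1)[of 0 1 y q] ac_y velocity(2) ends by (simp add: integral_unique)
    finally show ?thesis by simp
  qed
  ultimately show "?g \<in> admissible a h (a * h - L)"
    using adm' unfolding admissible_def by (simp add: flip_def zero_prod_def)
qed

lemma flip_solutions:
  assumes "0 < a" "0 < h" "\<gamma> \<in> solutions a h L"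
  shows "flip a h \<gamma> \<in> solutions a h (a * h - L)"
  unfolding solutions_iff
proof (intro conjI ballI)
  have \<gamma>: "\<gamma> \<in> admissible a h L" "\<And>\<eta>. \<eta> \<in> admissible a h L \<Longrightarrow> functional_F \<gamma> \<le> functional_F \<eta>"
    using assms(3) by (auto simp: solutions_iff)
  then show "flip a h \<gamma> \<in> admissible a h (a * h - L)" using flip_admissible(1) assms by blast
  fix \<eta> assume "\<eta> \<in> admissible a h (a * h - L)"
  then have "flip a h \<eta> \<in> admissible a h L" "functional_F (flip a h \<eta>) = functional_F \<eta>"
    using flip_admissible[of a h \<eta> "a * h - L"] assms by auto
  then show "functional_F (flip a h \<gamma>) \<le> functional_F \<eta>"
    using \<gamma> flip_admissible(2)[OF assms(1,2) \<gamma>(1)] by metis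
qed

lemma unique_class:
  assumes "\<eta> \<in> solutions a h L" "\<And>\<gamma>. \<gamma> \<in> solutions a h L \<Longrightarrow> reparam \<eta> \<gamma>"
  shows "\<exists>!C. C \<in> solutions a h L // reparam_rel (solutions a h L)"
proof -
  let ?S = "solutions a h L"
  let ?R = "reparam_rel ?S"
  have "?R `` {\<gamma>} = ?R `` {\<eta>}" if "\<gamma> \<in> ?S" for \<gamma>
    by (rule equiv_class_eq[OF equiv_solutions, symmetric]) (use assms that in \<open>simp add: reparam_rel_def\<close>)
  then have "?S // ?R = (\<Union>\<gamma>\<in>?S. {?R `` {\<eta>}})"
    unfolding quotient_def by (intro SUP_cong refl) simp
  also have "\<dots> = {?R `` {\<eta>}}" using assms(1) by blast
  finally show ?thesis by (simp only: singleton_iff) simp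
qed

section \<open>Staircase curves\<close>

lemma relu_deriv:
  assumes "u \<noteq> c"
  shows "((\<lambda>u. max 0 (u - c)) has_real_derivative of_bool (c < u)) (at u)"
proof (cases "c < u")
  case True
  have "((\<lambda>u. u - c) has_real_derivative 1) (at u)" by (auto intro!: derivative_eq_intros)
  then have "((\<lambda>u. max 0 (u - c)) has_real_derivative 1) (at u)"
    by (rule has_field_derivative_transform_within_open[of _ _ _ "{c<..}"]) (use True in auto)
  then show ?thesis using True by simp
next
  case False
  have "((\<lambda>u. 0 :: real) has_real_derivative 0) (at u)" by auto
  then have "((\<lambda>u. max 0 (u - c)) has_real_derivative 0) (at u)"
    by (rule has_field_derivative_transform_within_open[of _ _ _ "{..<c}"]) (use False assms in auto)
  then show ?thesis using False by simp
qed

text \<open>With \<open>w = h - a + b\<close> this is the abscissa, as a function of the height \<open>u\<close>, of a staircase curve: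
  vertical up to height \<open>v\<close>, diagonal for a width \<open>b\<close>, vertical up to height \<open>w\<close>, and diagonal again.\<close>

definition stair :: "real \<Rightarrow> real \<Rightarrow> real \<Rightarrow> real \<Rightarrow> real" where
  "stair v b w u = max 0 (u - v) - max 0 (u - (v + b)) + max 0 (u - w)"

text \<open>For \<open>k = 1\<close> and \<open>l = 0\<close> the costate is constantly 1, and slope
  1 and vertical motion have no gap. The equation for \<open>L\<close> is the area:
  \<open>a\<^sup>2 / 2\<close> from the diagonal pieces, and for each vertical piece its height
  times the width to its right, namely \<open>v * a\<close> and
  \<open>(h - a - v) * (a - b)\<close>.\<close>

lemma staircase_solution:
  assumes a: "0 < a" and h: "a < h" and v: "0 \<le> v" "0 < b" "b < a" "v < h - a"
    and L: "2 * L = a\<^sup>2 + 2 * v * a + 2 * (h - a - v) * (a - b)"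
  shows "(\<lambda>t. (stair v b (h - a + b) (h * t), h * t)) \<in> solutions a h L"
proof -
  let ?w = "h - a + b"
  let ?X = "stair v b ?w"
  define \<gamma> where "\<gamma> = (\<lambda>t. (?X (h * t), h * t))"
  have hp: "0 < h" using a h by simp
  have Xm: "?X s \<le> ?X t" "?X t - ?X s \<le> t - s" if "s \<le> t" for s t
    using that v unfolding stair_def max_def by (smt (verit))+
  define S where "S = {v / h, (v + b) / h, ?w / h}"
  define d where "d u = of_bool (v < u) - of_bool (v + b < u) + (of_bool (?w < u) :: real)" for u
  have d01: "d u = 0 \<or> d u = 1" for u using v by (auto simp: d_def)
  have Xd: "((\<lambda>t. ?X (h * t)) has_real_derivative h * d (h * t)) (at t)" if "t \<notin> S" for t
  proof -
    have ne: "h * t \<noteq> v" "h * t \<noteq> v + b" "h * t \<noteq> ?w" using that hp by (auto simp: S_def field_simps)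
    have "(?X has_real_derivative d (h * t)) (at (h * t))"
      unfolding stair_def[abs_def] d_def by (intro DERIV_add DERIV_diff relu_deriv ne)
    moreover have "((\<lambda>t. h * t) has_real_derivative h) (at t)" by (auto intro!: derivative_eq_intros)
    ultimately show ?thesis using DERIV_chain2[of ?X "d (h * t)" "\<lambda>t. h * t" t h] by (simp add: mult.commute)
  qed
  \<comment> \<open>An antiderivative of \<open>h\<close> times one ramp of \<open>stair\<close>;
    the combination of three of them evaluates the area constraint.\<close>
  define R where "R c t = (max 0 (h * t - c))\<^sup>2 / 2" for c t :: real
  have Rd: "(R c has_real_derivative h * max 0 (h * t - c)) (at t)" if "h * t \<noteq> c" for c t
  proof -
    have d1: "((\<lambda>u. (max 0 (u - c))\<^sup>2 / 2) has_real_derivative max 0 (h * t - c)) (at (h * t))"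
      using relu_deriv[OF that] by (auto intro!: derivative_eq_intros simp: max_def)
    have d2: "((\<lambda>t. h * t) has_real_derivative h) (at t)" by (auto intro!: derivative_eq_intros)
    have "(R c has_real_derivative max 0 (h * t - c) * h) (at t)"
      unfolding R_def[abs_def] by (rule DERIV_chain2[OF d1 d2])
    then show ?thesis by (simp add: mult.commute)
  qed
  have Rac: "abs_cont_on 0 1 (R c)" for c
  proof -
    have "abs_cont_on 0 1 (\<lambda>t. max 0 (h * t - c))"
    proof (rule abs_cont_on_lipschitz[of _ _ _ h])
      fix s t :: real assume "s \<le> t"
      then have "h * s \<le> h * t" using hp by simp
      then show "dist (max 0 (h * s - c)) (max 0 (h * t - c)) \<le> h * (t - s)"
        unfolding dist_real_def max_def right_diff_distrib by (smt (verit))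
    qed
    from abs_cont_on_mult[OF abs_cont_on_mult[OF this this] abs_cont_on_const[of _ _ "1 / 2"]]
    show ?thesis by (simp add: R_def[abs_def] power2_eq_square)
  qed
  have adm: "\<gamma> \<in> admissible a h L"
  proof (rule admissible_monotoneI[where M = S and C = "2 * h" and p = "\<lambda>t. h * d (h * t)" and q = "\<lambda>_. h"
        and \<Phi> = "\<lambda>t. R v t - R (v + b) t + R ?w t"])
    fix s t :: real assume st: "0 \<le> s" "s \<le> t" "t \<le> 1"
    then have "h * s \<le> h * t" using hp by simp
    note X = Xm[OF this] this
    show "fst (\<gamma> s) \<le> fst (\<gamma> t) \<and> snd (\<gamma> s) \<le> snd (\<gamma> t)" using X by (simp add: \<gamma>_def)
    show "fst (\<gamma> t) + snd (\<gamma> t) - (fst (\<gamma> s) + snd (\<gamma> s)) \<le> 2 * h * (t - s)"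
      using X by (simp add: \<gamma>_def algebra_simps)
  next
    fix s t :: real assume st: "0 \<le> s" "s < t" "t \<le> 1"
    then have "h * s < h * t" using hp by simp
    then show "fst (\<gamma> s) + snd (\<gamma> s) < fst (\<gamma> t) + snd (\<gamma> t)"
      using Xm(1)[of "h * s" "h * t"] by (simp add: \<gamma>_def)
  next
    show "\<gamma> 0 = (0, 0)" "\<gamma> 1 = (a, h)" using v a h by (auto simp: \<gamma>_def stair_def)
    show "negligible S" by (simp add: S_def negligible_finite)
  next
    fix t assume t: "t \<in> {0<..<1} - S"
    then show "((\<lambda>t. fst (\<gamma> t)) has_real_derivative h * d (h * t)) (at t)" using Xd by (simp add: \<gamma>_def)
    show "((\<lambda>t. snd (\<gamma> t)) has_real_derivative h) (at t)" by (auto simp: \<gamma>_def intro!: derivative_eq_intros)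
    show "0 \<le> h * d (h * t) \<and> (h * d (h * t) \<noteq> 0 \<or> h \<noteq> 0)" using d01[of "h * t"] hp by auto
    have ne: "h * t \<noteq> v" "h * t \<noteq> v + b" "h * t \<noteq> ?w" using t hp by (auto simp: S_def field_simps)
    have "((\<lambda>t. R v t - R (v + b) t + R ?w t) has_real_derivative
        h * max 0 (h * t - v) - h * max 0 (h * t - (v + b)) + h * max 0 (h * t - ?w)) (at t)"
      by (intro DERIV_add DERIV_diff Rd ne)
    then show "((\<lambda>t. R v t - R (v + b) t + R ?w t) has_real_derivative fst (\<gamma> t) * h) (at t)"
      by (simp add: \<gamma>_def stair_def algebra_simps)
  next
    show "abs_cont_on 0 1 (\<lambda>t. R v t - R (v + b) t + R ?w t)" by (intro abs_cont_on_add abs_cont_on_diff Rac)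
    have "R v 1 - R (v + b) 1 + R ?w 1 = (h - v)\<^sup>2 / 2 - (h - (v + b))\<^sup>2 / 2 + (a - b)\<^sup>2 / 2"
      using v a h by (simp add: R_def max_def)
    moreover have "R v 0 - R (v + b) 0 + R ?w 0 = 0" using v a h by (simp add: R_def max_def)
    ultimately show "R v 1 - R (v + b) 1 + R ?w 1 - (R v 0 - R (v + b) 0 + R ?w 0) = a * h - L"
      using L by (simp add: power2_eq_square field_simps)
  qed
  have os: "opt_slope a 1 0 \<xi> = 1" for \<xi> by (simp add: opt_slope_l0)
  \<comment> \<open>Since \<open>slope_cost_conj 1 = 1 / 2\<close>, the calibration bound is
    \<open>h - a / 2\<close>; with \<open>l = 0\<close> the area does not enter.\<close>
  have G: "((\<lambda>\<xi>. \<xi> / 2) has_real_derivative slope_cost_conj (opt_slope a 1 0 \<xi>)) (at \<xi>)" for \<xi>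
    by (auto intro!: derivative_eq_intros simp: os slope_cost_conj_def)
  interpret adm_curve a h L \<gamma> by unfold_locales (use a hp adm in auto)
  have F: "functional_F \<gamma> = 1 * h - 0 * L - a / 2"
  proof (rule functional_F_attained[OF _ _ _ _ G, of S])
    fix t assume t: "t \<in> {0..1} - (N \<union> S)"
    have "((\<lambda>t. fst (\<gamma> t)) has_real_derivative h * d (h * t)) (at t)" using Xd[of t] t by (simp add: \<gamma>_def)
    moreover have "((\<lambda>t. snd (\<gamma> t)) has_real_derivative h) (at t)" by (auto simp: \<gamma>_def intro!: derivative_eq_intros)
    ultimately have "p t = h * d (h * t)" "q t = h" using vel_eq[of \<gamma> _ t] unfolding p_def q_def by force+
    then show "gap 1 0 t = 0"
      unfolding gap_def os using d01[of "h * t"] hp by (intro resistance_gap_zero) auto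
  qed (auto simp: S_def negligible_finite costate_def)
  have "\<gamma> \<in> solutions a h L"
    unfolding solutions_iff
  proof (intro conjI ballI adm)
    fix \<eta> assume "\<eta> \<in> admissible a h L"
    then interpret \<eta>: adm_curve a h L \<eta> by unfold_locales (use a hp in auto)
    show "functional_F \<gamma> \<le> functional_F \<eta>"
      using \<eta>.functional_F_lower(1)[of 1 0, OF _ _ _ _ G] F by simp
  qed
  then show ?thesis by (simp add: \<gamma>_def)
qed

text \<open>The height \<open>v\<close> of the first vertical piece ranges over an interval, the
  area constraint then fixes the position of the second one, and different \<open>v\<close> give
  different images.\<close>

lemma staircase_classes_infinite:
  assumes a: "0 < a" and h: "0 < h" and L: "a\<^sup>2 < 2 * L" "2 * L < 2 * a * h - a\<^sup>2"
  shows "infinite (solutions a h L // reparam_rel (solutions a h L))"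
proof -
  let ?S = "solutions a h L"
  \<comment> \<open>\<open>E\<close> is the excess of the area over that of the diagonal,
    \<open>T\<close> the total height of the vertical pieces. The two bounds on \<open>L\<close>
    amount to \<open>0 < E\<close> and \<open>E < a * T\<close>.\<close>
  define E where "E = L - a\<^sup>2 / 2"
  define T where "T = h - a"
  have E: "0 < E" "E < a * T" using L by (auto simp: E_def T_def power2_eq_square algebra_simps)
  then have T: "0 < T" using a by (meson less_trans zero_less_mult_pos)
  \<comment> \<open>The first vertical piece accounts for \<open>v * a\<close> of the excess;
    \<open>b v\<close> places the second one, of height \<open>T - v\<close>, so that it supplies
    the rest. For \<open>v\<close> in \<open>I\<close> a positive rest remains.\<close>
  define b where "b v = a - (E - v * a) / (T - v)" for v
  define \<gamma> where "\<gamma> v = (\<lambda>t. (stair v (b v) (h - a + b v) (h * t), h * t))" for v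
  define I where "I = {0<..<E / a}"
  have v: "0 < v" "v < T" "0 < b v" "b v < a" if "v \<in> I" for v
  proof -
    show "0 < v" using that by (simp add: I_def)
    have va: "v * a < E" using that a by (simp add: I_def field_simps)
    also have "E < T * a" using E(2) by (simp add: mult.commute)
    finally show vT: "v < T" using a by simp
    show "b v < a" using va vT by (simp add: b_def)
    have "E - v * a < a * (T - v)" using E(2) by (simp add: algebra_simps)
    then show "0 < b v" using vT by (simp add: b_def divide_less_eq)
  qed
  have sol: "\<gamma> v \<in> ?S" if "v \<in> I" for v
    unfolding \<gamma>_def
  proof (rule staircase_solution)
    have "(T - v) * (a - b v) = E - v * a" using v(2)[OF that] by (simp add: b_def)
    then show "2 * L = a\<^sup>2 + 2 * v * a + 2 * (h - a - v) * (a - b v)"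
      by (simp add: T_def E_def algebra_simps)
  qed (use v[OF that] a T in \<open>auto simp: T_def\<close>)
  have distinct: "\<not> reparam (\<gamma> v) (\<gamma> v')" if "v \<in> I" "v' \<in> I" "v < v'" for v v'
  proof
    assume "reparam (\<gamma> v) (\<gamma> v')"
    then have "\<gamma> v' ` {0..1} \<subseteq> \<gamma> v ` {0..1}" unfolding reparam_def by force
    \<comment> \<open>At height \<open>v'\<close> the curve \<open>\<gamma> v'\<close> is still at
      abscissa 0, whereas \<open>\<gamma> v\<close> has already left it. Both curves are
      parametrized by height, so a common point must have the same parameter.\<close>
    moreover have "v' / h \<in> {0..1}" using v[OF that(2)] a h by (auto simp: T_def field_simps)
    ultimately obtain t where t: "t \<in> {0..1}" "\<gamma> v' (v' / h) = \<gamma> v t" by blast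
    then have ht: "h * t = v'" and "stair v' (b v') (h - a + b v') v' = stair v (b v) (h - a + b v) v'"
      using h by (auto simp: \<gamma>_def)
    moreover have "stair v' (b v') (h - a + b v') v' = 0"
      using v[OF that(2)] by (simp add: stair_def T_def max_def)
    moreover have "0 < stair v (b v) (h - a + b v) v'"
      using v[OF that(1)] that(3) by (simp add: stair_def max_def)
    ultimately show False by simp
  qed
  have inj: "inj_on (\<lambda>v. reparam_rel ?S `` {\<gamma> v}) I"
  proof (rule inj_onI, rule ccontr)
    fix v v' assume vv: "v \<in> I" "v' \<in> I" "reparam_rel ?S `` {\<gamma> v} = reparam_rel ?S `` {\<gamma> v'}" "v \<noteq> v'"
    then have "(\<gamma> v, \<gamma> v') \<in> reparam_rel ?S"
      using eq_equiv_class[OF _ equiv_solutions sol] by blast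
    then have "(\<gamma> v', \<gamma> v) \<in> reparam_rel ?S" "(\<gamma> v, \<gamma> v') \<in> reparam_rel ?S"
      using equiv_solutions[of a h L] unfolding equiv_def by (meson symD)+
    then have "reparam (\<gamma> v) (\<gamma> v')" "reparam (\<gamma> v') (\<gamma> v)" by (auto simp: reparam_rel_def)
    then show False using distinct[of v v'] distinct[of v' v] vv by (cases v v' rule: linorder_cases) auto
  qed
  have "infinite I" using E a by (simp add: I_def infinite_Ioo)
  then have "infinite ((\<lambda>v. reparam_rel ?S `` {\<gamma> v}) ` I)" using inj by (simp add: finite_image_iff)
  moreover have "(\<lambda>v. reparam_rel ?S `` {\<gamma> v}) ` I \<subseteq> ?S // reparam_rel ?S"
    using sol by (auto intro: quotientI)
  ultimately show ?thesis using finite_subset by blast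
qed

theorem theorem2p1:
  fixes a h L :: real
  assumes "a > 0" and "h > 0" and "L \<in> {0<..<a * h}"
  shows "(2 * L \<notin> {a\<^sup>2<..<2 * a * h - a\<^sup>2} \<longrightarrow>
            (\<exists>!C. C \<in> solutions a h L // reparam_rel (solutions a h L)))
       \<and> (h \<le> a \<longrightarrow> 2 * L \<notin> {a\<^sup>2<..<2 * a * h - a\<^sup>2})
       \<and> (2 * L \<in> {a\<^sup>2<..<2 * a * h - a\<^sup>2} \<longrightarrow>
            infinite (solutions a h L // reparam_rel (solutions a h L)))"
proof (intro conjI impI)
  assume n: "2 * L \<notin> {a\<^sup>2<..<2 * a * h - a\<^sup>2}"
  show "\<exists>!C. C \<in> solutions a h L // reparam_rel (solutions a h L)"
  proof (cases "2 * L \<le> a\<^sup>2 \<and> 2 * L \<le> a * h")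
    case True
    then obtain \<eta> where "\<eta> \<in> solutions a h L" "\<And>\<gamma>. \<gamma> \<in> solutions a h L \<Longrightarrow> reparam \<eta> \<gamma>"
      using low_area_solutions[of a h L] assms by auto
    then show ?thesis by (rule unique_class)
  next
    case False
    define L' where "L' = a * h - L"
    \<comment> \<open>Whichever of the two bounds fails for \<open>L\<close>, the assumption
      \<open>n\<close> yields both of them for the complementary area.\<close>
    have "0 < L'" "2 * L' \<le> a\<^sup>2" "2 * L' \<le> a * h"
      using n False assms(3) by (auto simp: L'_def not_less not_le)
    then obtain \<eta> where \<eta>: "\<eta> \<in> solutions a h L'" "\<And>\<gamma>. \<gamma> \<in> solutions a h L' \<Longrightarrow> reparam \<eta> \<gamma>"
      using low_area_solutions[of a h L'] assms by blast
    have LL: "a * h - L' = L" by (simp add: L'_def)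
    show ?thesis
    proof (rule unique_class)
      show "flip a h \<eta> \<in> solutions a h L" using flip_solutions[OF assms(1,2) \<eta>(1)] by (simp add: LL)
      fix \<gamma> assume "\<gamma> \<in> solutions a h L"
      then have "reparam \<eta> (flip a h \<gamma>)"
        using flip_solutions[OF assms(1,2)] by (intro \<eta>(2)) (simp add: L'_def)
      from reparam_flip[OF this, of a h] show "reparam (flip a h \<eta>) \<gamma>" by simp
    qed
  qed
next
  assume "h \<le> a"
  then have "a * h \<le> a * a" using assms by simp
  then show "2 * L \<notin> {a\<^sup>2<..<2 * a * h - a\<^sup>2}" by (auto simp: power2_eq_square)
next
  assume "2 * L \<in> {a\<^sup>2<..<2 * a * h - a\<^sup>2}"
  then show "infinite (solutions a h L // reparam_rel (solutions a h L))"
    using staircase_classes_infinite assms by auto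
qed

end
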